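(* Let $E$ be a vector lattice with the countable sup property, and suppose that $E^\sim_{\mathrm{oc}}$ separates the points of $E$. Then $E$ admits a (necessarily unique) Hausdorff uo-Lebesgue topology $\widehat\tau_E$. Take an ideal $I$ of $E^\sim_{\mathrm{oc}}$ that separates the points of $E$, and take a vector sublattice $F$ of $E$. Then the following eleven vector sublattices of $E$ are all equal: (1) $a_{\sigma\widehat\tau_E}(F)$ and $\overline{F}^{\sigma\widehat\tau_E}$; (2) $a_{\sigma\mathrm{uo}}(F)$ and $\overline{F}^{\sigma\mathrm{uo}}$; (3) $a_{\mathrm{uo}}(F)$ and $\overline{F}^{\mathrm{uo}}$; (4) $\overline{F}^{\widehat\tau_E}$, $\overline{F}^{|\sigma|(E,I)}$, and $\overline{F}^{\sigma(E,I)}$; (5) $a_{\mathrm{o}}(a_{\mathrm{o}}(F))$ and $\overline{F}^{\mathrm{o}}$.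
   Context: All vector lattices are real and Archimedean. A vector lattice $E$ has the countable sup property if every non-empty subset of $E$ that has a supremum in $E$ has an at most countable subset with the same supremum. A net $(x_\alpha)_{\alpha\in\mathcal A}$ in $E$ is order convergent (o-convergent) to $x$ if there is a net $(y_\beta)_{\beta\in\mathcal B}$ in $E$ (possibly with a different index set) with $y_\beta\downarrow 0$ such that for every $\beta_0\in\mathcal B$ there is $\alpha_0\in\mathcal A$ with $|x-x_\alpha|\le y_{\beta_0}$ for all $\alpha\ge\alpha_0$; it is unbounded order convergent (uo-convergent) to $x$ if $|x_\alpha-x|\wedge y$ is order convergent to $0$ in $E$ for all $y\in E^+$. $E^\sim_{\mathrm{oc}}$ is the vector lattice of order continuous linear functionals on $E$ (those mapping nets order convergent to $0$ to nets convergent to $0$). A uo-Lebesgue topology is a locally solid linear topology (a vector space topology, not necessarily Hausdorff, with a base of solid neighbourhoods of $0$) such that uo-convergence of a net to $x$ implies its topological convergence to $x$. $\sigma(E,I)$ is the weak topology on $E$ induced by $I$, and $|\sigma|(E,I)$ is the topology on $E$ generated by the lattice seminorms $x\mapsto|\varphi|(|x|)$, $\varphi\in I$. For $A\subseteq E$: $a_{\mathrm o}(A)$ and $a_{\mathrm{uo}}(A)$ are the sets of all o-limits, resp. uo-limits, of nets in $A$; $a_{\sigma\mathrm{uo}}(A)$ is the set of all uo-limits of sequences in $A$. $A$ is o-closed (resp. uo-closed, $\sigma$uo-closed) if $a_{\mathrm o}(A)=A$ (resp. $a_{\mathrm{uo}}(A)=A$, $a_{\sigma\mathrm{uo}}(A)=A$);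 these sets are the closed sets of topologies on $E$, in which the closures of $A$ are written $\overline{A}^{\mathrm o}$, $\overline{A}^{\mathrm{uo}}$, $\overline{A}^{\sigma\mathrm{uo}}$, respectively. For a topology $\tau$ on $E$, $\overline{A}^\tau$ is the $\tau$-closure, $a_{\sigma\tau}(A)$ is the set of all $\tau$-limits of sequences in $A$, $A$ is $\sigma\tau$-closed if $a_{\sigma\tau}(A)=A$, the $\sigma\tau$-closed sets are the closed sets of a topology, and $\overline{A}^{\sigma\tau}$ is the closure of $A$ in that topology. *)

theory Defs
  imports
    "HOL-Analysis.Analysis"
    "HOL-Library.Lattice_Algebras"
    "HOL-Library.Lub_Glb"
    "HOL-Library.Countable_Set"
begin

section \<open>Archimedean vector lattices\<close>

class archimedean_vector_lattice = ordered_real_vector + lattice_ab_group_add_abs +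
  assumes archimedean: "0 \<le> x \<Longrightarrow> \<forall>n::nat. real n *\<^sub>R x \<le> y \<Longrightarrow> x = 0"

instance real :: archimedean_vector_lattice
proof
  fix x y :: real
  assume x: "0 \<le> x" and bound: "\<forall>n::nat. real n *\<^sub>R x \<le> y"
  show "x = 0"
  proof (rule ccontr)
    assume "x \<noteq> 0"
    with x have "0 < x" by simp
    then obtain n :: nat where "y < real n * x"
      using reals_Archimedean3 by blast
    with bound[rule_format, of n] show False by simp
  qed
qed

definition vector_sublattice :: "'a::archimedean_vector_lattice set \<Rightarrow> bool" where
  "vector_sublattice F \<longleftrightarrow> subspace F \<and> (\<forall>x\<in>F. \<forall>y\<in>F. sup x y \<in> F \<and> inf x y \<in> F)"

definition countable_sup_property :: "'a::archimedean_vector_lattice itself \<Rightarrow> bool" where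
  "countable_sup_property (_ :: 'a itself) \<longleftrightarrow>
     (\<forall>(A :: 'a set) s. A \<noteq> {} \<and> isLub UNIV A s \<longrightarrow>
        (\<exists>B. B \<subseteq> A \<and> countable B \<and> isLub UNIV B s))"


section \<open>Nets\<close>

text \<open>
  A net consists of an index set \<open>D\<close> directed by a preorder \<open>r\<close> (with \<open>r i j\<close> read as
  \<open>i\<close> below \<open>j\<close>), and a map \<open>x\<close> of which only the values on \<open>D\<close> matter.
\<close>

definition directed_set :: "'i set \<Rightarrow> ('i \<Rightarrow> 'i \<Rightarrow> bool) \<Rightarrow> bool" where
  "directed_set D r \<longleftrightarrow> D \<noteq> {} \<and> reflp_on D r \<and> transp_on D r \<and>
     (\<forall>i\<in>D. \<forall>j\<in>D. \<exists>k\<in>D. r i k \<and> r j k)"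

definition tail_filter :: "'i set \<Rightarrow> ('i \<Rightarrow> 'i \<Rightarrow> bool) \<Rightarrow> 'i filter" where
  "tail_filter D r = (INF i\<in>D. principal {j\<in>D. r i j})"

lemma eventually_tail_filter:
  assumes "directed_set D r"
  shows "eventually P (tail_filter D r) \<longleftrightarrow> (\<exists>i\<in>D. \<forall>j\<in>D. r i j \<longrightarrow> P j)"
proof -
  have "eventually P (tail_filter D r) \<longleftrightarrow>
      (\<exists>i\<in>D. eventually P (principal {j\<in>D. r i j}))"
    unfolding tail_filter_def
  proof (rule eventually_INF_base)
    show "D \<noteq> {}" using assms by (simp add: directed_set_def)
  next
    fix a b assume "a \<in> D" "b \<in> D"
    with assms obtain k where k: "k \<in> D" "r a k" "r b k"
      unfolding directed_set_def by blast
    have "{j\<in>D. r k j} \<subseteq> {j\<in>D. r a j} \<inter> {j\<in>D. r b j}"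
      using assms k \<open>a \<in> D\<close> \<open>b \<in> D\<close> unfolding directed_set_def transp_on_def by blast
    with k(1) show "\<exists>x\<in>D. principal {j\<in>D. r x j} \<le>
        inf (principal {j\<in>D. r a j}) (principal {j\<in>D. r b j})"
      by auto
  qed
  then show ?thesis by (auto simp: eventually_principal)
qed

lemma directed_set_nat: "directed_set (UNIV :: nat set) (\<le>)"
  unfolding directed_set_def
proof (intro conjI ballI)
  fix i j :: nat
  show "\<exists>k\<in>UNIV. i \<le> k \<and> j \<le> k" by (intro bexI[of _ "max i j"]) auto
qed (auto simp: reflp_on_def transp_on_def)

lemma tail_filter_nat: "tail_filter (UNIV :: nat set) (\<le>) = sequentially"
  by (simp add: filter_eq_iff eventually_sequentially eventually_tail_filter[OF directed_set_nat])

text \<open>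
  Quantifiers over nets have to fix a type of indices. Each net in \<open>'a\<close> has the same tails as
  a net whose indices are pairs of a tail and a point of it (\<open>net_reindex\<close> below), so that
  \<open>'a net_index\<close> is large enough to test all nets in \<open>'a\<close>.
\<close>

type_synonym 'a net_index = "'a set \<times> 'a"

lemma net_reindex:
  fixes x :: "'i \<Rightarrow> 'a"
  assumes "directed_set D r"
  obtains D' :: "'a net_index set" and r' x' where
    "directed_set D' r'" "x' ` D' = x ` D"
    "filtermap x' (tail_filter D' r') = filtermap x (tail_filter D r)"
proof -
  define T where "T i = x ` {j\<in>D. r i j}" for i
  define D' where "D' = {(S, s). \<exists>i\<in>D. S = T i \<and> s \<in> S}"
  define r' :: "'a net_index \<Rightarrow> 'a net_index \<Rightarrow> bool" where "r' p q \<longleftrightarrow> fst q \<subseteq> fst p" for p q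
  have refl: "r i i" if "i \<in> D" for i
    using assms that by (auto simp: directed_set_def reflp_on_def)
  have anti: "T k \<subseteq> T i" if "i \<in> D" "k \<in> D" "r i k" for i k
    using assms that unfolding directed_set_def transp_on_def T_def by blast
  have mem: "(T i, x i) \<in> D'" if "i \<in> D" for i
    using that refl[OF that] by (auto simp: D'_def T_def)
  have dir: "directed_set D' r'"
    unfolding directed_set_def
  proof (intro conjI ballI)
    show "D' \<noteq> {}" using assms mem by (auto simp: directed_set_def)
    show "reflp_on D' r'" by (auto simp: reflp_on_def r'_def)
    show "transp_on D' r'" by (auto simp: transp_on_def r'_def)
    fix p q assume "p \<in> D'" "q \<in> D'"
    then obtain i j where ij: "i \<in> D" "j \<in> D" "fst p = T i" "fst q = T j"
      by (auto simp: D'_def)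
    with assms obtain k where k: "k \<in> D" "r i k" "r j k"
      unfolding directed_set_def by blast
    then have "r' p (T k, x k)" "r' q (T k, x k)"
      using anti ij by (auto simp: r'_def)
    with mem[OF k(1)] show "\<exists>m\<in>D'. r' p m \<and> r' q m" by blast
  qed
  have img: "snd ` D' = x ` D"
  proof
    show "snd ` D' \<subseteq> x ` D" by (auto simp: D'_def T_def)
    show "x ` D \<subseteq> snd ` D'" using mem by force
  qed
  have "eventually P (filtermap snd (tail_filter D' r')) \<longleftrightarrow>
      eventually P (filtermap x (tail_filter D r))" for P
  proof -
    have "(\<exists>p\<in>D'. \<forall>q\<in>D'. r' p q \<longrightarrow> P (snd q)) \<longleftrightarrow> (\<exists>i\<in>D. \<forall>j\<in>D. r i j \<longrightarrow> P (x j))"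
    proof
      assume "\<exists>p\<in>D'. \<forall>q\<in>D'. r' p q \<longrightarrow> P (snd q)"
      then obtain p where p: "p \<in> D'" "\<forall>q\<in>D'. r' p q \<longrightarrow> P (snd q)" by blast
      from p(1) obtain i where i: "i \<in> D" "fst p = T i" by (auto simp: D'_def)
      have "P (x j)" if "j \<in> D" "r i j" for j
        using p(2)[rule_format, OF mem[OF that(1)]] anti[OF i(1) that] i(2)
        by (auto simp: r'_def)
      with i(1) show "\<exists>i\<in>D. \<forall>j\<in>D. r i j \<longrightarrow> P (x j)" by blast
    next
      assume "\<exists>i\<in>D. \<forall>j\<in>D. r i j \<longrightarrow> P (x j)"
      then obtain i where i: "i \<in> D" "\<forall>j\<in>D. r i j \<longrightarrow> P (x j)" by blast
      have "P (snd q)" if "q \<in> D'" "r' (T i, x i) q" for q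
      proof -
        have "snd q \<in> fst q" using that(1) by (auto simp: D'_def)
        with that(2) have "snd q \<in> T i" by (auto simp: r'_def)
        with i(2) show ?thesis by (auto simp: T_def)
      qed
      with mem[OF i(1)] show "\<exists>p\<in>D'. \<forall>q\<in>D'. r' p q \<longrightarrow> P (snd q)" by blast
    qed
    then show ?thesis
      by (simp add: eventually_filtermap eventually_tail_filter[OF dir]
          eventually_tail_filter[OF assms])
  qed
  then have "filtermap snd (tail_filter D' r') = filtermap x (tail_filter D r)"
    by (simp add: filter_eq_iff)
  with dir img show ?thesis by (rule that)
qed


section \<open>Order convergence and unbounded order convergence\<close>

definition decreases_to_zero ::
    "'i set \<Rightarrow> ('i \<Rightarrow> 'i \<Rightarrow> bool) \<Rightarrow> ('i \<Rightarrow> 'a::archimedean_vector_lattice) \<Rightarrow> bool" where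
  "decreases_to_zero D r y \<longleftrightarrow> directed_set D r \<and>
     (\<forall>i\<in>D. \<forall>j\<in>D. r i j \<longrightarrow> y j \<le> y i) \<and> isGlb UNIV (y ` D) 0"

text \<open>
  The dominating net may be taken with indices in \<open>'a\<close>: a decreasing net can be replaced by its
  range with the reversed order (\<open>order_limitI\<close> below).
\<close>

definition order_limit ::
    "'i set \<Rightarrow> ('i \<Rightarrow> 'i \<Rightarrow> bool) \<Rightarrow> ('i \<Rightarrow> 'a::archimedean_vector_lattice) \<Rightarrow> 'a \<Rightarrow> bool" where
  "order_limit D r x l \<longleftrightarrow>
     (\<exists>(B :: 'a set) s (y :: 'a \<Rightarrow> 'a). decreases_to_zero B s y \<and>
        (\<forall>b\<in>B. \<exists>i\<in>D. \<forall>j\<in>D. r i j \<longrightarrow> \<bar>l - x j\<bar> \<le> y b))"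

definition uo_limit ::
    "'i set \<Rightarrow> ('i \<Rightarrow> 'i \<Rightarrow> bool) \<Rightarrow> ('i \<Rightarrow> 'a::archimedean_vector_lattice) \<Rightarrow> 'a \<Rightarrow> bool" where
  "uo_limit D r x l \<longleftrightarrow> (\<forall>u\<ge>0. order_limit D r (\<lambda>i. inf \<bar>x i - l\<bar> u) 0)"

lemma order_limitI:
  fixes y :: "'j \<Rightarrow> 'a::archimedean_vector_lattice"
  assumes y: "decreases_to_zero B s y"
    and dom: "\<forall>b\<in>B. \<exists>i\<in>D. \<forall>j\<in>D. r i j \<longrightarrow> \<bar>l - x j\<bar> \<le> y b"
  shows "order_limit D r x l"
proof -
  have dir: "directed_set B s" and anti: "\<And>i j. i \<in> B \<Longrightarrow> j \<in> B \<Longrightarrow> s i j \<Longrightarrow> y j \<le> y i"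
    and inf: "isGlb UNIV (y ` B) 0"
    using y by (auto simp: decreases_to_zero_def)
  have "directed_set (y ` B) (\<lambda>a b. b \<le> a)"
    unfolding directed_set_def
  proof (intro conjI ballI)
    show "y ` B \<noteq> {}" using dir by (auto simp: directed_set_def)
    fix a b assume "a \<in> y ` B" "b \<in> y ` B"
    then obtain i j where ij: "i \<in> B" "j \<in> B" "a = y i" "b = y j" by blast
    with dir obtain k where k: "k \<in> B" "s i k" "s j k" unfolding directed_set_def by blast
    then have "y k \<le> a" "y k \<le> b" using anti ij by auto
    with k(1) show "\<exists>c\<in>y ` B. c \<le> a \<and> c \<le> b" by blast
  qed (auto simp: reflp_on_def transp_on_def)
  then have "decreases_to_zero (y ` B) (\<lambda>a b. b \<le> a) (\<lambda>a. a)"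
    using inf by (simp add: decreases_to_zero_def)
  moreover have "\<forall>b\<in>y ` B. \<exists>i\<in>D. \<forall>j\<in>D. r i j \<longrightarrow> \<bar>l - x j\<bar> \<le> b" using dom by simp
  ultimately show ?thesis unfolding order_limit_def by blast
qed

lemma order_limit_tail_filter:
  assumes "directed_set D r"
  shows "order_limit D r x l \<longleftrightarrow>
     (\<exists>(B :: 'a set) s (y :: 'a \<Rightarrow> 'a::archimedean_vector_lattice). decreases_to_zero B s y \<and>
        (\<forall>b\<in>B. eventually (\<lambda>a. \<bar>l - a\<bar> \<le> y b) (filtermap x (tail_filter D r))))"
  by (simp add: order_limit_def eventually_filtermap eventually_tail_filter[OF assms])

lemma order_limit_cong_filter:
  assumes "directed_set D r" "directed_set D' r'"
    and "filtermap x' (tail_filter D' r') = filtermap x (tail_filter D r)"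
  shows "order_limit D' r' x' l \<longleftrightarrow> order_limit D r x l"
  using assms by (simp add: order_limit_tail_filter)

lemma uo_limit_cong_filter:
  assumes "directed_set D r" "directed_set D' r'"
    and "filtermap x' (tail_filter D' r') = filtermap x (tail_filter D r)"
  shows "uo_limit D' r' x' l \<longleftrightarrow> uo_limit D r x l"
proof -
  have "order_limit D' r' (\<lambda>i. inf \<bar>x' i - l\<bar> u) 0 \<longleftrightarrow> order_limit D r (\<lambda>i. inf \<bar>x i - l\<bar> u) 0" for u
  proof (rule order_limit_cong_filter[OF assms(1,2)])
    show "filtermap (\<lambda>i. inf \<bar>x' i - l\<bar> u) (tail_filter D' r') =
        filtermap (\<lambda>i. inf \<bar>x i - l\<bar> u) (tail_filter D r)"
      using arg_cong[OF assms(3), of "filtermap (\<lambda>a. inf \<bar>a - l\<bar> u)"]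
      by (simp add: filtermap_filtermap)
  qed
  then show ?thesis by (simp add: uo_limit_def)
qed


section \<open>Adherences and closures\<close>

definition adh_o :: "'a::archimedean_vector_lattice set \<Rightarrow> 'a set" where
  "adh_o A = {l. \<exists>(D :: 'a net_index set) r x.
     directed_set D r \<and> x ` D \<subseteq> A \<and> order_limit D r x l}"

definition adh_uo :: "'a::archimedean_vector_lattice set \<Rightarrow> 'a set" where
  "adh_uo A = {l. \<exists>(D :: 'a net_index set) r x.
     directed_set D r \<and> x ` D \<subseteq> A \<and> uo_limit D r x l}"

definition adh_suo :: "'a::archimedean_vector_lattice set \<Rightarrow> 'a set" where
  "adh_suo A = {l. \<exists>x :: nat \<Rightarrow> 'a. range x \<subseteq> A \<and> uo_limit UNIV (\<le>) x l}"

definition adh_seq :: "'a topology \<Rightarrow> 'a set \<Rightarrow> 'a set" where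
  "adh_seq T A = {l. \<exists>x :: nat \<Rightarrow> 'a. range x \<subseteq> A \<and> limitin T x l sequentially}"

lemma adh_oI:
  fixes x :: "'i \<Rightarrow> 'a::archimedean_vector_lattice"
  assumes "directed_set D r" "x ` D \<subseteq> A" "order_limit D r x l"
  shows "l \<in> adh_o A"
proof -
  obtain D' :: "'a net_index set" and r' x' where D': "directed_set D' r'" "x' ` D' = x ` D"
    "filtermap x' (tail_filter D' r') = filtermap x (tail_filter D r)"
    using net_reindex[OF assms(1)] .
  have "order_limit D' r' x' l"
    using order_limit_cong_filter[OF assms(1) D'(1,3)] assms(3) by simp
  moreover have "x' ` D' \<subseteq> A" using D'(2) assms(2) by simp
  ultimately show ?thesis using D'(1) unfolding adh_o_def by blast
qed

lemma adh_uoI: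
  fixes x :: "'i \<Rightarrow> 'a::archimedean_vector_lattice"
  assumes "directed_set D r" "x ` D \<subseteq> A" "uo_limit D r x l"
  shows "l \<in> adh_uo A"
proof -
  obtain D' :: "'a net_index set" and r' x' where D': "directed_set D' r'" "x' ` D' = x ` D"
    "filtermap x' (tail_filter D' r') = filtermap x (tail_filter D r)"
    using net_reindex[OF assms(1)] .
  have "uo_limit D' r' x' l"
    using uo_limit_cong_filter[OF assms(1) D'(1,3)] assms(3) by simp
  moreover have "x' ` D' \<subseteq> A" using D'(2) assms(2) by simp
  ultimately show ?thesis using D'(1) unfolding adh_uo_def by blast
qed

text \<open>
  The topology whose closed sets are the sets \<open>A\<close> with \<open>c A = A\<close>. That this is a topology for
  each of the four adherences above is shown at the end of this section.
\<close>

definition adh_topology :: "('a set \<Rightarrow> 'a set) \<Rightarrow> 'a topology" where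
  "adh_topology c = topology (\<lambda>U. c (- U) = - U)"

lemma closedin_adh_topology:
  assumes ext: "\<And>A. A \<subseteq> c A" and mono: "\<And>A B. A \<subseteq> B \<Longrightarrow> c A \<subseteq> c B"
    and empty: "c {} = {}" and Un: "\<And>A B. c (A \<union> B) \<subseteq> c A \<union> c B"
  shows "closedin (adh_topology c) A \<longleftrightarrow> c A = A"
proof -
  have "istopology (\<lambda>U. c (- U) = - U)"
    unfolding istopology_def
  proof (intro conjI allI impI)
    fix S T assume S: "c (- S) = - S" and T: "c (- T) = - T"
    have "c (- S \<union> - T) \<subseteq> - S \<union> - T" using Un[of "- S" "- T"] S T by simp
    then have "c (- (S \<inter> T)) \<subseteq> - (S \<inter> T)" by (simp only: Compl_Int)
    with ext show "c (- (S \<inter> T)) = - (S \<inter> T)" by (rule equalityI[rotated])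
  next
    fix K assume K: "\<forall>U\<in>K. c (- U) = - U"
    have "c (- \<Union>K) \<subseteq> - U" if "U \<in> K" for U
      using mono[of "- \<Union>K" "- U"] K that by auto
    then show "c (- \<Union>K) = - \<Union>K" using ext[of "- \<Union>K"] by blast
  qed
  then have op: "openin (adh_topology c) U \<longleftrightarrow> c (- U) = - U" for U
    by (simp add: adh_topology_def)
  have "openin (adh_topology c) UNIV" by (simp add: op empty)
  then have "topspace (adh_topology c) = UNIV" by (metis openin_subset top.extremum_uniqueI)
  then show ?thesis by (simp add: closedin_def op Compl_eq_Diff_UNIV[symmetric])
qed

lemma decreases_to_zero_const: "decreases_to_zero {0} (\<lambda>_ _. True) (\<lambda>_. 0 :: 'a::archimedean_vector_lattice)"
  by (auto simp: decreases_to_zero_def directed_set_def reflp_on_def transp_on_def isGlb_def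
      greatestP_def isLb_def setge_def setle_def)

lemma order_limit_const:
  assumes "directed_set D r" "\<forall>i\<in>D. x i = l"
  shows "order_limit D r x l"
proof (rule order_limitI[OF decreases_to_zero_const])
  from assms(1) obtain i where "i \<in> D" unfolding directed_set_def by blast
  with assms(2) show "\<forall>b\<in>{0}. \<exists>i\<in>D. \<forall>j\<in>D. r i j \<longrightarrow> \<bar>l - x j\<bar> \<le> 0" by auto
qed

lemma uo_limit_const:
  assumes "directed_set D r" "\<forall>i\<in>D. x i = l"
  shows "uo_limit D r x l"
  unfolding uo_limit_def using assms by (auto intro!: order_limit_const simp: inf_absorb1)

lemma directed_set_singleton: "directed_set {i} (\<lambda>_ _. True)"
  by (auto simp: directed_set_def reflp_on_def transp_on_def)

lemma directed_set_cofinal: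
  assumes D: "directed_set D r" and "E \<subseteq> D" and cof: "\<forall>i\<in>D. \<exists>j\<in>E. r i j"
  shows "directed_set E r"
  unfolding directed_set_def
proof (intro conjI ballI)
  show "E \<noteq> {}" using D cof unfolding directed_set_def by blast
  show "reflp_on E r" using D \<open>E \<subseteq> D\<close> unfolding directed_set_def reflp_on_def by blast
  show "transp_on E r" using D \<open>E \<subseteq> D\<close> unfolding directed_set_def transp_on_def by blast
  fix i j assume ij: "i \<in> E" "j \<in> E"
  then obtain k where k: "k \<in> D" "r i k" "r j k"
    using D \<open>E \<subseteq> D\<close> unfolding directed_set_def by blast
  with cof obtain m where m: "m \<in> E" "r k m" by blast
  have "r i m" "r j m"
    using D \<open>E \<subseteq> D\<close> ij k m unfolding directed_set_def transp_on_def by blast+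
  with m(1) show "\<exists>k\<in>E. r i k \<and> r j k" by blast
qed

lemma order_limit_cofinal:
  fixes x :: "'i \<Rightarrow> 'a::archimedean_vector_lattice"
  assumes D: "directed_set D r" and "E \<subseteq> D" and cof: "\<forall>i\<in>D. \<exists>j\<in>E. r i j"
    and lim: "order_limit D r x l"
  shows "order_limit E r x l"
proof -
  have tail: "\<exists>i\<in>E. \<forall>j\<in>E. r i j \<longrightarrow> P j" if "\<exists>i\<in>D. \<forall>j\<in>D. r i j \<longrightarrow> P j" for P
  proof -
    from that obtain i where i: "i \<in> D" "\<forall>j\<in>D. r i j \<longrightarrow> P j" by blast
    with cof obtain k where k: "k \<in> E" "r i k" by blast
    have "P j" if "j \<in> E" "r k j" for j
    proof -
      have "r i j"
        using D i(1) k that \<open>E \<subseteq> D\<close> unfolding directed_set_def transp_on_def by blast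
      with i(2) that(1) \<open>E \<subseteq> D\<close> show ?thesis by blast
    qed
    with k(1) show ?thesis by blast
  qed
  from lim obtain B :: "'a set" and s and y :: "'a \<Rightarrow> 'a" where
    y: "decreases_to_zero B s y" "\<forall>b\<in>B. \<exists>i\<in>D. \<forall>j\<in>D. r i j \<longrightarrow> \<bar>l - x j\<bar> \<le> y b"
    unfolding order_limit_def by blast
  show ?thesis by (rule order_limitI[OF y(1)]) (use y(2) tail in simp)
qed

lemma uo_limit_cofinal:
  assumes "directed_set D r" "E \<subseteq> D" "\<forall>i\<in>D. \<exists>j\<in>E. r i j" "uo_limit D r x l"
  shows "uo_limit E r x l"
  using assms order_limit_cofinal unfolding uo_limit_def by blast

lemma directed_set_split:
  assumes D: "directed_set D r" and "x ` D \<subseteq> A \<union> B"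
  obtains E where "E \<subseteq> D" "\<forall>i\<in>D. \<exists>j\<in>E. r i j" "x ` E \<subseteq> A \<or> x ` E \<subseteq> B"
proof (cases "\<forall>i\<in>D. \<exists>j\<in>{j\<in>D. x j \<in> A}. r i j")
  case True
  then show ?thesis by (intro that[of "{j\<in>D. x j \<in> A}"]) auto
next
  case False
  then obtain i where i: "i \<in> D" "\<forall>j\<in>D. r i j \<longrightarrow> x j \<notin> A" by blast
  have "\<exists>j\<in>{j\<in>D. r i j}. r k j" if "k \<in> D" for k
    using D i(1) that unfolding directed_set_def by blast
  moreover have "x ` {j\<in>D. r i j} \<subseteq> B" using i(2) assms(2) by blast
  ultimately show ?thesis by (intro that[of "{j\<in>D. r i j}"]) auto
qed

lemma sequence_split:
  fixes x :: "nat \<Rightarrow> 'a"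
  assumes "range x \<subseteq> A \<union> B"
  obtains f :: "nat \<Rightarrow> nat" where "strict_mono f" "range (x \<circ> f) \<subseteq> A \<or> range (x \<circ> f) \<subseteq> B"
proof -
  have "infinite {n. x n \<in> A} \<or> infinite {n. x n \<in> B}"
  proof -
    have "{n. x n \<in> A} \<union> {n. x n \<in> B} = UNIV" using assms by auto
    then show ?thesis by (metis finite_UnI infinite_UNIV_nat)
  qed
  then show ?thesis
  proof
    assume "infinite {n. x n \<in> A}"
    then show ?thesis
      using that[of "enumerate {n. x n \<in> A}"] enumerate_in_set[of "{n. x n \<in> A}"]
      by (auto simp: strict_mono_enumerate)
  next
    assume "infinite {n. x n \<in> B}"
    then show ?thesis
      using that[of "enumerate {n. x n \<in> B}"] enumerate_in_set[of "{n. x n \<in> B}"]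
      by (auto simp: strict_mono_enumerate)
  qed
qed

lemma uo_limit_subsequence:
  fixes x :: "nat \<Rightarrow> 'a::archimedean_vector_lattice" and f :: "nat \<Rightarrow> nat"
  assumes "uo_limit UNIV (\<le>) x l" "strict_mono f"
  shows "uo_limit UNIV (\<le>) (x \<circ> f) l"
proof -
  have "order_limit UNIV (\<le>) (z \<circ> f) 0" if "order_limit UNIV (\<le>) z 0" for z :: "nat \<Rightarrow> 'a"
  proof -
    from that obtain B :: "'a set" and s and y :: "'a \<Rightarrow> 'a" where y: "decreases_to_zero B s y"
      and dom: "\<forall>b\<in>B. \<exists>i. \<forall>j\<ge>i. \<bar>0 - z j\<bar> \<le> y b"
      unfolding order_limit_def by auto
    have "\<exists>i. \<forall>j\<ge>i. \<bar>0 - z (f j)\<bar> \<le> y b" if "b \<in> B" for b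
      using dom that seq_suble[OF assms(2)] by (meson order.trans)
    then show ?thesis by (intro order_limitI[OF y]) simp
  qed
  from this[of "\<lambda>i. inf \<bar>x i - l\<bar> u" for u] show ?thesis
    using assms(1) unfolding uo_limit_def o_def by blast
qed

proposition closedin_o_topology: "closedin (adh_topology adh_o) A \<longleftrightarrow> adh_o A = A"
proof (rule closedin_adh_topology)
  fix A B :: "'a set"
  show "A \<subseteq> adh_o A"
  proof
    fix a assume "a \<in> A"
    then show "a \<in> adh_o A"
      by (intro adh_oI[OF directed_set_singleton[of "()"], of "\<lambda>_. a"] order_limit_const
          directed_set_singleton) auto
  qed
  show "A \<subseteq> B \<Longrightarrow> adh_o A \<subseteq> adh_o B" unfolding adh_o_def by blast
  show "adh_o {} = ({} :: 'a set)" by (auto simp: adh_o_def directed_set_def)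
  show "adh_o (A \<union> B) \<subseteq> adh_o A \<union> adh_o B"
  proof
    fix l assume "l \<in> adh_o (A \<union> B)"
    then obtain D :: "'a net_index set" and r x where
      D: "directed_set D r" "x ` D \<subseteq> A \<union> B" "order_limit D r x l"
      unfolding adh_o_def by blast
    obtain E where E: "E \<subseteq> D" "\<forall>i\<in>D. \<exists>j\<in>E. r i j" "x ` E \<subseteq> A \<or> x ` E \<subseteq> B"
      using directed_set_split[OF D(1,2)] .
    show "l \<in> adh_o A \<union> adh_o B"
      using adh_oI[OF directed_set_cofinal[OF D(1) E(1,2)] _
          order_limit_cofinal[OF D(1) E(1,2) D(3)]] E(3) by blast
  qed
qed

proposition closedin_uo_topology: "closedin (adh_topology adh_uo) A \<longleftrightarrow> adh_uo A = A"
proof (rule closedin_adh_topology)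
  fix A B :: "'a set"
  show "A \<subseteq> adh_uo A"
  proof
    fix a assume "a \<in> A"
    then show "a \<in> adh_uo A"
      by (intro adh_uoI[OF directed_set_singleton[of "()"], of "\<lambda>_. a"] uo_limit_const
          directed_set_singleton) auto
  qed
  show "A \<subseteq> B \<Longrightarrow> adh_uo A \<subseteq> adh_uo B" unfolding adh_uo_def by blast
  show "adh_uo {} = ({} :: 'a set)" by (auto simp: adh_uo_def directed_set_def)
  show "adh_uo (A \<union> B) \<subseteq> adh_uo A \<union> adh_uo B"
  proof
    fix l assume "l \<in> adh_uo (A \<union> B)"
    then obtain D :: "'a net_index set" and r x where
      D: "directed_set D r" "x ` D \<subseteq> A \<union> B" "uo_limit D r x l"
      unfolding adh_uo_def by blast
    obtain E where E: "E \<subseteq> D" "\<forall>i\<in>D. \<exists>j\<in>E. r i j" "x ` E \<subseteq> A \<or> x ` E \<subseteq> B"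
      using directed_set_split[OF D(1,2)] .
    show "l \<in> adh_uo A \<union> adh_uo B"
      using adh_uoI[OF directed_set_cofinal[OF D(1) E(1,2)] _
          uo_limit_cofinal[OF D(1) E(1,2) D(3)]] E(3) by blast
  qed
qed

proposition closedin_suo_topology: "closedin (adh_topology adh_suo) A \<longleftrightarrow> adh_suo A = A"
proof (rule closedin_adh_topology)
  fix A B :: "'a set"
  show "A \<subseteq> adh_suo A"
  proof
    fix a assume "a \<in> A"
    moreover have "uo_limit UNIV (\<le>) (\<lambda>_::nat. a) a"
      by (rule uo_limit_const[OF directed_set_nat]) simp
    ultimately show "a \<in> adh_suo A"
      unfolding adh_suo_def by (intro CollectI exI[of _ "\<lambda>_. a"]) auto
  qed
  show "A \<subseteq> B \<Longrightarrow> adh_suo A \<subseteq> adh_suo B" unfolding adh_suo_def by blast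
  show "adh_suo {} = ({} :: 'a set)" by (auto simp: adh_suo_def)
  show "adh_suo (A \<union> B) \<subseteq> adh_suo A \<union> adh_suo B"
  proof
    fix l assume "l \<in> adh_suo (A \<union> B)"
    then obtain x :: "nat \<Rightarrow> 'a" where x: "range x \<subseteq> A \<union> B" "uo_limit UNIV (\<le>) x l"
      unfolding adh_suo_def by blast
    obtain f :: "nat \<Rightarrow> nat" where
      "strict_mono f" "range (x \<circ> f) \<subseteq> A \<or> range (x \<circ> f) \<subseteq> B"
      using sequence_split[OF x(1)] .
    with uo_limit_subsequence[OF x(2)] show "l \<in> adh_suo A \<union> adh_suo B"
      unfolding adh_suo_def by blast
  qed
qed

proposition closedin_seq_topology:
  assumes "topspace T = UNIV"
  shows "closedin (adh_topology (adh_seq T)) A \<longleftrightarrow> adh_seq T A = A"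
proof (rule closedin_adh_topology)
  fix A B :: "'a set"
  show "A \<subseteq> adh_seq T A"
  proof
    fix a assume "a \<in> A"
    moreover have "limitin T (\<lambda>_::nat. a) a sequentially" by (simp add: limitin_def assms)
    ultimately show "a \<in> adh_seq T A"
      unfolding adh_seq_def by (intro CollectI exI[of _ "\<lambda>_. a"]) auto
  qed
  show "A \<subseteq> B \<Longrightarrow> adh_seq T A \<subseteq> adh_seq T B" unfolding adh_seq_def by blast
  show "adh_seq T {} = {}" by (auto simp: adh_seq_def)
  show "adh_seq T (A \<union> B) \<subseteq> adh_seq T A \<union> adh_seq T B"
  proof
    fix l assume "l \<in> adh_seq T (A \<union> B)"
    then obtain x :: "nat \<Rightarrow> 'a" where x: "range x \<subseteq> A \<union> B" "limitin T x l sequentially"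
      unfolding adh_seq_def by blast
    obtain f :: "nat \<Rightarrow> nat" where
      "strict_mono f" "range (x \<circ> f) \<subseteq> A \<or> range (x \<circ> f) \<subseteq> B"
      using sequence_split[OF x(1)] .
    with limitin_subsequence[OF _ x(2)] show "l \<in> adh_seq T A \<union> adh_seq T B"
      unfolding adh_seq_def by blast
  qed
qed


section \<open>Order continuous functionals\<close>

definition oc_dual :: "('a::archimedean_vector_lattice \<Rightarrow> real) set" where
  "oc_dual = {\<phi>. linear \<phi> \<and>
     (\<forall>(D :: 'a net_index set) r x. directed_set D r \<and> order_limit D r x 0 \<longrightarrow>
        ((\<lambda>i. \<phi> (x i)) \<longlongrightarrow> 0) (tail_filter D r))}"

lemma oc_dualD:
  fixes x :: "'i \<Rightarrow> 'a::archimedean_vector_lattice"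
  assumes "\<phi> \<in> oc_dual" "directed_set D r" "order_limit D r x 0"
  shows "((\<lambda>i. \<phi> (x i)) \<longlongrightarrow> 0) (tail_filter D r)"
proof -
  obtain D' :: "'a net_index set" and r' x' where D': "directed_set D' r'"
    and "x' ` D' = x ` D" and eq: "filtermap x' (tail_filter D' r') = filtermap x (tail_filter D r)"
    using net_reindex[OF assms(2)] .
  have "order_limit D' r' x' 0"
    using order_limit_cong_filter[OF assms(2) D' eq] assms(3) by simp
  then have "((\<lambda>i. \<phi> (x' i)) \<longlongrightarrow> 0) (tail_filter D' r')"
    using assms(1) D' unfolding oc_dual_def by blast
  then have "(\<phi> \<longlongrightarrow> 0) (filtermap x' (tail_filter D' r'))"
    by (simp add: filterlim_filtermap)
  then show ?thesis by (simp add: eq filterlim_filtermap)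
qed

definition functional_le ::
    "('a::archimedean_vector_lattice \<Rightarrow> real) \<Rightarrow> ('a \<Rightarrow> real) \<Rightarrow> bool" where
  "functional_le \<phi> \<psi> \<longleftrightarrow> (\<forall>x\<ge>0. \<phi> x \<le> \<psi> x)"

text \<open>The modulus in the vector lattice \<open>oc_dual\<close>, i.e. the supremum of \<open>\<phi>\<close> and \<open>- \<phi>\<close> there.\<close>

definition oc_abs :: "('a::archimedean_vector_lattice \<Rightarrow> real) \<Rightarrow> 'a \<Rightarrow> real" where
  "oc_abs \<phi> = (THE \<psi>. \<psi> \<in> oc_dual \<and> functional_le \<phi> \<psi> \<and> functional_le (\<lambda>x. - \<phi> x) \<psi> \<and>
     (\<forall>\<theta>\<in>oc_dual. functional_le \<phi> \<theta> \<and> functional_le (\<lambda>x. - \<phi> x) \<theta> \<longrightarrow> functional_le \<psi> \<theta>))"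

definition oc_ideal :: "('a::archimedean_vector_lattice \<Rightarrow> real) set \<Rightarrow> bool" where
  "oc_ideal I \<longleftrightarrow> I \<subseteq> oc_dual \<and> (\<lambda>x. 0) \<in> I \<and>
     (\<forall>\<phi>\<in>I. \<forall>\<psi>\<in>I. (\<lambda>x. \<phi> x + \<psi> x) \<in> I) \<and>
     (\<forall>c. \<forall>\<phi>\<in>I. (\<lambda>x. c * \<phi> x) \<in> I) \<and>
     (\<forall>\<phi>\<in>I. \<forall>\<psi>\<in>oc_dual. functional_le (oc_abs \<psi>) (oc_abs \<phi>) \<longrightarrow> \<psi> \<in> I)"

definition separates_points :: "('a \<Rightarrow> real) set \<Rightarrow> bool" where
  "separates_points I \<longleftrightarrow> (\<forall>x y. x \<noteq> y \<longrightarrow> (\<exists>\<phi>\<in>I. \<phi> x \<noteq> \<phi> y))"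


section \<open>Linear topologies\<close>

definition linear_topology :: "'a::real_vector topology \<Rightarrow> bool" where
  "linear_topology T \<longleftrightarrow> topspace T = UNIV \<and>
     continuous_map (prod_topology T T) T (\<lambda>(x, y). x + y) \<and>
     continuous_map (prod_topology euclideanreal T) T (\<lambda>(c, x). c *\<^sub>R x)"

definition solid :: "'a::archimedean_vector_lattice set \<Rightarrow> bool" where
  "solid S \<longleftrightarrow> (\<forall>x y. y \<in> S \<and> \<bar>x\<bar> \<le> \<bar>y\<bar> \<longrightarrow> x \<in> S)"

definition locally_solid :: "'a::archimedean_vector_lattice topology \<Rightarrow> bool" where
  "locally_solid T \<longleftrightarrow> linear_topology T \<and>
     (\<forall>U. openin T U \<and> 0 \<in> U \<longrightarrow>
        (\<exists>V W. solid V \<and> V \<subseteq> U \<and> openin T W \<and> 0 \<in> W \<and> W \<subseteq> V))"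

definition uo_Lebesgue :: "'a::archimedean_vector_lattice topology \<Rightarrow> bool" where
  "uo_Lebesgue T \<longleftrightarrow> locally_solid T \<and>
     (\<forall>(D :: 'a net_index set) r x l. directed_set D r \<and> uo_limit D r x l \<longrightarrow>
        limitin T x l (tail_filter D r))"

lemma uo_LebesgueD:
  fixes x :: "'i \<Rightarrow> 'a::archimedean_vector_lattice"
  assumes "uo_Lebesgue T" "directed_set D r" "uo_limit D r x l"
  shows "limitin T x l (tail_filter D r)"
proof -
  obtain D' :: "'a net_index set" and r' x' where D': "directed_set D' r'"
    and "x' ` D' = x ` D" and eq: "filtermap x' (tail_filter D' r') = filtermap x (tail_filter D r)"
    using net_reindex[OF assms(2)] .
  have "uo_limit D' r' x' l"
    using uo_limit_cong_filter[OF assms(2) D' eq] assms(3) by simp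
  then have lim: "limitin T x' l (tail_filter D' r')"
    using assms(1) D' unfolding uo_Lebesgue_def by blast
  have "eventually (\<lambda>i. x' i \<in> U) (tail_filter D' r') \<longleftrightarrow>
      eventually (\<lambda>i. x i \<in> U) (tail_filter D r)" for U
    using arg_cong[OF eq, of "eventually (\<lambda>a. a \<in> U)"] by (simp add: eventually_filtermap)
  with lim show ?thesis by (auto simp: limitin_def)
qed

definition weak_topology_of :: "('a \<Rightarrow> real) set \<Rightarrow> 'a topology" where
  "weak_topology_of I = topology_generated_by {\<phi> -` U |\<phi> U. \<phi> \<in> I \<and> open U}"

definition abs_weak_topology_of ::
    "('a::archimedean_vector_lattice \<Rightarrow> real) set \<Rightarrow> 'a topology" where
  "abs_weak_topology_of I =
     topology_generated_by {{x. oc_abs \<phi> \<bar>x - a\<bar> < e} |\<phi> a e. \<phi> \<in> I \<and> 0 < e}"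

end

theory Submission
  imports Defs
begin

text \<open>
  Let \<open>T\<close> be a Hausdorff uo-Lebesgue topology. The countable sup property yields, for each \<open>u \<ge> 0\<close>,
  countably many solid \<open>T\<close>-neighbourhoods that separate the points of the order interval from 0 to
  \<open>u\<close>. Hence every point of the \<open>T\<close>-closure of an arbitrary set is the uo-limit of a sequence in
  this set: take a sequence that converges fast for the neighbourhoods belonging to its own terms.
  So \<open>T\<close>-closed, uo-closed and sequentially uo-closed sets are the same, which gives both the
  uniqueness of \<open>T\<close> and the equality of all adherences and closures with respect to \<open>T\<close> and
  uo-convergence. In particular \<open>T\<close> is generated by the maps \<open>\<phi> (inf \<bar>x\<bar> u)\<close> with \<open>\<phi> \<ge> 0\<close> in
  \<open>I\<close>, for every separating ideal \<open>I\<close>. A uo-limit of a sequence in a sublattice is obtained by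
  two successive order limits of truncations, so it lies in the closures for the (absolute) weak
  topology; conversely, by the Hahn-Banach theorem, the weak closure of a subspace is contained in
  its \<open>T\<close>-closure.
\<close>

section \<open>Estimates in vector lattices\<close>

text \<open>The space need not be Dedekind complete and the topology need not be metrizable; these
  two obstacles shape the proof. Where a supremum of partial sums or a limit superior is wanted,
  upper bounds are used instead: every neighbourhood contains a gap between some upper bound of a
  bounded directed set and one of its elements. Countably many neighbourhoods need not separate all
  points of the space, but on one order interval they can be made to: below each nonzero
  \<open>c\<close> there is a nonzero piece on which a single halving sequence separates points, the
  pieces below \<open>u\<close> have supremum \<open>u\<close>, and the countable sup property
  extracts countably many of them, whose sequences are merged diagonally. The set whose closure is
  taken is arbitrary, so its elements share no order interval; this is why each term of the sequence
  contributes the neighbourhoods of its own interval.\<close>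

lemma inf_add_le:
  fixes a b c :: "'a::archimedean_vector_lattice"
  assumes "0 \<le> a" "0 \<le> b" "0 \<le> c"
  shows "inf (a + b) c \<le> inf a c + inf b c"
proof -
  have "inf a c + inf b c = inf (inf (a + b) (c + b)) (inf (a + c) (c + c))"
    by (simp add: add_inf_distrib_left add_inf_distrib_right inf_aci)
  moreover have "c \<le> c + b" "c \<le> a + c" "c \<le> c + c" using assms by auto
  moreover have "inf (a + b) c \<le> a + b" "inf (a + b) c \<le> c" by auto
  ultimately show ?thesis by (simp only: le_inf_iff) (blast intro: order_trans)
qed

lemma inf_scaleR_nat_le:
  fixes a b :: "'a::archimedean_vector_lattice"
  assumes "0 \<le> a" "0 \<le> b"
  shows "inf (real k *\<^sub>R a) b \<le> real k *\<^sub>R inf a b"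
proof (induction k)
  case 0
  then show ?case by simp
next
  case (Suc k)
  have "inf (real (Suc k) *\<^sub>R a) b = inf (a + real k *\<^sub>R a) b"
    by (simp add: algebra_simps)
  also have "\<dots> \<le> inf a b + inf (real k *\<^sub>R a) b"
    using assms by (intro inf_add_le) (auto intro: scaleR_nonneg_nonneg)
  also have "\<dots> \<le> inf a b + real k *\<^sub>R inf a b" using Suc by simp
  finally show ?case by (simp add: algebra_simps)
qed

lemma inf_scaleR_le:
  fixes a b :: "'a::archimedean_vector_lattice"
  assumes "0 \<le> a" "0 \<le> b" "0 \<le> c" "c \<le> K" "1 \<le> K"
  shows "inf (c *\<^sub>R a) b \<le> K *\<^sub>R inf a b"
proof -
  have "inf (c *\<^sub>R a) b \<le> K *\<^sub>R a"
    using scaleR_right_mono[OF assms(4,1)] by (rule le_infI1)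
  moreover have "inf (c *\<^sub>R a) b \<le> K *\<^sub>R b"
    using scaleR_right_mono[OF assms(5,2)] by (intro le_infI2) simp
  ultimately have "(1 / K) *\<^sub>R inf (c *\<^sub>R a) b \<le> inf a b"
    using assms scaleR_left_mono[of "inf (c *\<^sub>R a) b" "K *\<^sub>R _" "1 / K"] by auto
  then show ?thesis
    using assms scaleR_left_mono[of "(1 / K) *\<^sub>R inf (c *\<^sub>R a) b" "inf a b" K] by auto
qed

lemma abs_scaleR_le:
  fixes x :: "'a::archimedean_vector_lattice"
  shows "\<bar>c *\<^sub>R x\<bar> \<le> \<bar>c\<bar> *\<^sub>R \<bar>x\<bar>"
proof (rule abs_leI)
  show "c *\<^sub>R x \<le> \<bar>c\<bar> *\<^sub>R \<bar>x\<bar>"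
  proof (cases "0 \<le> c")
    case True
    then show ?thesis by (simp add: scaleR_left_mono abs_ge_self)
  next
    case False
    then have "(- c) *\<^sub>R (- x) \<le> (- c) *\<^sub>R \<bar>x\<bar>"
      by (intro scaleR_left_mono abs_ge_minus_self) auto
    with False show ?thesis by simp
  qed
  show "- (c *\<^sub>R x) \<le> \<bar>c\<bar> *\<^sub>R \<bar>x\<bar>"
  proof (cases "0 \<le> c")
    case True
    then have "c *\<^sub>R (- x) \<le> c *\<^sub>R \<bar>x\<bar>"
      by (intro scaleR_left_mono abs_ge_minus_self) auto
    with True show ?thesis by simp
  next
    case False
    then have "(- c) *\<^sub>R x \<le> (- c) *\<^sub>R \<bar>x\<bar>"
      by (intro scaleR_left_mono abs_ge_self) auto
    with False show ?thesis by simp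
  qed
qed

lemma abs_diff_leI:
  fixes a b c :: "'a::archimedean_vector_lattice"
  assumes "a \<le> b + c" "b \<le> a + c"
  shows "\<bar>a - b\<bar> \<le> c"
  using assms by (intro abs_leI) (auto simp: algebra_simps)

lemma le_add_abs_diff:
  fixes a b :: "'a::archimedean_vector_lattice"
  shows "a \<le> b + \<bar>a - b\<bar>" "b \<le> a + \<bar>a - b\<bar>"
  using abs_ge_self[of "a - b"] abs_ge_minus_self[of "a - b"] by (auto simp: algebra_simps)

lemma abs_sup_diff_le:
  fixes a b :: "'a::archimedean_vector_lattice"
  shows "\<bar>sup a b - sup c d\<bar> \<le> \<bar>a - c\<bar> + \<bar>b - d\<bar>"
proof -
  have *: "sup a b \<le> sup c d + (\<bar>a - c\<bar> + \<bar>b - d\<bar>)" for a b c d :: 'a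
  proof (rule sup_least)
    have "a \<le> c + \<bar>a - c\<bar>" by (rule le_add_abs_diff)
    also have "\<dots> \<le> sup c d + (\<bar>a - c\<bar> + \<bar>b - d\<bar>)" by (intro add_mono) auto
    finally show "a \<le> sup c d + (\<bar>a - c\<bar> + \<bar>b - d\<bar>)" .
    have "b \<le> d + \<bar>b - d\<bar>" by (rule le_add_abs_diff)
    also have "\<dots> \<le> sup c d + (\<bar>a - c\<bar> + \<bar>b - d\<bar>)" by (intro add_mono) auto
    finally show "b \<le> sup c d + (\<bar>a - c\<bar> + \<bar>b - d\<bar>)" .
  qed
  from *[of a b c d] *[of c d a b] show ?thesis
    by (intro abs_diff_leI) (auto simp: abs_minus_commute)
qed

lemma abs_inf_diff_le:
  fixes a b :: "'a::archimedean_vector_lattice"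
  shows "\<bar>inf a b - inf c d\<bar> \<le> \<bar>a - c\<bar> + \<bar>b - d\<bar>"
proof -
  have "sup (- a) (- b) - sup (- c) (- d) = - (inf a b - inf c d)"
    by (simp only: neg_inf_eq_sup[symmetric] minus_diff_minus)
  moreover have "- a - - c = - (a - c)" "- b - - d = - (b - d)"
    by (simp_all only: minus_diff_minus)
  ultimately show ?thesis
    using abs_sup_diff_le[of "- a" "- b" "- c" "- d"] by (simp only: abs_minus_cancel)
qed

lemma abs_diff_triangle:
  fixes x y z :: "'a::archimedean_vector_lattice"
  shows "\<bar>z - x\<bar> \<le> \<bar>z - y\<bar> + \<bar>y - x\<bar>"
  using abs_triangle_ineq[of "z - y" "y - x"] by simp

text \<open>An induction on the multiples of \<open>b\<close>: the step may use that the current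
  multiple is below \<open>c\<close>, which is how membership in a set of elements below
  \<open>c\<close> enters the later arguments.\<close>

lemma archimedean_all_nat:
  fixes b :: "'a::archimedean_vector_lattice"
  assumes "0 \<le> b" "0 \<le> c" "\<And>k. real k *\<^sub>R b \<le> c \<Longrightarrow> b + real k *\<^sub>R b \<le> c"
  shows "b = 0"
proof (rule archimedean[OF assms(1)], rule allI)
  fix n
  show "real n *\<^sub>R b \<le> c"
    by (induction n) (use assms in \<open>auto simp: algebra_simps\<close>)
qed

section \<open>Truncation to an order interval\<close>

definition truncation :: "'a::archimedean_vector_lattice \<Rightarrow> 'a \<Rightarrow> 'a" where
  "truncation u x = sup (inf x u) (- u)"

lemma abs_truncation_le: "0 \<le> u \<Longrightarrow> \<bar>truncation u x\<bar> \<le> u"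
  unfolding truncation_def
  by (intro abs_leI) (auto intro: order_trans[of _ 0] le_infI2)

lemma truncation_eq: "\<bar>x\<bar> \<le> u \<Longrightarrow> truncation u x = x"
  unfolding truncation_def by (auto simp: abs_le_iff inf_absorb1 sup_absorb1 minus_le_iff)

text \<open>Together with \<open>abs_truncation_le\<close> this gives, for \<open>u \<ge> 0\<close>,
  the Riesz decomposition of \<open>x\<close> into a part of modulus at most \<open>u\<close> and a
  rest of modulus at most \<open>v\<close>, with an explicit first part.\<close>

lemma abs_diff_truncation_le:
  fixes x u v :: "'a::archimedean_vector_lattice"
  assumes "\<bar>x\<bar> \<le> u + v" "0 \<le> v"
  shows "\<bar>x - truncation u x\<bar> \<le> v"
proof (rule abs_diff_leI)
  have "x \<le> u + v" "- x \<le> u + v" using assms(1) by (auto simp: abs_le_iff)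
  then have "- (u + v) \<le> x" by (simp only: minus_le_iff)
  from add_right_mono[OF this, of v] have "- u \<le> x + v" by simp
  moreover have "x \<le> x + v" using assms(2) by simp
  ultimately show "truncation u x \<le> x + v"
    unfolding truncation_def by (intro sup_least le_infI1)
  have "x \<le> inf x u + v"
    using \<open>x \<le> u + v\<close> assms(2) by (simp add: add_inf_distrib_right)
  also have "\<dots> \<le> truncation u x + v" unfolding truncation_def by simp
  finally show "x \<le> truncation u x + v" .
qed

lemma abs_truncation_diff_le: "\<bar>truncation u x - truncation u y\<bar> \<le> \<bar>x - y\<bar>"
  using abs_sup_diff_le[of "inf x u" "- u" "inf y u" "- u"] abs_inf_diff_le[of x u y u]
  unfolding truncation_def by simp

lemma abs_truncation_diff_bound_le:
  fixes x :: "'a::archimedean_vector_lattice"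
  shows "\<bar>truncation u x - truncation v x\<bar> \<le> \<bar>u - v\<bar>"
proof -
  have *: "truncation u x \<le> truncation v x + \<bar>u - v\<bar>" for u v :: 'a
  proof -
    have "inf x u \<le> inf x v + \<bar>u - v\<bar>"
      unfolding add_inf_distrib_right
      by (intro inf_mono le_add_abs_diff) auto
    moreover have "- u \<le> - v + \<bar>u - v\<bar>" using le_add_abs_diff(2)[of v u] by (simp add: algebra_simps)
    ultimately show ?thesis
      unfolding truncation_def add_sup_distrib_right by (intro sup_mono)
  qed
  from *[of u v] *[of v u] show ?thesis
    by (intro abs_diff_leI) (auto simp: abs_minus_commute)
qed

text \<open>Only the range of a decreasing net matters, so the net is indexed by its range with the
  reversed order; separate index sets then disappear from the arguments.\<close>

definition directed_to_zero :: "'a::archimedean_vector_lattice set \<Rightarrow> bool" where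
  "directed_to_zero P \<longleftrightarrow> decreases_to_zero P (\<lambda>a b. b \<le> a) (\<lambda>a. a)"

lemma isGlb_0_iff:
  "isGlb UNIV P (0 :: 'a::archimedean_vector_lattice) \<longleftrightarrow>
    (\<forall>p\<in>P. 0 \<le> p) \<and> (\<forall>b\<ge>0. (\<forall>p\<in>P. b \<le> p) \<longrightarrow> b = 0)"
proof -
  have "b \<le> 0" if "\<forall>b\<ge>0. (\<forall>p\<in>P. b \<le> p) \<longrightarrow> b = 0" "\<forall>p\<in>P. 0 \<le> p" "\<forall>p\<in>P. b \<le> p" for b :: 'a
    using that(1)[rule_format, of "sup b 0"] that(2,3) by (metis le_sup_iff order_refl sup_ge2)
  then show ?thesis
    by (auto simp: isGlb_def greatestP_def isLb_def setge_def setle_def intro: order.antisym)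
qed

lemma directed_to_zero_iff:
  "directed_to_zero P \<longleftrightarrow> P \<noteq> {} \<and> (\<forall>a\<in>P. \<forall>b\<in>P. \<exists>c\<in>P. c \<le> a \<and> c \<le> b) \<and>
     (\<forall>p\<in>P. 0 \<le> p) \<and> (\<forall>b\<ge>0. (\<forall>p\<in>P. b \<le> p) \<longrightarrow> b = 0)"
  unfolding directed_to_zero_def decreases_to_zero_def directed_set_def image_ident isGlb_0_iff
  by (auto simp: reflp_on_def transp_on_def)

lemma directed_to_zeroI:
  assumes "P \<noteq> {}" "\<And>a b. a \<in> P \<Longrightarrow> b \<in> P \<Longrightarrow> \<exists>c\<in>P. c \<le> a \<and> c \<le> b" "\<And>p. p \<in> P \<Longrightarrow> 0 \<le> p"
    "\<And>b. 0 \<le> b \<Longrightarrow> (\<And>p. p \<in> P \<Longrightarrow> b \<le> p) \<Longrightarrow> b = 0"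
  shows "directed_to_zero P"
proof -
  have "b = 0" if "0 \<le> b" "\<forall>p\<in>P. b \<le> p" for b using assms(4) that by blast
  then show ?thesis using assms(1-3) unfolding directed_to_zero_iff by simp
qed

lemma directed_to_zeroD:
  assumes "directed_to_zero P"
  shows "P \<noteq> {}" "\<And>a b. a \<in> P \<Longrightarrow> b \<in> P \<Longrightarrow> \<exists>c\<in>P. c \<le> a \<and> c \<le> b" "\<And>p. p \<in> P \<Longrightarrow> 0 \<le> p"
    "\<And>b. 0 \<le> b \<Longrightarrow> (\<And>p. p \<in> P \<Longrightarrow> b \<le> p) \<Longrightarrow> b = 0"
  using assms unfolding directed_to_zero_iff by blast+

lemma decreases_to_zero_image:
  assumes "decreases_to_zero B s y"
  shows "directed_to_zero (y ` B)"
proof -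
  have 1: "y ` B \<noteq> {}" and g: "isGlb UNIV (y ` B) 0"
    using assms unfolding decreases_to_zero_def directed_set_def by auto
  have 2: "\<exists>c\<in>y ` B. c \<le> a \<and> c \<le> b" if ab: "a \<in> y ` B" "b \<in> y ` B" for a b
  proof -
    from ab obtain i j where ij: "i \<in> B" "j \<in> B" "a = y i" "b = y j" by blast
    with assms obtain k where "k \<in> B" "s i k" "s j k"
      unfolding decreases_to_zero_def directed_set_def by blast
    with ij assms show ?thesis unfolding decreases_to_zero_def by blast
  qed
  show ?thesis unfolding directed_to_zero_iff using 1 2 g[unfolded isGlb_0_iff] by blast
qed

text \<open>In an Archimedean space the gaps between a bounded set and its upper bounds have infimum 0,
  even if the set has no supremum. This replaces passing to the Dedekind completion.\<close>

lemma directed_to_zero_gaps: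
  fixes S :: "'a::archimedean_vector_lattice set"
  assumes "S \<noteq> {}" and c: "\<And>s. s \<in> S \<Longrightarrow> s \<le> c"
    and dir: "\<And>a b. a \<in> S \<Longrightarrow> b \<in> S \<Longrightarrow> \<exists>d\<in>S. a \<le> d \<and> b \<le> d"
  shows "directed_to_zero {w - s |w s. w \<le> c \<and> (\<forall>t\<in>S. t \<le> w) \<and> s \<in> S}" (is "directed_to_zero ?P")
proof -
  obtain s0 where "s0 \<in> S" using assms(1) by blast
  then have "c - s0 \<in> ?P" using c by blast
  then have ne: "?P \<noteq> {}" by blast
  have pos: "0 \<le> p" if "p \<in> ?P" for p using that by auto
  have down: "\<exists>d\<in>?P. d \<le> a \<and> d \<le> b" if ab: "a \<in> ?P" "b \<in> ?P" for a b
  proof -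
    from ab obtain w s w' s' where w: "a = w - s" "w \<le> c" "\<forall>t\<in>S. t \<le> w" "s \<in> S"
      "b = w' - s'" "w' \<le> c" "\<forall>t\<in>S. t \<le> w'" "s' \<in> S" by blast
    from dir[OF w(4,8)] obtain d where d: "d \<in> S" "s \<le> d" "s' \<le> d" by blast
    have "inf w w' \<le> c" "\<forall>t\<in>S. t \<le> inf w w'" using w by (auto intro: le_infI1)
    with d(1) have "inf w w' - d \<in> ?P" by blast
    moreover have "inf w w' - d \<le> a" "inf w w' - d \<le> b"
      unfolding w(1,5) using d by (auto intro!: diff_mono)
    ultimately show ?thesis by blast
  qed
  have zero: "b = 0" if b: "0 \<le> b" "\<And>p. p \<in> ?P \<Longrightarrow> b \<le> p" for b
  proof -
    obtain s where s: "s \<in> S" using assms(1) by blast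
    \<comment> \<open>If \<open>c - real k *\<^sub>R b\<close> is an upper bound of
      \<open>S\<close>, its gaps are among the elements above \<open>b\<close>, so \<open>b\<close>
      can be subtracted once more.\<close>
    have *: "\<forall>t\<in>S. t \<le> c - real k *\<^sub>R b" for k
    proof (induction k)
      case 0
      then show ?case using c by simp
    next
      case (Suc k)
      have le: "c - real k *\<^sub>R b \<le> c" using b(1) by (simp add: scaleR_nonneg_nonneg)
      have "t \<le> c - real (Suc k) *\<^sub>R b" if "t \<in> S" for t
      proof -
        have "b \<le> (c - real k *\<^sub>R b) - t" using Suc le that by (intro b(2)) blast
        then show ?thesis by (simp add: algebra_simps)
      qed
      then show ?case by blast
    qed
    have "\<forall>k. real k *\<^sub>R b \<le> c - s"
    proof
      fix k
      from * s have "s \<le> c - real k *\<^sub>R b" by blast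
      then show "real k *\<^sub>R b \<le> c - s" by (simp add: algebra_simps)
    qed
    with b(1) show "b = 0" by (rule archimedean)
  qed
  show ?thesis using ne down pos zero by (rule directed_to_zeroI)
qed

section \<open>Solid neighbourhoods\<close>

definition solid_nhd :: "'a::archimedean_vector_lattice topology \<Rightarrow> 'a set \<Rightarrow> bool" where
  "solid_nhd T V \<longleftrightarrow> solid V \<and> (\<exists>W. openin T W \<and> 0 \<in> W \<and> W \<subseteq> V)"

lemma solidD: "solid V \<Longrightarrow> y \<in> V \<Longrightarrow> \<bar>x\<bar> \<le> \<bar>y\<bar> \<Longrightarrow> x \<in> V"
  unfolding solid_def by blast

lemma solid_nhd_downD:
  "solid_nhd T V \<Longrightarrow> y \<in> V \<Longrightarrow> 0 \<le> x \<Longrightarrow> x \<le> \<bar>y\<bar> \<Longrightarrow> x \<in> V"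
  by (rule solidD[of V y]) (auto simp: solid_nhd_def)

lemma solid_nhd_zero: "solid_nhd T V \<Longrightarrow> 0 \<in> V"
  unfolding solid_nhd_def by blast

lemma solid_nhd_Int:
  assumes "solid_nhd T V" "solid_nhd T V'"
  shows "solid_nhd T (V \<inter> V')"
proof -
  from assms obtain W W' where W: "openin T W" "0 \<in> W" "W \<subseteq> V"
    "openin T W'" "0 \<in> W'" "W' \<subseteq> V'"
    unfolding solid_nhd_def by blast
  have "openin T (W \<inter> W')" using W by blast
  moreover have "0 \<in> W \<inter> W'" "W \<inter> W' \<subseteq> V \<inter> V'" using W by blast+
  moreover have "solid (V \<inter> V')" using assms unfolding solid_nhd_def solid_def by blast
  ultimately show ?thesis unfolding solid_nhd_def by blast
qed

locale Hausdorff_uo_Lebesgue =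
  fixes T :: "'a::archimedean_vector_lattice topology"
  assumes Hausdorff: "Hausdorff_space T" and uo_Lebesgue: "uo_Lebesgue T"
begin

lemma topspace_eq [simp]: "topspace T = UNIV"
  using uo_Lebesgue unfolding uo_Lebesgue_def locally_solid_def linear_topology_def by blast

lemma solid_nhd_UNIV: "solid_nhd T UNIV"
  using openin_topspace[of T] unfolding solid_nhd_def solid_def by auto

lemma solid_nhd_INT:
  assumes "finite K" "\<And>k. k \<in> K \<Longrightarrow> solid_nhd T (V k)"
  shows "solid_nhd T (\<Inter>k\<in>K. V k)"
  using assms by (induction K rule: finite_induct) (auto intro: solid_nhd_Int solid_nhd_UNIV)

lemma add_nhd:
  assumes "openin T U" "x + y \<in> U"
  obtains A B where "openin T A" "openin T B" "x \<in> A" "y \<in> B" "\<And>a b. a \<in> A \<Longrightarrow> b \<in> B \<Longrightarrow> a + b \<in> U"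
proof -
  have "continuous_map (prod_topology T T) T (\<lambda>(x, y). x + y)"
    using uo_Lebesgue unfolding uo_Lebesgue_def locally_solid_def linear_topology_def by blast
  from openin_continuous_map_preimage[OF this assms(1)]
  have "openin (prod_topology T T) {p. (\<lambda>(x, y). x + y) p \<in> U}" by simp
  from this[unfolded openin_prod_topology_alt, rule_format, of x y] assms(2)
  obtain A B where AB: "openin T A" "openin T B" "x \<in> A" "y \<in> B"
    "A \<times> B \<subseteq> {p. (\<lambda>(x, y). x + y) p \<in> U}"
    by auto
  show ?thesis by (rule that[OF AB(1-4)]) (use AB(5) in auto)
qed

lemma ex_solid_nhd:
  assumes "openin T U" "0 \<in> U"
  obtains V where "solid_nhd T V" "V \<subseteq> U"
proof -
  have "locally_solid T" using uo_Lebesgue unfolding uo_Lebesgue_def by (rule conjunct1)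
  from this[unfolded locally_solid_def, THEN conjunct2, rule_format, of U] assms
  obtain V W where "solid V" "V \<subseteq> U" "openin T W" "0 \<in> W" "W \<subseteq> V" by auto
  then show ?thesis using that[of V] unfolding solid_nhd_def by blast
qed

lemma solid_nhd_half:
  assumes "solid_nhd T V"
  shows "\<exists>V'. solid_nhd T V' \<and> (\<forall>x\<in>V'. \<forall>y\<in>V'. x + y \<in> V)"
proof -
  from assms obtain W where W: "openin T W" "0 + 0 \<in> W" "W \<subseteq> V"
    unfolding solid_nhd_def by auto
  obtain A B where AB: "openin T A" "openin T B" "0 \<in> A" "0 \<in> B"
    "\<And>a b. a \<in> A \<Longrightarrow> b \<in> B \<Longrightarrow> a + b \<in> W"
    using add_nhd[OF W(1,2)] by metis
  obtain V' where "solid_nhd T V'" "V' \<subseteq> A \<inter> B"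
    using AB by (auto intro: ex_solid_nhd[of "A \<inter> B"])
  with AB(5) W(3) show ?thesis by blast
qed

lemma solid_nhd_separates:
  assumes "c \<noteq> 0"
  obtains V where "solid_nhd T V" "c \<notin> V"
proof -
  have "0 \<in> topspace T" "c \<in> topspace T" by simp_all
  with assms Hausdorff obtain U U' where U: "openin T U" "0 \<in> U" "c \<in> U'" "disjnt U U'"
    unfolding Hausdorff_space_def by metis
  then have "c \<notin> U" unfolding disjnt_def by blast
  obtain V where "solid_nhd T V" "V \<subseteq> U" using ex_solid_nhd[OF U(1,2)] .
  with \<open>c \<notin> U\<close> show ?thesis by (intro that[of V]) auto
qed

lemma closure_solid_nhd:
  assumes "x \<in> T closure_of A" "solid_nhd T V"
  obtains a where "a \<in> A" "a - x \<in> V"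
proof -
  from assms(2) obtain W where W: "openin T W" "x + (- x) \<in> W" "W \<subseteq> V"
    unfolding solid_nhd_def by auto
  obtain B C where BC: "openin T B" "openin T C" "x \<in> B" "- x \<in> C"
    "\<And>a b. a \<in> B \<Longrightarrow> b \<in> C \<Longrightarrow> a + b \<in> W"
    using add_nhd[OF W(1,2)] by metis
  obtain a where "a \<in> A" "a \<in> B" using assms(1) BC(1,3) unfolding in_closure_of by blast
  with BC(4,5) W(3) that[of a] show ?thesis by (metis diff_conv_add_uminus subsetD)
qed

text \<open>As a net indexed by itself, \<open>P\<close> dominates its own truncations; it is
  therefore uo-convergent to 0, and the uo-Lebesgue property applies.\<close>

lemma directed_to_zero_solid_nhd:
  assumes P: "directed_to_zero P" and "solid_nhd T V"
  obtains p where "p \<in> P" "p \<in> V"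
proof -
  let ?r = "\<lambda>a b. b \<le> (a::'a)"
  have d: "directed_set P ?r" using P unfolding directed_to_zero_def decreases_to_zero_def by blast
  have "order_limit P ?r (\<lambda>p. inf \<bar>p - 0\<bar> u) 0" if "0 \<le> u" for u
  proof (rule order_limitI[OF P[unfolded directed_to_zero_def]])
    have "\<bar>0 - inf \<bar>j - 0\<bar> u\<bar> \<le> b" if "j \<in> P" "j \<le> b" for j b
    proof -
      have "\<bar>0 - inf \<bar>j - 0\<bar> u\<bar> = inf j u"
        using that directed_to_zeroD(3)[OF P] \<open>0 \<le> u\<close> by simp
      with that(2) show ?thesis by (simp add: le_infI1)
    qed
    then show "\<forall>b\<in>P. \<exists>i\<in>P. \<forall>j\<in>P. j \<le> i \<longrightarrow> \<bar>0 - inf \<bar>j - 0\<bar> u\<bar> \<le> b" by blast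
  qed
  then have "uo_limit P ?r (\<lambda>p. p) 0" unfolding uo_limit_def by blast
  from uo_LebesgueD[OF uo_Lebesgue d this] have lim: "limitin T (\<lambda>p. p) 0 (tail_filter P ?r)" .
  obtain W where W: "openin T W" "0 \<in> W" "W \<subseteq> V" using assms(2) unfolding solid_nhd_def by blast
  with lim have "eventually (\<lambda>p. p \<in> W) (tail_filter P ?r)" unfolding limitin_def by blast
  then obtain i where "i \<in> P" "\<forall>j\<in>P. j \<le> i \<longrightarrow> j \<in> W"
    unfolding eventually_tail_filter[OF d] by blast
  with W(3) that[of i] show ?thesis by blast
qed

text \<open>A halving sequence as in the metrization of topological groups; it makes the
  intersection of all \<open>V n\<close> closed under addition.\<close>

definition nested_nhds :: "(nat \<Rightarrow> 'a set) \<Rightarrow> bool" where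
  "nested_nhds V \<longleftrightarrow> (\<forall>n. solid_nhd T (V n)) \<and> (\<forall>n. \<forall>x\<in>V (Suc n). \<forall>y\<in>V (Suc n). x + y \<in> V n)"

lemma nested_nhdsD:
  assumes "nested_nhds V"
  shows "solid_nhd T (V n)" "x \<in> V (Suc n) \<Longrightarrow> y \<in> V (Suc n) \<Longrightarrow> x + y \<in> V n"
  using assms unfolding nested_nhds_def by blast+

lemma nested_nhds_downD:
  "nested_nhds V \<Longrightarrow> y \<in> V n \<Longrightarrow> 0 \<le> x \<Longrightarrow> x \<le> \<bar>y\<bar> \<Longrightarrow> x \<in> V n"
  using solid_nhd_downD nested_nhdsD(1) by blast

lemma nested_nhds_mono:
  assumes "nested_nhds V" "m \<le> n"
  shows "V n \<subseteq> V m"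
proof -
  have "V (Suc k) \<subseteq> V k" for k
    using nested_nhdsD(2)[OF assms(1), of _ k 0] solid_nhd_zero[OF nested_nhdsD(1)[OF assms(1)]]
    by auto
  then show ?thesis by (rule lift_Suc_antimono_le) (rule assms(2))
qed

text \<open>Every summand costs one index: one copy of \<open>w\<close> and the multiple with one
  copy fewer are both found one index higher and then added.\<close>

lemma nested_nhds_scaleR:
  assumes "nested_nhds V" "w \<in> V (i + k)"
  shows "real k *\<^sub>R w \<in> V i"
  using assms(2)
proof (induction k arbitrary: i)
  case 0
  then show ?case using solid_nhd_zero[OF nested_nhdsD(1)[OF assms(1)]] by simp
next
  case (Suc k)
  from Suc.IH[of "Suc i"] Suc.prems have "real k *\<^sub>R w \<in> V (Suc i)" by simp
  moreover have "w \<in> V (Suc i)"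
    using Suc.prems nested_nhds_mono[OF assms(1), of "Suc i" "i + Suc k"] by auto
  ultimately have "w + real k *\<^sub>R w \<in> V i" using nested_nhdsD(2)[OF assms(1)] by blast
  then show ?case by (simp add: algebra_simps)
qed

lemma ex_nested_nhds:
  assumes "solid_nhd T U"
  obtains V where "nested_nhds V" "V 0 = U"
proof -
  from solid_nhd_half obtain h where
    h: "\<And>V. solid_nhd T V \<Longrightarrow> solid_nhd T (h V) \<and> (\<forall>x\<in>h V. \<forall>y\<in>h V. x + y \<in> V)"
    by metis
  define V where "V n = (h ^^ n) U" for n
  have "solid_nhd T (V n)" for n
    unfolding V_def by (induction n) (use assms h in auto)
  with h have "nested_nhds V" unfolding nested_nhds_def by (simp add: V_def)
  then show ?thesis by (rule that) (simp add: V_def)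
qed

text \<open>At index \<open>n\<close> only the first \<open>n + 1\<close> sequences are intersected,
  so the intersection is finite and stays a neighbourhood, while every sequence is eventually
  included.\<close>

lemma nested_nhds_INT:
  assumes "\<And>j. nested_nhds (N j)"
  shows "nested_nhds (\<lambda>n. \<Inter>j\<in>{..n}. N j n)"
proof -
  have "solid_nhd T (\<Inter>j\<in>{..n}. N j n)" for n :: nat
    using nested_nhdsD(1)[OF assms] by (intro solid_nhd_INT) auto
  moreover have "x + y \<in> (\<Inter>j\<in>{..n}. N j n)"
    if "x \<in> (\<Inter>j\<in>{..Suc n}. N j (Suc n))" "y \<in> (\<Inter>j\<in>{..Suc n}. N j (Suc n))" for x y n
    using that nested_nhdsD(2)[OF assms] by auto
  ultimately show ?thesis unfolding nested_nhds_def by simp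
qed

text \<open>Split off the first term: it lies in \<open>V (Suc m)\<close>, and so does the rest by
  induction. The result is uniform in the number of summands.\<close>

lemma nested_nhds_sum:
  fixes y :: "nat \<Rightarrow> 'a"
  assumes V: "nested_nhds V" and y: "\<And>n. m \<le> n \<Longrightarrow> y n \<in> V (Suc n)"
  shows "(\<Sum>n\<in>{m..<m + k}. y n) \<in> V m"
  using y
proof (induction k arbitrary: m)
  case 0
  then show ?case using solid_nhd_zero[OF nested_nhdsD(1)[OF V]] by simp
next
  case (Suc k)
  have "(\<Sum>n\<in>{Suc m..<Suc m + k}. y n) \<in> V (Suc m)" by (rule Suc.IH) (simp add: Suc.prems)
  with Suc.prems[of m] have "y m + (\<Sum>n\<in>{Suc m..<Suc m + k}. y n) \<in> V m"
    using nested_nhdsD(2)[OF V] by blast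
  moreover have "(\<Sum>n\<in>{m..<m + Suc k}. y n) = y m + (\<Sum>n\<in>{Suc m..<Suc m + k}. y n)"
    by (subst sum.atLeast_Suc_lessThan) auto
  ultimately show ?case by (simp only:)
qed

text \<open>The neighbourhoods \<open>V n\<close> define a Hausdorff topology on the order interval from 0 to \<open>u\<close>.\<close>

definition separating_nhds :: "'a \<Rightarrow> (nat \<Rightarrow> 'a set) \<Rightarrow> bool" where
  "separating_nhds u V \<longleftrightarrow> nested_nhds V \<and> (\<forall>b. 0 \<le> b \<and> b \<le> u \<and> (\<forall>n. b \<in> V n) \<longrightarrow> b = 0)"

text \<open>Inside the interval from 0 to \<open>c\<close>, the elements that no \<open>V n\<close>
  detects form an upward directed set \<open>N\<close>. Since \<open>V 0\<close> misses
  \<open>c\<close>, some upper bound \<open>w \<le> c\<close> of \<open>N\<close> differs from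
  \<open>c\<close>, and on the remaining piece \<open>c - w\<close> the sequence separates
  points.\<close>

lemma ex_separating_nhds_below:
  assumes "0 \<le> c" "c \<noteq> 0"
  obtains a V where "0 \<le> a" "a \<le> c" "a \<noteq> 0" "separating_nhds a V"
proof -
  obtain U where U: "solid_nhd T U" "c \<notin> U" using solid_nhd_separates[OF assms(2)] .
  obtain V where V: "nested_nhds V" "V 0 = U" using ex_nested_nhds[OF U(1)] .
  define N where "N = {h. 0 \<le> h \<and> h \<le> c \<and> (\<forall>n. h \<in> V n)}"
  have add: "\<forall>n. h + h' \<in> V n" if "\<forall>n. h \<in> V n" "\<forall>n. h' \<in> V n" for h h'
    using that nested_nhdsD(2)[OF V(1)] by blast
  have "0 \<in> N" using assms(1) solid_nhd_zero[OF nested_nhdsD(1)[OF V(1)]] by (simp add: N_def)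
  have dir: "\<exists>d\<in>N. a \<le> d \<and> b \<le> d" if ab: "a \<in> N" "b \<in> N" for a b
  proof (intro bexI[of _ "sup a b"] conjI)
    have nn: "0 \<le> a" "0 \<le> b" using ab by (auto simp: N_def)
    then have "sup a b \<le> a + b" by simp
    moreover have "0 \<le> sup a b" using nn by (simp add: le_supI1)
    moreover have "\<bar>a + b\<bar> = a + b" using nn by simp
    ultimately have "\<forall>n. sup a b \<in> V n"
      using add[of a b] ab nested_nhds_downD[OF V(1), of "a + b" _ "sup a b"] by (auto simp: N_def)
    with ab \<open>0 \<le> sup a b\<close> show "sup a b \<in> N" by (simp add: N_def)
  qed auto
  have "directed_to_zero {w - h |w h. w \<le> c \<and> (\<forall>t\<in>N. t \<le> w) \<and> h \<in> N}"
    by (rule directed_to_zero_gaps) (use \<open>0 \<in> N\<close> dir in \<open>auto simp: N_def\<close>)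
  \<comment> \<open>Index 1 leaves room for one addition: the gap \<open>w - h\<close> and
    \<open>h\<close> both lie in \<open>V (Suc 0)\<close>, so \<open>w\<close> lies in
    \<open>V 0\<close>, which misses \<open>c\<close>.\<close>
  from directed_to_zero_solid_nhd[OF this nested_nhdsD(1)[OF V(1), of "Suc 0"]]
  obtain w h where w: "w - h \<in> V (Suc 0)" "w \<le> c" "\<forall>t\<in>N. t \<le> w" "h \<in> N" by blast
  have "h \<in> V (Suc 0)" using w(4) by (simp add: N_def)
  from nested_nhdsD(2)[OF V(1) w(1) this] have "(w - h) + h \<in> V 0" .
  with U(2) V(2) have "w \<noteq> c" by auto
  have "b = 0" if b: "0 \<le> b" "b \<le> c - w" "\<forall>n. b \<in> V n" for b
  proof -
    \<comment> \<open>Being in \<open>N\<close>, a multiple of \<open>b\<close> is below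
      \<open>w\<close>; adding \<open>b \<le> c - w\<close> keeps it below \<open>c\<close>, so the
      next multiple is in \<open>N\<close> again.\<close>
    have *: "real k *\<^sub>R b \<in> N" for k
    proof (induction k)
      case 0
      then show ?case using \<open>0 \<in> N\<close> by simp
    next
      case (Suc k)
      then have "real k *\<^sub>R b \<le> w" using w(3) by blast
      with b(2) have "b + real k *\<^sub>R b \<le> (c - w) + w" by (rule add_mono)
      moreover have "0 \<le> b + real k *\<^sub>R b" using b(1) Suc by (auto simp: N_def)
      moreover have "\<forall>n. b + real k *\<^sub>R b \<in> V n" using add[OF b(3)] Suc by (auto simp: N_def)
      ultimately have "b + real k *\<^sub>R b \<in> N" by (simp add: N_def)
      then show ?case by (simp add: algebra_simps)
    qed
    then have "\<forall>k. real k *\<^sub>R b \<le> c" by (simp add: N_def)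
    with b(1) show "b = 0" by (rule archimedean)
  qed
  with V(1) have sep: "separating_nhds (c - w) V" unfolding separating_nhds_def by blast
  have "0 \<le> w" using w(3) \<open>0 \<in> N\<close> by blast
  show ?thesis
    by (rule that[OF _ _ _ sep]) (use w(2) \<open>0 \<le> w\<close> \<open>w \<noteq> c\<close> in auto)
qed

text \<open>If \<open>b\<close> lies in all \<open>V n\<close>, so does \<open>inf a b\<close>,
  which is then 0; hence \<open>b\<close> is disjoint from \<open>a\<close> and from all its
  multiples.\<close>

lemma separating_nhds_scaleR:
  assumes "separating_nhds a V" "0 \<le> a"
  shows "separating_nhds (real k *\<^sub>R a) V"
proof -
  have V: "nested_nhds V" using assms(1) unfolding separating_nhds_def by blast
  have "b = 0" if b: "0 \<le> b" "b \<le> real k *\<^sub>R a" "\<forall>n. b \<in> V n" for b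
  proof -
    have "0 \<le> inf a b" "inf a b \<le> \<bar>b\<bar>" using b(1) assms(2) by auto
    with b(3) have "\<forall>n. inf a b \<in> V n" using nested_nhds_downD[OF V] by blast
    with assms(1) \<open>0 \<le> inf a b\<close> have "inf a b = 0" unfolding separating_nhds_def by simp
    with inf_scaleR_nat_le[OF assms(2) b(1), of k] have "inf (real k *\<^sub>R a) b \<le> 0" by simp
    with b(1,2) show "b = 0" by (simp add: inf_absorb2)
  qed
  with V show ?thesis unfolding separating_nhds_def by blast
qed

text \<open>If some upper bound \<open>v\<close> of the set were not above \<open>u\<close>, a
  nonzero \<open>a\<close> with separating neighbourhoods would fit below
  \<open>u - inf u v\<close>. Its multiples below \<open>u\<close> belong to the set, hence lie
  below \<open>inf u v\<close>, which leaves room for one more \<open>a\<close>; this contradicts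
  the Archimedean property.\<close>

lemma isLub_separating_nhds:
  assumes "0 \<le> u"
  shows "isLub UNIV {a. 0 \<le> a \<and> a \<le> u \<and> (\<exists>V. separating_nhds a V)} u" (is "isLub UNIV ?A u")
proof -
  have "u \<le> v" if v: "\<And>a. a \<in> ?A \<Longrightarrow> a \<le> v" for v
  proof (rule ccontr)
    assume "\<not> u \<le> v"
    then have "u - inf u v \<noteq> 0" by (simp del: diff_inf_eq_sup add: le_iff_inf)
    moreover have "0 \<le> u - inf u v" by (simp del: diff_inf_eq_sup)
    ultimately obtain a V where a: "0 \<le> a" "a \<le> u - inf u v" "a \<noteq> 0" "separating_nhds a V"
      using ex_separating_nhds_below[of "u - inf u v"] by metis
    have "a = 0"
    proof (rule archimedean_all_nat[OF a(1) assms])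
      fix k assume "real k *\<^sub>R a \<le> u"
      then have "real k *\<^sub>R a \<in> ?A"
        using separating_nhds_scaleR[OF a(4,1), of k] a(1) by (auto intro: scaleR_nonneg_nonneg)
      from this v[OF this] have "real k *\<^sub>R a \<le> inf u v" by simp
      with a(2) have "a + real k *\<^sub>R a \<le> (u - inf u v) + inf u v" by (rule add_mono)
      then show "a + real k *\<^sub>R a \<le> u" by (simp del: diff_inf_eq_sup)
    qed
    with a(3) show False by blast
  qed
  then show ?thesis by (auto simp: isLub_def leastP_def isUb_def setle_def setge_def)
qed

lemma ex_separating_nhds:
  assumes csp: "countable_sup_property TYPE('a)" and "0 \<le> u"
  shows "\<exists>V. separating_nhds u V"
proof -
  let ?A = "{a. 0 \<le> a \<and> a \<le> u \<and> (\<exists>V. separating_nhds a V)}"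
  obtain V0 where "nested_nhds V0" using ex_nested_nhds[OF solid_nhd_UNIV] .
  then have "separating_nhds 0 V0" unfolding separating_nhds_def by auto
  with assms(2) have 0: "0 \<in> ?A" by auto
  then have "?A \<noteq> {} \<and> isLub UNIV ?A u" using isLub_separating_nhds[OF assms(2)] by blast
  from csp[unfolded countable_sup_property_def, rule_format, OF this]
  obtain B where B: "B \<subseteq> ?A" "countable B" "isLub UNIV B u" by blast
  \<comment> \<open>Enumerating by \<open>from_nat_into\<close> requires a nonempty set; the
    inserted 0 belongs to \<open>?A\<close> as well.\<close>
  define e where "e = from_nat_into (insert 0 B)"
  have e: "range e = insert 0 B" using B(2) unfolding e_def by simp
  have "e j \<in> ?A" for j
  proof -
    have "e j \<in> insert 0 B" using e by (metis rangeI)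
    moreover have "insert 0 B \<subseteq> ?A" using B(1) 0 by (simp only: insert_subset)
    ultimately show ?thesis by (rule rev_subsetD)
  qed
  then have "\<forall>j. \<exists>V. separating_nhds (e j) V" "\<And>j. 0 \<le> e j" by blast+
  then obtain N where N: "\<And>j. separating_nhds (e j) (N j)" by metis
  then have N': "nested_nhds (N j)" for j unfolding separating_nhds_def by blast
  let ?V = "\<lambda>n. \<Inter>j\<in>{..n}. N j n"
  have "b = 0" if b: "0 \<le> b" "b \<le> u" "\<forall>n. b \<in> ?V n" for b
  proof -
    have bN: "b \<in> N j n" for j n
    proof -
      have "b \<in> N j (max j n)" using b(3) by auto
      then show ?thesis using nested_nhds_mono[OF N', of n "max j n" j] by auto
    qed
    \<comment> \<open>Lying in every \<open>N j n\<close>, the element \<open>b\<close> is disjoint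
      from each \<open>a\<close> in \<open>B\<close>, so \<open>a + b\<close> is
      \<open>sup a b\<close> and stays below \<open>u\<close>. Thus \<open>u - b\<close> is an upper
      bound of a set with supremum \<open>u\<close>.\<close>
    have "a \<le> u - b" if "a \<in> B" for a
    proof -
      from that e obtain j where j: "a = e j" by blast
      have a: "0 \<le> a" "a \<le> u" using that B(1) by auto
      have "\<forall>n. inf a b \<in> N j n"
        using nested_nhds_downD[OF N' bN, of "inf a b"] a(1) b(1) by simp
      then have "inf a b = 0" using N[of j] a(1) b(1) unfolding separating_nhds_def j by simp
      then have "a + b = sup a b" using add_eq_inf_sup[of a b] by simp
      also have "\<dots> \<le> u" using a(2) b(2) by simp
      finally show ?thesis by (simp add: le_diff_eq)
    qed
    then have "isUb UNIV B (u - b)" by (rule isUb_UNIV_I)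
    with B(3) have "u \<le> u - b" by (rule isLub_le_isUb)
    with b(1) show "b = 0" by (simp add: le_diff_eq)
  qed
  with nested_nhds_INT[OF N'] have "separating_nhds u ?V" unfolding separating_nhds_def by simp
  then show ?thesis by blast
qed

end

section \<open>Sequences and uniqueness\<close>

text \<open>The dominating net consists of all eventual upper bounds of \<open>z\<close>, which
  stand in for a limit superior that may not exist. Since \<open>v\<close> is one of them, only
  lower bounds \<open>b \<le> v\<close> have to be tested.\<close>

lemma order_limit_seqI:
  fixes z :: "nat \<Rightarrow> 'a::archimedean_vector_lattice"
  assumes z: "\<And>n. 0 \<le> z n" "\<And>n. z n \<le> v"
    and glb: "\<And>b. 0 \<le> b \<Longrightarrow> b \<le> v \<Longrightarrow> (\<And>w m. (\<And>n. m \<le> n \<Longrightarrow> z n \<le> w) \<Longrightarrow> b \<le> w) \<Longrightarrow> b = 0"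
  shows "order_limit UNIV (\<le>) z 0"
proof -
  define W where "W = {w. \<exists>m. \<forall>n\<ge>m. z n \<le> w}"
  have "v \<in> W" using z(2) by (auto simp: W_def)
  have "directed_to_zero W"
  proof (rule directed_to_zeroI)
    show "W \<noteq> {}" using \<open>v \<in> W\<close> by blast
  next
    fix a b assume "a \<in> W" "b \<in> W"
    then obtain k l where "\<forall>n\<ge>k. z n \<le> a" "\<forall>n\<ge>l. z n \<le> b" unfolding W_def by blast
    then have "\<forall>n\<ge>max k l. z n \<le> inf a b" by simp
    then have "inf a b \<in> W" unfolding W_def by blast
    then show "\<exists>c\<in>W. c \<le> a \<and> c \<le> b" by (intro bexI[of _ "inf a b"]) auto
  next
    fix p assume "p \<in> W"
    then obtain m where "z m \<le> p" unfolding W_def by auto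
    with z(1)[of m] show "0 \<le> p" by (rule order_trans)
  next
    fix b assume b: "0 \<le> b" "\<And>p. p \<in> W \<Longrightarrow> b \<le> p"
    show "b = 0"
    proof (rule glb[OF b(1)])
      show "b \<le> v" using b(2) \<open>v \<in> W\<close> by blast
      fix w m assume "\<And>n. m \<le> n \<Longrightarrow> z n \<le> w"
      then have "w \<in> W" unfolding W_def by blast
      then show "b \<le> w" by (rule b(2))
    qed
  qed
  then show ?thesis
    unfolding directed_to_zero_def
    by (rule order_limitI) (use z(1) in \<open>auto simp: W_def\<close>)
qed

text \<open>The sum of two elements is the sum of their infimum and supremum: here the supremum is
  below \<open>v\<close> and the infimum below \<open>real k *\<^sub>R w\<close>. So, up to this
  error, multiples of an element that is almost disjoint from \<open>y\<close> fit beside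
  \<open>inf y v\<close> below \<open>v\<close>.\<close>

lemma inf_plus_scaleR_le:
  fixes y v c w :: "'a::archimedean_vector_lattice"
  assumes "0 \<le> y" "0 \<le> c" "real k *\<^sub>R c \<le> v" "inf c y \<le> w"
  shows "inf y v + real k *\<^sub>R c \<le> v + real k *\<^sub>R w"
proof -
  have "inf (inf y v) (real k *\<^sub>R c) \<le> inf (real k *\<^sub>R c) y"
    by (simp add: le_infI1)
  also have "\<dots> \<le> real k *\<^sub>R inf c y" by (rule inf_scaleR_nat_le[OF assms(2,1)])
  also have "\<dots> \<le> real k *\<^sub>R w" using assms(4) by (rule scaleR_left_mono) simp
  finally have "inf (inf y v) (real k *\<^sub>R c) \<le> real k *\<^sub>R w" .
  moreover have "sup (inf y v) (real k *\<^sub>R c) \<le> v" using assms(3) by simp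
  ultimately show ?thesis unfolding add_eq_inf_sup[of "inf y v"] by (rule add_mono[rotated])
qed

lemma limitin_closure_of:
  assumes "directed_set D r" "x ` D \<subseteq> A" "limitin T x l (tail_filter D r)"
  shows "l \<in> T closure_of A"
  unfolding in_closure_of
proof (intro conjI allI impI)
  show "l \<in> topspace T" using assms(3) by (rule limitin_topspace)
  fix U assume "l \<in> U \<and> openin T U"
  with assms(3) have "eventually (\<lambda>i. x i \<in> U) (tail_filter D r)" unfolding limitin_def by blast
  then obtain i where i: "i \<in> D" "\<forall>j\<in>D. r i j \<longrightarrow> x j \<in> U"
    unfolding eventually_tail_filter[OF assms(1)] by blast
  moreover have "r i i" using assms(1) i(1) unfolding directed_set_def reflp_on_def by blast
  ultimately show "\<exists>y. y \<in> A \<and> y \<in> U" using assms(2) by blast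
qed

lemma adh_suo_subset_adh_uo: "adh_suo A \<subseteq> adh_uo A"
proof
  fix l assume "l \<in> adh_suo A"
  then obtain x :: "nat \<Rightarrow> 'a" where "range x \<subseteq> A" "uo_limit UNIV (\<le>) x l"
    unfolding adh_suo_def by blast
  then show "l \<in> adh_uo A" by (rule adh_uoI[OF directed_set_nat])
qed

context Hausdorff_uo_Lebesgue
begin

lemma adh_uo_subset_closure: "adh_uo A \<subseteq> T closure_of A"
proof
  fix l assume "l \<in> adh_uo A"
  then obtain D :: "'a net_index set" and r x where
    D: "directed_set D r" "x ` D \<subseteq> A" "uo_limit D r x l"
    unfolding adh_uo_def by blast
  show "l \<in> T closure_of A"
    by (rule limitin_closure_of[OF D(1,2) uo_LebesgueD[OF uo_Lebesgue D(1,3)]])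
qed

text \<open>A sequence that converges fast enough for the separating neighbourhoods belonging to its own
  terms is uo-convergent: the Borel-Cantelli argument works below each \<open>\<bar>f k - x\<bar>\<close>, and what is
  disjoint from all these elements does not matter.\<close>

lemma closure_subset_adh_suo:
  assumes csp: "countable_sup_property TYPE('a)"
  shows "T closure_of A \<subseteq> adh_suo A"
proof
  fix x assume x: "x \<in> T closure_of A"
  from ex_separating_nhds[OF csp] obtain N where N: "\<And>u. 0 \<le> u \<Longrightarrow> separating_nhds u (N u)"
    by metis
  have N': "nested_nhds (N u)" if "0 \<le> u" for u using N[OF that] unfolding separating_nhds_def by blast
  \<comment> \<open>Only finitely many earlier terms restrict the choice of \<open>f n\<close>, so
    their neighbourhoods intersect in a neighbourhood. The index \<open>Suc n\<close> is the one
    that \<open>nested_nhds_sum\<close> asks for.\<close>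
  have "\<exists>f. \<forall>n::nat. f n \<in> A \<and> (\<forall>k<n. f n - x \<in> N \<bar>f k - x\<bar> (Suc n))"
  proof (rule dependent_wellorder_choice)
    fix n and f :: "nat \<Rightarrow> 'a"
    have "solid_nhd T (\<Inter>k\<in>{..<n}. N \<bar>f k - x\<bar> (Suc n))"
      using nested_nhdsD(1)[OF N'] by (intro solid_nhd_INT) auto
    from closure_solid_nhd[OF x this] obtain a where
      "a \<in> A" "a - x \<in> (\<Inter>k\<in>{..<n}. N \<bar>f k - x\<bar> (Suc n))" .
    then show "\<exists>a. a \<in> A \<and> (\<forall>k<n. a - x \<in> N \<bar>f k - x\<bar> (Suc n))" by (intro exI[of _ a]) auto
  qed auto
  then obtain f where f: "\<And>n. f n \<in> A" "\<And>n k. k < n \<Longrightarrow> f n - x \<in> N \<bar>f k - x\<bar> (Suc n)"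
    by blast
  define y where "y n = \<bar>f n - x\<bar>" for n
  have y0: "0 \<le> y n" for n by (simp add: y_def)
  have yN: "y n \<in> N (y k) (Suc n)" if "k < n" for n k
    using nested_nhds_downD[OF N'[OF y0] f(2)[OF that, folded y_def], of "y n"] y0 by (simp add: y_def)

  \<comment> \<open>The Borel-Cantelli estimate below \<open>y k\<close>. The partial sums
    \<open>s i\<close>, cut off at \<open>y k\<close>, need not have a supremum, so \<open>w\<close>
    is an upper bound of them whose gap to one of them is small; it dominates every late term
    because that term is part of a partial sum.\<close>
  have tail: "\<exists>w m. w \<in> N (y k) j \<and> (\<forall>n\<ge>m. inf (y n) (y k) \<le> w)" for k j
  proof -
    let ?u = "y k" and ?V = "N (y k)"
    \<comment> \<open>\<open>Suc k\<close> because \<open>y n\<close> is controlled for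
      \<open>n > k\<close> only; \<open>Suc j\<close> because adding the gap to the partial sum
      costs one index.\<close>
    define m where "m = max (Suc j) (Suc k)"
    define s where "s i = (\<Sum>n\<in>{m..<m + i}. y n)" for i
    have V: "nested_nhds ?V" using N'[OF y0] .
    have s0: "0 \<le> s i" for i unfolding s_def by (intro sum_nonneg y0)
    have sV: "s i \<in> ?V m" for i
      unfolding s_def by (rule nested_nhds_sum[OF V]) (use yN in \<open>auto simp: m_def\<close>)
    have smono: "s i \<le> s i'" if "i \<le> i'" for i i'
      unfolding s_def by (rule sum_mono2) (use that y0 in auto)
    let ?S = "range (\<lambda>i. inf (s i) ?u)"
    have "directed_to_zero {w - t |w t. w \<le> ?u \<and> (\<forall>t'\<in>?S. t' \<le> w) \<and> t \<in> ?S}"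
    proof (rule directed_to_zero_gaps)
      fix a b assume "a \<in> ?S" "b \<in> ?S"
      then obtain i i' where i: "a = inf (s i) ?u" "b = inf (s i') ?u" by blast
      have "s i \<le> s (max i i')" "s i' \<le> s (max i i')" by (simp_all add: smono)
      then have "a \<le> inf (s (max i i')) ?u" "b \<le> inf (s (max i i')) ?u"
        unfolding i by (simp_all only: inf_mono order_refl)
      then show "\<exists>d\<in>?S. a \<le> d \<and> b \<le> d" by blast
    qed auto
    from directed_to_zero_solid_nhd[OF this nested_nhdsD(1)[OF V, of m]]
    obtain q where q: "q \<in> {w - t |w t. w \<le> ?u \<and> (\<forall>t'\<in>?S. t' \<le> w) \<and> t \<in> ?S}" "q \<in> ?V m" .
    from q(1) obtain w t where wt: "q = w - t" "\<forall>t'\<in>?S. t' \<le> w" "t \<in> ?S" by blast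
    from wt(3) obtain i where "t = inf (s i) ?u" by blast
    with q(2) wt(1) have w: "w - inf (s i) ?u \<in> ?V m" by simp
    from wt(2) have w_ge: "inf (s i') ?u \<le> w" for i' by (simp only: ball_simps)
    have "inf (s i) ?u \<in> ?V m"
      by (rule nested_nhds_downD[OF V sV[of i]]) (use s0 y0 in \<open>auto intro: le_infI1\<close>)
    moreover have "?V m \<subseteq> ?V (Suc j)" by (rule nested_nhds_mono[OF V]) (simp add: m_def)
    ultimately have "(w - inf (s i) ?u) + inf (s i) ?u \<in> ?V j"
      using nested_nhdsD(2)[OF V] w by blast
    then have "w \<in> ?V j" by (simp del: diff_inf_eq_sup)
    moreover have "inf (y n) ?u \<le> w" if "m \<le> n" for n
    proof -
      have "y n \<le> s (Suc n - m)"
        unfolding s_def using sum_mono2[of "{m..<m + (Suc n - m)}" "{n}" y] that y0 by simp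
      then have "inf (y n) ?u \<le> inf (s (Suc n - m)) ?u" by (rule inf_mono) simp
      with w_ge show ?thesis by (rule order_trans[rotated])
    qed
    ultimately show ?thesis by blast
  qed

  have "order_limit UNIV (\<le>) (\<lambda>n. inf \<bar>f n - x\<bar> v) 0" if v: "0 \<le> v" for v
  proof (rule order_limit_seqI[of _ v])
    fix b assume b: "0 \<le> b" "b \<le> v"
      and bound: "\<And>w m. (\<And>n. m \<le> n \<Longrightarrow> inf \<bar>f n - x\<bar> v \<le> w) \<Longrightarrow> b \<le> w"
    have disj: "inf b (y k) = 0" for k
    proof (rule archimedean_all_nat[OF _ v])
      show c0: "0 \<le> inf b (y k)" using b(1) y0 by simp
      let ?c = "inf b (y k)" and ?V = "N (y k)"
      have V: "nested_nhds ?V" using N'[OF y0] .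
      fix p assume p: "real p *\<^sub>R ?c \<le> v"
      \<comment> \<open>The excess of the next multiple over \<open>v\<close>. It is below
        \<open>y k\<close>, so it vanishes as soon as it lies in all neighbourhoods that separate
        this interval.\<close>
      define g where "g = sup (?c + real p *\<^sub>R ?c - v) 0"
      have "g \<in> ?V i" for i
      proof -
        \<comment> \<open>The index is raised by \<open>p\<close> to pay for the multiple
          \<open>real p *\<^sub>R w\<close>, which bounds \<open>g\<close>.\<close>
        obtain w m where w: "w \<in> ?V (i + p)" "\<And>n. m \<le> n \<Longrightarrow> inf (y n) (y k) \<le> w"
          using tail by blast
        have "0 \<le> inf (y m) (y k)" using y0 by simp
        also have "\<dots> \<le> w" by (rule w(2)) simp
        finally have w0: "0 \<le> w" .
        have "b \<le> v + real p *\<^sub>R w - real p *\<^sub>R ?c"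
        proof (rule bound)
          fix n assume "m \<le> n"
          have "inf ?c (y n) \<le> inf (y n) (y k)" by (simp add: le_infI1)
          also have "\<dots> \<le> w" using w(2) \<open>m \<le> n\<close> .
          finally have "inf ?c (y n) \<le> w" .
          from inf_plus_scaleR_le[OF y0 c0 p this]
          show "inf \<bar>f n - x\<bar> v \<le> v + real p *\<^sub>R w - real p *\<^sub>R ?c"
            by (simp add: y_def le_diff_eq)
        qed
        moreover have "?c \<le> b" by simp
        ultimately have "?c \<le> v + real p *\<^sub>R w - real p *\<^sub>R ?c" by (rule order_trans[rotated])
        then have "?c + real p *\<^sub>R ?c - v \<le> real p *\<^sub>R w" by (simp only: le_diff_eq diff_le_eq add.commute)
        moreover have pw: "0 \<le> real p *\<^sub>R w" using w0 by (simp add: scaleR_nonneg_nonneg)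
        ultimately have "g \<le> real p *\<^sub>R w" unfolding g_def by simp
        with nested_nhds_downD[OF V nested_nhds_scaleR[OF V w(1)], of g] pw
        show ?thesis by (simp add: g_def)
      qed
      moreover have "0 \<le> g" unfolding g_def by simp
      moreover have "g \<le> y k"
      proof -
        have "?c + real p *\<^sub>R ?c \<le> ?c + v" using p by (rule add_left_mono)
        then have "?c + real p *\<^sub>R ?c - v \<le> ?c" by (simp only: diff_le_eq)
        then have "?c + real p *\<^sub>R ?c - v \<le> y k" by (rule order_trans) simp
        then show ?thesis unfolding g_def using y0 by simp
      qed
      ultimately have "g = 0" using N[OF y0[of k]] unfolding separating_nhds_def by blast
      then have "?c + real p *\<^sub>R ?c - v \<le> 0" unfolding g_def by (metis sup_ge1)
      then show "?c + real p *\<^sub>R ?c \<le> v" by (simp only: diff_le_eq add_0_left)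
    qed
    show "b = 0"
    proof (rule archimedean_all_nat[OF b(1) v])
      fix k assume k: "real k *\<^sub>R b \<le> v"
      have "b \<le> v - real k *\<^sub>R b"
      proof (rule bound[of 0])
        fix n
        have "inf b (y n) \<le> 0" using disj by simp
        from inf_plus_scaleR_le[OF y0 b(1) k this] show "inf \<bar>f n - x\<bar> v \<le> v - real k *\<^sub>R b"
          by (simp add: y_def le_diff_eq)
      qed
      then show "b + real k *\<^sub>R b \<le> v" by (simp only: le_diff_eq)
    qed
  qed (use v in auto)
  then have "uo_limit UNIV (\<le>) f x" unfolding uo_limit_def by blast
  with f(1) show "x \<in> adh_suo A" unfolding adh_suo_def by blast
qed

text \<open>Sequential uo-limits are \<open>T\<close>-limits of sequences as well as uo-limits, all
  of these lie in the closure, and the closure leads back to sequential uo-limits. As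
  \<open>A\<close> is arbitrary, this also applies to closures themselves.\<close>

lemma closure_eq_adh:
  assumes "countable_sup_property TYPE('a)"
  shows "adh_suo A = T closure_of A" "adh_uo A = T closure_of A" "adh_seq T A = T closure_of A"
proof -
  have "adh_suo A \<subseteq> adh_seq T A"
    unfolding adh_suo_def adh_seq_def
    using uo_LebesgueD[OF uo_Lebesgue directed_set_nat, unfolded tail_filter_nat] by blast
  moreover have "adh_seq T A \<subseteq> T closure_of A"
  proof
    fix l assume "l \<in> adh_seq T A"
    then obtain x :: "nat \<Rightarrow> 'a" where "range x \<subseteq> A" "limitin T x l sequentially"
      unfolding adh_seq_def by blast
    then show "l \<in> T closure_of A"
      by (rule limitin_closure_of[OF directed_set_nat, unfolded tail_filter_nat])
  qed
  ultimately show "adh_suo A = T closure_of A" "adh_uo A = T closure_of A" "adh_seq T A = T closure_of A"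
    using closure_subset_adh_suo[OF assms, of A] adh_uo_subset_closure[of A]
      adh_suo_subset_adh_uo[of A] by blast+
qed

end

lemma Hausdorff_uo_Lebesgue_unique:
  fixes T T' :: "'a::archimedean_vector_lattice topology"
  assumes "countable_sup_property TYPE('a)" "Hausdorff_uo_Lebesgue T" "Hausdorff_uo_Lebesgue T'"
  shows "T = T'"
proof -
  \<comment> \<open>\<open>adh_suo A\<close> refers to the order alone, so it ties the two closures
    together.\<close>
  have "T closure_of A = T' closure_of A" for A
    using Hausdorff_uo_Lebesgue.closure_eq_adh(1)[OF assms(2,1)]
      Hausdorff_uo_Lebesgue.closure_eq_adh(1)[OF assms(3,1)] by simp
  then have "closedin T A \<longleftrightarrow> closedin T' A" for A by (simp add: closure_of_eq[symmetric])
  then show ?thesis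
    by (simp add: topology_eq openin_closedin_eq
        Hausdorff_uo_Lebesgue.topspace_eq[OF assms(2)] Hausdorff_uo_Lebesgue.topspace_eq[OF assms(3)])
qed

section \<open>The modulus of an order continuous functional\<close>

definition positive_functional :: "('a::archimedean_vector_lattice \<Rightarrow> real) \<Rightarrow> bool" where
  "positive_functional \<phi> \<longleftrightarrow> linear \<phi> \<and> (\<forall>x\<ge>0. 0 \<le> \<phi> x)"

lemma positive_functional_mono:
  assumes "positive_functional \<phi>" "x \<le> y"
  shows "\<phi> x \<le> \<phi> y"
proof -
  have "0 \<le> \<phi> (y - x)" using assms unfolding positive_functional_def by simp
  then show ?thesis using assms(1) unfolding positive_functional_def by (simp add: linear_diff)
qed

lemma positive_functional_abs:
  assumes "positive_functional \<phi>"
  shows "\<bar>\<phi> x\<bar> \<le> \<phi> \<bar>x\<bar>"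
proof -
  have "\<phi> x \<le> \<phi> \<bar>x\<bar>" "\<phi> (- x) \<le> \<phi> \<bar>x\<bar>"
    by (intro positive_functional_mono[OF assms] abs_ge_self abs_ge_minus_self)+
  then show ?thesis using assms unfolding positive_functional_def by (simp add: linear_neg)
qed

lemma order_limit_dominated:
  fixes x :: "'i \<Rightarrow> 'a::archimedean_vector_lattice"
  assumes "order_limit D r x l" "\<And>i. i \<in> D \<Longrightarrow> \<bar>l' - z i\<bar> \<le> \<bar>l - x i\<bar>"
  shows "order_limit D r z l'"
proof -
  from assms(1) obtain B :: "'a set" and s y where B: "decreases_to_zero B s y"
    "\<forall>b\<in>B. \<exists>i\<in>D. \<forall>j\<in>D. r i j \<longrightarrow> \<bar>l - x j\<bar> \<le> y b"
    unfolding order_limit_def by blast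
  have "\<forall>b\<in>B. \<exists>i\<in>D. \<forall>j\<in>D. r i j \<longrightarrow> \<bar>l' - z j\<bar> \<le> y b"
    using B(2) assms(2) by (meson order_trans)
  with B(1) show ?thesis by (rule order_limitI)
qed

lemma oc_dual_linear: "\<phi> \<in> oc_dual \<Longrightarrow> linear \<phi>"
  unfolding oc_dual_def by blast

text \<open>The net \<open>g\<close> indexed by \<open>P\<close> is dominated by \<open>P\<close>
  itself. The case of interest is that of truncations at \<open>p\<close>, where \<open>p\<close>
  must also be below a given \<open>q\<close>.\<close>

lemma oc_dual_directed:
  assumes "\<phi> \<in> oc_dual" and P: "directed_to_zero P" and g: "\<And>p. p \<in> P \<Longrightarrow> \<bar>g p\<bar> \<le> p"
    and "0 < e" "q \<in> P"
  obtains p where "p \<in> P" "p \<le> q" "\<bar>\<phi> (g p)\<bar> < e"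
proof -
  let ?r = "\<lambda>a b. b \<le> (a::'a)"
  have d: "directed_set P ?r" using P unfolding directed_to_zero_def decreases_to_zero_def by blast
  have "\<forall>b\<in>P. \<exists>i\<in>P. \<forall>j\<in>P. j \<le> i \<longrightarrow> \<bar>0 - g j\<bar> \<le> b"
  proof
    fix b assume "b \<in> P"
    have "\<bar>0 - g j\<bar> \<le> b" if "j \<in> P" "j \<le> b" for j
      using order_trans[OF g[OF that(1)] that(2)] by simp
    with \<open>b \<in> P\<close> show "\<exists>i\<in>P. \<forall>j\<in>P. j \<le> i \<longrightarrow> \<bar>0 - g j\<bar> \<le> b" by blast
  qed
  with P have "order_limit P ?r g 0" unfolding directed_to_zero_def by (rule order_limitI)
  from oc_dualD[OF assms(1) d this] have "((\<lambda>p. \<phi> (g p)) \<longlongrightarrow> 0) (tail_filter P ?r)" .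
  from tendstoD[OF this \<open>0 < e\<close>] obtain i where i: "i \<in> P" "\<forall>j\<in>P. j \<le> i \<longrightarrow> \<bar>\<phi> (g j)\<bar> < e"
    by (auto simp: eventually_tail_filter[OF d])
  obtain p where "p \<in> P" "p \<le> i" "p \<le> q" using directed_to_zeroD(2)[OF P i(1) \<open>q \<in> P\<close>] by blast
  with i(2) that show ?thesis by blast
qed

text \<open>A positive functional on a convergent net is controlled by its values on the dominating
  net, so order continuity has to be tested on decreasing nets only.\<close>

lemma oc_dualI_positive:
  assumes \<phi>: "positive_functional \<phi>"
    and dir: "\<And>P e. directed_to_zero P \<Longrightarrow> 0 < e \<Longrightarrow> \<exists>p\<in>P. \<phi> p < e"
  shows "\<phi> \<in> oc_dual"
proof -
  have "((\<lambda>i. \<phi> (x i)) \<longlongrightarrow> 0) (tail_filter D r)"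
    if D: "directed_set D r" and lim: "order_limit D r x 0" for D :: "'a net_index set" and r x
  proof (rule tendstoI)
    fix e :: real assume "0 < e"
    from lim obtain B :: "'a set" and s y where B: "decreases_to_zero B s y"
      "\<forall>b\<in>B. \<exists>i\<in>D. \<forall>j\<in>D. r i j \<longrightarrow> \<bar>0 - x j\<bar> \<le> y b"
      unfolding order_limit_def by blast
    from dir[OF decreases_to_zero_image[OF B(1)] \<open>0 < e\<close>] obtain b where b: "b \<in> B" "\<phi> (y b) < e"
      by blast
    with B(2) obtain i where i: "i \<in> D" "\<forall>j\<in>D. r i j \<longrightarrow> \<bar>0 - x j\<bar> \<le> y b" by blast
    have "\<bar>\<phi> (x j)\<bar> < e" if "j \<in> D" "r i j" for j
    proof -
      have "\<bar>\<phi> (x j)\<bar> \<le> \<phi> \<bar>x j\<bar>" by (rule positive_functional_abs[OF \<phi>])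
      also have "\<bar>x j\<bar> \<le> y b" using i(2) that by simp
      then have "\<phi> \<bar>x j\<bar> \<le> \<phi> (y b)" by (rule positive_functional_mono[OF \<phi>])
      finally show ?thesis using b(2) by simp
    qed
    with i(1) show "eventually (\<lambda>i. dist (\<phi> (x i)) 0 < e) (tail_filter D r)"
      unfolding eventually_tail_filter[OF D] dist_real_def diff_0_right by blast
  qed
  with \<phi> show ?thesis unfolding oc_dual_def positive_functional_def by blast
qed

lemma decreases_to_zero_inverse_scaleR:
  fixes x :: "'a::archimedean_vector_lattice"
  assumes "0 \<le> x"
  shows "decreases_to_zero UNIV (\<le>) (\<lambda>n. inverse (real (Suc n)) *\<^sub>R x)"
proof -
  have "b = 0" if b: "0 \<le> b" "\<And>n. b \<le> inverse (real (Suc n)) *\<^sub>R x" for b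
  proof (rule archimedean[OF b(1)], rule allI)
    fix n
    have "real n *\<^sub>R b \<le> real n *\<^sub>R (inverse (real (Suc n)) *\<^sub>R x)"
      by (rule scaleR_left_mono[OF b(2)]) simp
    also have "\<dots> = (real n * inverse (real (Suc n))) *\<^sub>R x" by simp
    also have "\<dots> \<le> 1 *\<^sub>R x" using assms by (intro scaleR_right_mono) (auto simp: field_simps)
    finally show "real n *\<^sub>R b \<le> x" by simp
  qed
  then have "isGlb UNIV (range (\<lambda>n. inverse (real (Suc n)) *\<^sub>R x)) 0"
    unfolding isGlb_0_iff using assms by (auto intro!: scaleR_nonneg_nonneg)
  moreover have "inverse (real (Suc j)) *\<^sub>R x \<le> inverse (real (Suc i)) *\<^sub>R x" if "i \<le> j" for i j
    using that assms by (intro scaleR_right_mono le_imp_inverse_le) auto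
  ultimately show ?thesis unfolding decreases_to_zero_def using directed_set_nat by blast
qed

section \<open>Order boundedness and the Riesz-Kantorovich formula\<close>

lemma oc_dual_order_bounded:
  assumes \<phi>: "\<phi> \<in> oc_dual" and x: "0 \<le> x"
  shows "bdd_above (\<phi> ` {y. \<bar>y\<bar> \<le> x})"
proof (rule ccontr)
  assume "\<not> ?thesis"
  then have "\<forall>K. \<exists>y. \<bar>y\<bar> \<le> x \<and> K < \<phi> y" unfolding bdd_above_def by (auto simp: not_le)
  then obtain y where y: "\<And>K. \<bar>y K\<bar> \<le> x" "\<And>K. K < \<phi> (y K)" by metis
  \<comment> \<open>Elements with \<open>\<phi>\<close>-value above \<open>n + 1\<close> are divided
    by \<open>n + 1\<close>: the quotients are dominated by multiples of \<open>x\<close> that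
    decrease to 0, yet \<open>\<phi>\<close> stays above 1 on them.\<close>
  define z where "z n = inverse (real (Suc n)) *\<^sub>R y (real (Suc n))" for n
  have z: "\<bar>z n\<bar> \<le> inverse (real (Suc n)) *\<^sub>R x" for n
  proof -
    have "\<bar>z n\<bar> \<le> inverse (real (Suc n)) *\<^sub>R \<bar>y (real (Suc n))\<bar>"
      unfolding z_def using abs_scaleR_le[of "inverse (real (Suc n))"] by simp
    also have "\<dots> \<le> inverse (real (Suc n)) *\<^sub>R x" by (rule scaleR_left_mono[OF y(1)]) simp
    finally show ?thesis .
  qed
  have "order_limit UNIV (\<le>) z 0"
  proof (rule order_limitI[OF decreases_to_zero_inverse_scaleR[OF x]])
    have "\<bar>0 - z j\<bar> \<le> inverse (real (Suc b)) *\<^sub>R x" if "b \<le> j" for b j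
    proof -
      have "\<bar>z j\<bar> \<le> inverse (real (Suc j)) *\<^sub>R x" by (rule z)
      also have "\<dots> \<le> inverse (real (Suc b)) *\<^sub>R x"
        using that x by (intro scaleR_right_mono le_imp_inverse_le) auto
      finally show ?thesis by simp
    qed
    then show "\<forall>b\<in>UNIV. \<exists>i\<in>UNIV. \<forall>j\<in>UNIV. i \<le> j \<longrightarrow> \<bar>0 - z j\<bar> \<le> inverse (real (Suc b)) *\<^sub>R x"
      by blast
  qed
  from oc_dualD[OF \<phi> directed_set_nat this] have "(\<lambda>n. \<phi> (z n)) \<longlonglongrightarrow> 0"
    by (simp add: tail_filter_nat)
  from tendstoD[OF this, of 1] obtain n where "\<bar>\<phi> (z n)\<bar> < 1"
    by (auto simp: eventually_sequentially)
  moreover have "\<phi> (z n) = inverse (real (Suc n)) * \<phi> (y (real (Suc n)))"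
    unfolding z_def using linear_scale[OF oc_dual_linear[OF \<phi>]] by simp
  ultimately show False using y(2)[of "real (Suc n)"] by (simp add: field_simps)
qed

text \<open>The Riesz-Kantorovich formula for the modulus of a functional, meant for
  \<open>x \<ge> 0\<close>.\<close>

definition sup_below :: "('a::archimedean_vector_lattice \<Rightarrow> real) \<Rightarrow> 'a \<Rightarrow> real" where
  "sup_below \<phi> x = (SUP y\<in>{y. \<bar>y\<bar> \<le> x}. \<phi> y)"

lemma sup_below_upper: "\<phi> \<in> oc_dual \<Longrightarrow> \<bar>y\<bar> \<le> x \<Longrightarrow> \<phi> y \<le> sup_below \<phi> x"
  unfolding sup_below_def
  by (rule cSUP_upper) (auto intro: oc_dual_order_bounded order_trans[OF abs_ge_zero])

lemma sup_below_least: "0 \<le> x \<Longrightarrow> (\<And>y. \<bar>y\<bar> \<le> x \<Longrightarrow> \<phi> y \<le> K) \<Longrightarrow> sup_below \<phi> x \<le> K"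
  unfolding sup_below_def by (rule cSUP_least) (auto intro!: exI[of _ 0])

text \<open>For one inequality, truncation at \<open>a\<close> splits every \<open>y\<close> with
  \<open>\<bar>y\<bar> \<le> a + b\<close>; for the other, the suprema over the two summands are
  taken one after the other.\<close>

lemma sup_below_add:
  assumes \<phi>: "\<phi> \<in> oc_dual" and "0 \<le> a" "0 \<le> b"
  shows "sup_below \<phi> (a + b) = sup_below \<phi> a + sup_below \<phi> b"
proof (rule antisym)
  show "sup_below \<phi> (a + b) \<le> sup_below \<phi> a + sup_below \<phi> b"
  proof (rule sup_below_least)
    fix y assume "\<bar>y\<bar> \<le> a + b"
    have "\<phi> y = \<phi> (truncation a y) + \<phi> (y - truncation a y)"
      using linear_add[OF oc_dual_linear[OF \<phi>], of "truncation a y" "y - truncation a y"] by simp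
    also have "\<dots> \<le> sup_below \<phi> a + sup_below \<phi> b"
      using abs_truncation_le[OF assms(2)] abs_diff_truncation_le[OF \<open>\<bar>y\<bar> \<le> a + b\<close> assms(3)]
      by (intro add_mono sup_below_upper[OF \<phi>])
    finally show "\<phi> y \<le> sup_below \<phi> a + sup_below \<phi> b" .
  qed (use assms in simp)
  have "sup_below \<phi> a \<le> sup_below \<phi> (a + b) - sup_below \<phi> b"
  proof (rule sup_below_least[OF assms(2)])
    fix y assume y: "\<bar>y\<bar> \<le> a"
    have "sup_below \<phi> b \<le> sup_below \<phi> (a + b) - \<phi> y"
    proof (rule sup_below_least[OF assms(3)])
      fix z assume z: "\<bar>z\<bar> \<le> b"
      have "\<bar>y + z\<bar> \<le> a + b" using order_trans[OF abs_triangle_ineq add_mono[OF y z]] .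
      then have "\<phi> (y + z) \<le> sup_below \<phi> (a + b)" by (rule sup_below_upper[OF \<phi>])
      then show "\<phi> z \<le> sup_below \<phi> (a + b) - \<phi> y"
        by (simp add: linear_add[OF oc_dual_linear[OF \<phi>]])
    qed
    then show "\<phi> y \<le> sup_below \<phi> (a + b) - sup_below \<phi> b" by simp
  qed
  then show "sup_below \<phi> a + sup_below \<phi> b \<le> sup_below \<phi> (a + b)" by simp
qed

lemma sup_below_scaleR:
  assumes \<phi>: "\<phi> \<in> oc_dual" and "0 \<le> c" and x: "0 \<le> x"
  shows "sup_below \<phi> (c *\<^sub>R x) = c * sup_below \<phi> x"
proof (cases "c = 0")
  case True
  have "sup_below \<phi> 0 = 0" using sup_below_add[OF \<phi>, of 0 0] by simp
  with True show ?thesis by simp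
next
  case False
  have *: "sup_below \<phi> (c *\<^sub>R x) \<le> c * sup_below \<phi> x" if c: "0 < c" and x: "0 \<le> x" for c x
  proof (rule sup_below_least)
    fix y assume y: "\<bar>y\<bar> \<le> c *\<^sub>R x"
    have "\<bar>(1 / c) *\<^sub>R y\<bar> \<le> (1 / c) *\<^sub>R \<bar>y\<bar>" using abs_scaleR_le[of "1 / c" y] c by simp
    also have "\<dots> \<le> (1 / c) *\<^sub>R (c *\<^sub>R x)" using y by (rule scaleR_left_mono) (use c in simp)
    also have "\<dots> = x" using c by simp
    finally have "\<phi> ((1 / c) *\<^sub>R y) \<le> sup_below \<phi> x" by (rule sup_below_upper[OF \<phi>])
    then show "\<phi> y \<le> c * sup_below \<phi> x"
      using c by (simp add: linear_scale[OF oc_dual_linear[OF \<phi>]] field_simps)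
  qed (use c x in \<open>simp add: scaleR_nonneg_nonneg\<close>)
  have c: "0 < c" using False assms(2) by simp
  have "sup_below \<phi> ((1 / c) *\<^sub>R (c *\<^sub>R x)) \<le> (1 / c) * sup_below \<phi> (c *\<^sub>R x)"
    by (rule *) (use c x in \<open>auto intro: scaleR_nonneg_nonneg\<close>)
  with c have "c * sup_below \<phi> x \<le> sup_below \<phi> (c *\<^sub>R x)" by (simp add: field_simps)
  with *[OF c x] show ?thesis by (rule antisym)
qed

text \<open>Extends \<open>sup_below\<close> from the positive cone by writing \<open>x\<close> as a
  difference of two positive elements; by \<open>modulus_diff\<close> the choice of these does not
  matter.\<close>

definition modulus :: "('a::archimedean_vector_lattice \<Rightarrow> real) \<Rightarrow> 'a \<Rightarrow> real" where
  "modulus \<phi> x = sup_below \<phi> (\<bar>x\<bar> + x) - sup_below \<phi> \<bar>x\<bar>"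

lemma abs_plus_self_nonneg: "0 \<le> \<bar>x\<bar> + (x::'a::archimedean_vector_lattice)"
  using abs_ge_minus_self[of x] add_mono[of "- x" "\<bar>x\<bar>" x x] by simp

lemma modulus_diff:
  assumes \<phi>: "\<phi> \<in> oc_dual" and "0 \<le> a" "0 \<le> b"
  shows "modulus \<phi> (a - b) = sup_below \<phi> a - sup_below \<phi> b"
proof -
  let ?x = "a - b"
  have "(\<bar>?x\<bar> + ?x) + b = \<bar>?x\<bar> + a" by simp
  then have "sup_below \<phi> ((\<bar>?x\<bar> + ?x) + b) = sup_below \<phi> (\<bar>?x\<bar> + a)" by (rule arg_cong)
  then show ?thesis
    unfolding modulus_def using sup_below_add[OF \<phi> abs_plus_self_nonneg[of ?x] assms(3)]
      sup_below_add[OF \<phi> abs_ge_zero[of ?x] assms(2)] by linarith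
qed

lemma modulus_nonneg_eq:
  assumes "\<phi> \<in> oc_dual" "0 \<le> x"
  shows "modulus \<phi> x = sup_below \<phi> x"
  using modulus_diff[OF assms, of 0] sup_below_scaleR[OF assms(1), of 0 0] by simp

lemma positive_modulus:
  assumes \<phi>: "\<phi> \<in> oc_dual"
  shows "positive_functional (modulus \<phi>)"
proof -
  note nn = abs_plus_self_nonneg abs_ge_zero
  have "linear (modulus \<phi>)"
  proof (rule linearI)
    fix x y :: 'a
    have "x + y = ((\<bar>x\<bar> + x) + (\<bar>y\<bar> + y)) - (\<bar>x\<bar> + \<bar>y\<bar>)" by simp
    then have "modulus \<phi> (x + y) = sup_below \<phi> ((\<bar>x\<bar> + x) + (\<bar>y\<bar> + y)) - sup_below \<phi> (\<bar>x\<bar> + \<bar>y\<bar>)"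
      using modulus_diff[OF \<phi>, of "(\<bar>x\<bar> + x) + (\<bar>y\<bar> + y)" "\<bar>x\<bar> + \<bar>y\<bar>"] nn by (metis add_nonneg_nonneg)
    then show "modulus \<phi> (x + y) = modulus \<phi> x + modulus \<phi> y"
      unfolding modulus_def by (simp add: sup_below_add[OF \<phi>] nn)
  next
    fix c :: real and x :: 'a
    show "modulus \<phi> (c *\<^sub>R x) = c *\<^sub>R modulus \<phi> x"
    proof (cases "0 \<le> c")
      case True
      have "c *\<^sub>R x = c *\<^sub>R (\<bar>x\<bar> + x) - c *\<^sub>R \<bar>x\<bar>" by (simp add: scaleR_add_right)
      then have "modulus \<phi> (c *\<^sub>R x) = sup_below \<phi> (c *\<^sub>R (\<bar>x\<bar> + x)) - sup_below \<phi> (c *\<^sub>R \<bar>x\<bar>)"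
        using modulus_diff[OF \<phi>, of "c *\<^sub>R (\<bar>x\<bar> + x)" "c *\<^sub>R \<bar>x\<bar>"] True nn
        by (metis scaleR_nonneg_nonneg)
      then show ?thesis
        unfolding modulus_def using True by (simp add: sup_below_scaleR[OF \<phi>] nn right_diff_distrib)
    next
      case False
      have "c *\<^sub>R x = (- c) *\<^sub>R \<bar>x\<bar> - (- c) *\<^sub>R (\<bar>x\<bar> + x)" by (simp add: scaleR_add_right)
      then have "modulus \<phi> (c *\<^sub>R x) = sup_below \<phi> ((- c) *\<^sub>R \<bar>x\<bar>) - sup_below \<phi> ((- c) *\<^sub>R (\<bar>x\<bar> + x))"
        using modulus_diff[OF \<phi>, of "(- c) *\<^sub>R \<bar>x\<bar>" "(- c) *\<^sub>R (\<bar>x\<bar> + x)"] False nn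
        by (metis scaleR_nonneg_nonneg neg_0_le_iff_le linear)
      also have "\<dots> = (- c) * sup_below \<phi> \<bar>x\<bar> - (- c) * sup_below \<phi> (\<bar>x\<bar> + x)"
        using False by (simp only: sup_below_scaleR[OF \<phi>] nn neg_0_le_iff_le linear)
      finally show ?thesis unfolding modulus_def by (simp add: algebra_simps)
    qed
  qed
  moreover have "0 \<le> modulus \<phi> x" if "0 \<le> x" for x
    using sup_below_upper[OF \<phi>, of 0 x] that
    by (simp add: modulus_nonneg_eq[OF \<phi>] linear_0[OF oc_dual_linear[OF \<phi>]])
  ultimately show ?thesis unfolding positive_functional_def by blast
qed

text \<open>If the modulus stayed above \<open>e\<close> on \<open>P\<close>, then for each
  \<open>y\<close> below \<open>q\<close> one could choose \<open>p\<close> so late that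
  \<open>\<phi>\<close> is less than \<open>e / 2\<close> on the truncation of \<open>y\<close> at
  \<open>p\<close>, while the rest of \<open>y\<close> is below \<open>q - p\<close> and loses at
  least \<open>e\<close>. All values would then be \<open>e / 2\<close> below their
  supremum.\<close>

lemma modulus_in_oc_dual:
  fixes \<phi> :: "'a::archimedean_vector_lattice \<Rightarrow> real"
  assumes \<phi>: "\<phi> \<in> oc_dual"
  shows "modulus \<phi> \<in> oc_dual"
proof (rule oc_dualI_positive[OF positive_modulus[OF \<phi>]])
  let ?m = "modulus \<phi>"
  fix P :: "'a set" and e :: real assume P: "directed_to_zero P" and "0 < e"
  show "\<exists>p\<in>P. ?m p < e"
  proof (rule ccontr)
    assume "\<not> ?thesis"
    then have m: "\<And>p. p \<in> P \<Longrightarrow> e \<le> ?m p" by auto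
    obtain q where "q \<in> P" using directed_to_zeroD(1)[OF P] by blast
    then have "0 \<le> q" using directed_to_zeroD(3)[OF P] by blast
    have "sup_below \<phi> q \<le> ?m q - e / 2"
    proof (rule sup_below_least[OF \<open>0 \<le> q\<close>])
      fix y assume "\<bar>y\<bar> \<le> q"
      obtain p where p: "p \<in> P" "p \<le> q" "\<bar>\<phi> (truncation p y)\<bar> < e / 2"
        by (rule oc_dual_directed[OF \<phi> P _ half_gt_zero[OF \<open>0 < e\<close>] \<open>q \<in> P\<close>,
              of "\<lambda>p. truncation p y"])
          (rule abs_truncation_le[OF directed_to_zeroD(3)[OF P]])
      have "\<bar>y - truncation p y\<bar> \<le> q - p"
        by (rule abs_diff_truncation_le) (use \<open>\<bar>y\<bar> \<le> q\<close> p(2) in auto)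
      then have "\<phi> (y - truncation p y) \<le> sup_below \<phi> (q - p)" by (rule sup_below_upper[OF \<phi>])
      also have "\<dots> = ?m (q - p)" using p(2) by (simp add: modulus_nonneg_eq[OF \<phi>])
      also have "\<dots> = ?m q - ?m p"
        using positive_modulus[OF \<phi>] unfolding positive_functional_def by (simp add: linear_diff)
      finally show "\<phi> y \<le> ?m q - e / 2"
        using p(3) m[OF p(1)] by (simp add: linear_diff[OF oc_dual_linear[OF \<phi>]])
    qed
    with \<open>0 < e\<close> show False by (simp add: modulus_nonneg_eq[OF \<phi> \<open>0 \<le> q\<close>])
  qed
qed

section \<open>Identification with the modulus in the order continuous dual\<close>

lemma functional_le_antisym:
  assumes "linear \<phi>" "linear \<psi>" "functional_le \<phi> \<psi>" "functional_le \<psi> \<phi>"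
  shows "\<phi> = \<psi>"
proof
  fix x
  have eq: "\<phi> y = \<psi> y" if "0 \<le> y" for y
    using assms(3,4) that unfolding functional_le_def by (meson antisym)
  have "\<phi> ((\<bar>x\<bar> + x) - \<bar>x\<bar>) = \<psi> ((\<bar>x\<bar> + x) - \<bar>x\<bar>)"
    unfolding linear_diff[OF assms(1)] linear_diff[OF assms(2)]
    by (simp only: eq abs_plus_self_nonneg abs_ge_zero)
  then show "\<phi> x = \<psi> x" by simp
qed

lemma oc_absI:
  assumes "\<psi> \<in> oc_dual" "functional_le \<phi> \<psi>" "functional_le (\<lambda>x. - \<phi> x) \<psi>"
    and "\<And>\<theta>. \<theta> \<in> oc_dual \<Longrightarrow> functional_le \<phi> \<theta> \<Longrightarrow> functional_le (\<lambda>x. - \<phi> x) \<theta> \<Longrightarrow> functional_le \<psi> \<theta>"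
  shows "oc_abs \<phi> = \<psi>"
  unfolding oc_abs_def
proof (rule the_equality)
  show "\<psi> \<in> oc_dual \<and> functional_le \<phi> \<psi> \<and> functional_le (\<lambda>x. - \<phi> x) \<psi> \<and>
     (\<forall>\<theta>\<in>oc_dual. functional_le \<phi> \<theta> \<and> functional_le (\<lambda>x. - \<phi> x) \<theta> \<longrightarrow> functional_le \<psi> \<theta>)"
    using assms by blast
  fix \<psi>' assume *: "\<psi>' \<in> oc_dual \<and> functional_le \<phi> \<psi>' \<and> functional_le (\<lambda>x. - \<phi> x) \<psi>' \<and>
     (\<forall>\<theta>\<in>oc_dual. functional_le \<phi> \<theta> \<and> functional_le (\<lambda>x. - \<phi> x) \<theta> \<longrightarrow> functional_le \<psi>' \<theta>)"
  show "\<psi>' = \<psi>"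
  proof (rule functional_le_antisym)
    show "linear \<psi>'" "linear \<psi>" using * assms(1) oc_dual_linear by blast+
    show "functional_le \<psi>' \<psi>" using * assms(1-3) by blast
    show "functional_le \<psi> \<psi>'" using * assms(4) by blast
  qed
qed

lemma positive_functionalI_le:
  assumes "linear \<theta>" "functional_le \<phi> \<theta>" "functional_le (\<lambda>x. - \<phi> x) \<theta>"
  shows "positive_functional \<theta>"
  unfolding positive_functional_def
proof (intro conjI allI impI assms(1))
  fix x :: 'a assume "0 \<le> x"
  with assms(2,3) have "\<phi> x \<le> \<theta> x" "- \<phi> x \<le> \<theta> x" unfolding functional_le_def by blast+
  then show "0 \<le> \<theta> x" by linarith
qed

lemma functional_le_dominates:
  assumes "linear \<phi>" "linear \<theta>" "functional_le \<phi> \<theta>" "functional_le (\<lambda>x. - \<phi> x) \<theta>"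
  shows "\<phi> y \<le> \<theta> \<bar>y\<bar>"
proof -
  have "\<phi> (pprt y) \<le> \<theta> (pprt y)" using assms(3) unfolding functional_le_def by simp
  moreover have "- \<phi> (- nprt y) \<le> \<theta> (- nprt y)" using assms(4) unfolding functional_le_def by simp
  moreover have "\<phi> (pprt y + nprt y) = \<phi> (pprt y) + \<phi> (nprt y)" by (rule linear_add[OF assms(1)])
  then have "\<phi> y = \<phi> (pprt y) + \<phi> (nprt y)" by (simp only: prts[symmetric])
  moreover have "\<theta> \<bar>y\<bar> = \<theta> (pprt y) - \<theta> (nprt y)"
    unfolding abs_prts by (rule linear_diff[OF assms(2)])
  ultimately show ?thesis by (simp add: linear_neg[OF assms(1)] linear_neg[OF assms(2)])
qed

text \<open>Replaces the definite description of a least upper bound by the Riesz-Kantorovich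
  formula, which all further estimates of \<open>oc_abs\<close> rest on.\<close>

lemma oc_abs_eq_modulus:
  assumes \<phi>: "\<phi> \<in> oc_dual"
  shows "oc_abs \<phi> = modulus \<phi>"
proof (rule oc_absI[OF modulus_in_oc_dual[OF \<phi>]])
  show "functional_le \<phi> (modulus \<phi>)"
    unfolding functional_le_def by (auto simp: modulus_nonneg_eq[OF \<phi>] intro: sup_below_upper[OF \<phi>])
  show "functional_le (\<lambda>x. - \<phi> x) (modulus \<phi>)"
    unfolding functional_le_def
    using sup_below_upper[OF \<phi>, of "- x" x for x] linear_neg[OF oc_dual_linear[OF \<phi>]]
    by (auto simp: modulus_nonneg_eq[OF \<phi>])
next
  fix \<theta> assume \<theta>: "\<theta> \<in> oc_dual" "functional_le \<phi> \<theta>" "functional_le (\<lambda>x. - \<phi> x) \<theta>"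
  have pos: "positive_functional \<theta>" by (rule positive_functionalI_le[OF oc_dual_linear[OF \<theta>(1)] \<theta>(2,3)])
  show "functional_le (modulus \<phi>) \<theta>"
    unfolding functional_le_def
  proof (intro allI impI)
    fix x :: 'a assume "0 \<le> x"
    have "sup_below \<phi> x \<le> \<theta> x"
    proof (rule sup_below_least[OF \<open>0 \<le> x\<close>])
      fix y assume "\<bar>y\<bar> \<le> x"
      have "\<phi> y \<le> \<theta> \<bar>y\<bar>"
        using functional_le_dominates[OF oc_dual_linear[OF \<phi>] oc_dual_linear[OF \<theta>(1)] \<theta>(2,3)] .
      also have "\<dots> \<le> \<theta> x" using positive_functional_mono[OF pos \<open>\<bar>y\<bar> \<le> x\<close>] .
      finally show "\<phi> y \<le> \<theta> x" .
    qed
    then show "modulus \<phi> x \<le> \<theta> x" by (simp add: modulus_nonneg_eq[OF \<phi> \<open>0 \<le> x\<close>])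
  qed
qed

lemma oc_abs_in_oc_dual: "\<phi> \<in> oc_dual \<Longrightarrow> oc_abs \<phi> \<in> oc_dual"
  by (simp add: oc_abs_eq_modulus modulus_in_oc_dual)

lemma positive_oc_abs: "\<phi> \<in> oc_dual \<Longrightarrow> positive_functional (oc_abs \<phi>)"
  by (simp add: oc_abs_eq_modulus positive_modulus)

lemma oc_abs_positive:
  assumes "\<phi> \<in> oc_dual" "positive_functional \<phi>"
  shows "oc_abs \<phi> = \<phi>"
  using assms by (intro oc_absI) (auto simp: functional_le_def positive_functional_def intro: order_trans[of _ 0])

lemma abs_le_oc_abs:
  assumes \<phi>: "\<phi> \<in> oc_dual"
  shows "\<bar>\<phi> x\<bar> \<le> oc_abs \<phi> \<bar>x\<bar>"
  using sup_below_upper[OF \<phi>, of x "\<bar>x\<bar>"] sup_below_upper[OF \<phi>, of "- x" "\<bar>x\<bar>"]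
  by (simp add: oc_abs_eq_modulus[OF \<phi>] modulus_nonneg_eq[OF \<phi>] linear_neg[OF oc_dual_linear[OF \<phi>]])

text \<open>Makes the whole order continuous dual an admissible ideal; its topology will witness
  existence.\<close>

lemma oc_ideal_oc_dual: "oc_ideal oc_dual"
  unfolding oc_ideal_def
proof (intro conjI ballI allI impI)
  show "(\<lambda>x. 0) \<in> oc_dual" by (simp add: oc_dual_def linear_zero)
  fix \<phi> assume \<phi>: "\<phi> \<in> oc_dual"
  show "(\<lambda>x. \<phi> x + \<psi> x) \<in> oc_dual" if "\<psi> \<in> oc_dual" for \<psi>
    using \<phi> that unfolding oc_dual_def by (auto intro: linear_compose_add tendsto_add_zero)
  show "(\<lambda>x. c * \<phi> x) \<in> oc_dual" for c
    using \<phi> linear_compose_scale_right[of \<phi> c] unfolding oc_dual_def by (auto intro: tendsto_mult_right_zero)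
qed auto

section \<open>The Hahn-Banach theorem\<close>

definition sublinear :: "('a::real_vector \<Rightarrow> real) \<Rightarrow> bool" where
  "sublinear q \<longleftrightarrow> (\<forall>x y. q (x + y) \<le> q x + q y) \<and> (\<forall>c>0. \<forall>x. q (c *\<^sub>R x) = c * q x)"

lemma sublinearD:
  assumes "sublinear q"
  shows "q (x + y) \<le> q x + q y" "0 < c \<Longrightarrow> q (c *\<^sub>R x) = c * q x" "q 0 = 0" "- q (- x) \<le> q x"
proof -
  show add: "q (x + y) \<le> q x + q y" for x y using assms unfolding sublinear_def by blast
  show "0 < c \<Longrightarrow> q (c *\<^sub>R x) = c * q x" using assms unfolding sublinear_def by blast
  have "q (2 *\<^sub>R 0) = 2 * q 0" using assms unfolding sublinear_def by (metis zero_less_numeral)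
  then show 0: "q 0 = 0" by simp
  show "- q (- x) \<le> q x" using add[of x "- x"] 0 by simp
qed

lemma sublinearI:
  fixes q :: "'a::real_vector \<Rightarrow> real"
  assumes "\<And>x y. q (x + y) \<le> q x + q y" "\<And>c x. 0 < c \<Longrightarrow> q (c *\<^sub>R x) \<le> c * q x"
  shows "sublinear q"
proof -
  have "q (c *\<^sub>R x) = c * q x" if "0 < c" for c x
  proof (rule antisym)
    have "q ((1 / c) *\<^sub>R (c *\<^sub>R x)) \<le> (1 / c) * q (c *\<^sub>R x)" by (rule assms(2)) (use that in simp)
    with that show "c * q x \<le> q (c *\<^sub>R x)" by (simp add: field_simps)
  qed (rule assms(2)[OF that])
  with assms(1) show ?thesis unfolding sublinear_def by blast
qed

text \<open>The largest sublinear functional below \<open>q\<close> with value at most \<open>- r\<close> at \<open>- k\<close> for all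
  \<open>(k, r)\<close> in a convex cone.\<close>

lemma sublinear_below_cone:
  fixes q :: "'a::real_vector \<Rightarrow> real" and S :: "('a \<times> real) set"
  assumes q: "sublinear q" and "(0, 0) \<in> S"
    and add: "\<And>z z'. z \<in> S \<Longrightarrow> z' \<in> S \<Longrightarrow> z + z' \<in> S"
    and scale: "\<And>c z. 0 < c \<Longrightarrow> z \<in> S \<Longrightarrow> c *\<^sub>R z \<in> S"
    and le: "\<And>z. z \<in> S \<Longrightarrow> snd z \<le> q (fst z)"
  obtains q' where "sublinear q'" "q' \<le> q" "\<And>k r. (k, r) \<in> S \<Longrightarrow> q' (- k) \<le> - r"
proof -
  define q' where "q' y = (INF z\<in>S. q (y + fst z) - snd z)" for y
  \<comment> \<open>The infimum is finite: \<open>snd z\<close> is at most \<open>q (fst z)\<close>,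
    and subadditivity bounds this by \<open>q (y + fst z) + q (- y)\<close>.\<close>
  have "- q (- y) \<le> q (y + fst z) - snd z" if "z \<in> S" for y z
    using sublinearD(1)[OF q, of "y + fst z" "- y"] le[OF that] by simp
  then have "bdd_below ((\<lambda>z. q (y + fst z) - snd z) ` S)" for y by (intro bdd_belowI2)
  then have lower: "q' y \<le> q (y + fst z) - snd z" if "z \<in> S" for y z
    unfolding q'_def using that by (rule cINF_lower)
  have greatest: "K \<le> q' y" if "\<And>z. z \<in> S \<Longrightarrow> K \<le> q (y + fst z) - snd z" for K y
    unfolding q'_def by (rule cINF_greatest) (use that assms(2) in auto)
  have "sublinear q'"
  proof (rule sublinearI)
    fix x y
    have *: "q' (x + y) \<le> (q (x + fst z) - snd z) + (q (y + fst z') - snd z')" if "z \<in> S" "z' \<in> S" for z z'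
      using lower[OF add[OF that], of "x + y"] sublinearD(1)[OF q, of "x + fst z" "y + fst z'"]
      by (simp add: algebra_simps)
    have "q' (x + y) - (q (x + fst z) - snd z) \<le> q' y" if "z \<in> S" for z
      by (rule greatest) (use *[OF that] in \<open>simp add: algebra_simps\<close>)
    then have "q' (x + y) - q' y \<le> q' x" by (intro greatest) (simp add: algebra_simps)
    then show "q' (x + y) \<le> q' x + q' y" by simp
  next
    fix c :: real and x :: 'a assume c: "0 < c"
    have "q' (c *\<^sub>R x) / c \<le> q' x"
    proof (rule greatest)
      fix z assume "z \<in> S"
      have "q' (c *\<^sub>R x) \<le> q (c *\<^sub>R (x + fst z)) - c * snd z"
        using lower[OF scale[OF c \<open>z \<in> S\<close>], of "c *\<^sub>R x"] by (simp add: scaleR_add_right)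
      also have "\<dots> = c * (q (x + fst z) - snd z)"
        by (simp only: sublinearD(2)[OF q c] right_diff_distrib)
      finally show "q' (c *\<^sub>R x) / c \<le> q (x + fst z) - snd z"
        using c by (simp only: pos_divide_le_eq mult.commute)
    qed
    with c show "q' (c *\<^sub>R x) \<le> c * q' x" by (simp add: field_simps)
  qed
  moreover have "q' \<le> q"
  proof (rule le_funI)
    fix y show "q' y \<le> q y" using lower[OF assms(2), of y] by simp
  qed
  moreover have "q' (- k) \<le> - r" if "(k, r) \<in> S" for k r
    using lower[OF that, of "- k"] sublinearD(3)[OF q] by simp
  ultimately show ?thesis by (rule that)
qed

text \<open>The cone spanned by \<open>(y, m y)\<close> yields a sublinear functional below
  \<open>m\<close> whose value at \<open>- y\<close> is at most \<open>- m y\<close>. By minimality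
  it is \<open>m\<close>, so \<open>m\<close> is odd, and odd sublinear functionals are
  linear.\<close>

lemma minimal_sublinear_linear:
  fixes m :: "'a::real_vector \<Rightarrow> real"
  assumes m: "sublinear m" and min: "\<And>q. sublinear q \<Longrightarrow> q \<le> m \<Longrightarrow> q = m"
  shows "linear m"
proof -
  have neg: "m (- y) = - m y" for y
  proof (rule antisym)
    let ?S = "{(t *\<^sub>R y, t * m y) |t. 0 \<le> t}"
    obtain q where q: "sublinear q" "q \<le> m" "\<And>k r. (k, r) \<in> ?S \<Longrightarrow> q (- k) \<le> - r"
    proof (rule sublinear_below_cone[OF m])
      show "(0, 0) \<in> ?S" by (auto intro!: exI[of _ 0])
      show "z + z' \<in> ?S" if zz: "z \<in> ?S" "z' \<in> ?S" for z z'
      proof -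
        from zz obtain t t' where "z = (t *\<^sub>R y, t * m y)" "0 \<le> t" "z' = (t' *\<^sub>R y, t' * m y)" "0 \<le> t'"
          by blast
        then show ?thesis by (auto simp: algebra_simps intro!: exI[of _ "t + t'"])
      qed
      show "c *\<^sub>R z \<in> ?S" if c: "0 < c" and z: "z \<in> ?S" for c z
      proof -
        from z obtain t where "z = (t *\<^sub>R y, t * m y)" "0 \<le> t" by blast
        with c show ?thesis by (auto intro!: exI[of _ "c * t"])
      qed
      show "snd z \<le> m (fst z)" if "z \<in> ?S" for z
      proof -
        from that obtain t where t: "z = (t *\<^sub>R y, t * m y)" "0 \<le> t" by blast
        then show ?thesis
          using sublinearD(2)[OF m, of t y] sublinearD(3)[OF m] by (cases "t = 0") auto
      qed
    qed blast
    have "(y, m y) \<in> ?S" by (auto intro!: exI[of _ 1])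
    with q(3) min[OF q(1,2)] show "m (- y) \<le> - m y" by blast
    show "- m y \<le> m (- y)" using sublinearD(4)[OF m, of "- y"] by simp
  qed
  show ?thesis
  proof (rule linearI)
    fix x y
    have "m x \<le> m (x + y) + m (- y)" using sublinearD(1)[OF m, of "x + y" "- y"] by simp
    with sublinearD(1)[OF m, of x y] neg[of y] show "m (x + y) = m x + m y" by simp
  next
    fix c x
    have *: "m (c *\<^sub>R x) = c * m x" if "0 \<le> c" for c
      using that sublinearD(2,3)[OF m] by (cases "c = 0") auto
    show "m (c *\<^sub>R x) = c *\<^sub>R m x"
    proof (cases "0 \<le> c")
      case False
      with *[of "- c"] neg[of "c *\<^sub>R x"] show ?thesis by simp
    qed (simp add: *)
  qed
qed

text \<open>The pointwise infimum is finite because each member is bounded below by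
  \<open>- p (- x)\<close>. It is subadditive because two members of a chain, applied to the two
  summands, can both be replaced by the smaller one.\<close>

lemma chain_sublinear_lower_bound:
  fixes p :: "'a::real_vector \<Rightarrow> real"
  assumes "C \<noteq> {}" and C: "\<And>q. q \<in> C \<Longrightarrow> sublinear q \<and> q \<le> p"
    and chain: "\<And>q q'. q \<in> C \<Longrightarrow> q' \<in> C \<Longrightarrow> q \<le> q' \<or> q' \<le> q"
  obtains u where "sublinear u" "\<And>q. q \<in> C \<Longrightarrow> u \<le> q"
proof -
  define u where "u x = (INF q\<in>C. q x)" for x
  have "- p (- x) \<le> q x" if "q \<in> C" for q x
    using C[OF that] sublinearD(4)[of q x] le_funD[of q p "- x"] by linarith
  then have "bdd_below ((\<lambda>q. q x) ` C)" for x by (intro bdd_belowI2)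
  then have lower: "u x \<le> q x" if "q \<in> C" for q x
    unfolding u_def using that by (rule cINF_lower)
  have greatest: "K \<le> u x" if "\<And>q. q \<in> C \<Longrightarrow> K \<le> q x" for K x
    unfolding u_def by (rule cINF_greatest[OF assms(1)]) (rule that)
  have "sublinear u"
  proof (rule sublinearI)
    fix x y
    have *: "u (x + y) \<le> q x + q' y" if qq: "q \<in> C" "q' \<in> C" for q q'
    proof -
      have "\<exists>s\<in>C. s \<le> q \<and> s \<le> q'" using chain[OF qq]
      proof
        assume "q \<le> q'"
        with qq(1) show ?thesis by (intro bexI[of _ q]) simp_all
      next
        assume "q' \<le> q"
        with qq(2) show ?thesis by (intro bexI[of _ q']) simp_all
      qed
      then obtain s where s: "s \<in> C" "s \<le> q" "s \<le> q'" by blast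
      have "u (x + y) \<le> s (x + y)" by (rule lower[OF s(1)])
      also have "\<dots> \<le> s x + s y" using C[OF s(1)] sublinearD(1) by blast
      also have "\<dots> \<le> q x + q' y" using s(2,3) by (intro add_mono le_funD[of s])
      finally show ?thesis .
    qed
    have "u (x + y) - q x \<le> u y" if "q \<in> C" for q
      by (rule greatest) (use *[OF that] in \<open>simp add: algebra_simps\<close>)
    then have "u (x + y) - u y \<le> u x" by (intro greatest) (simp add: algebra_simps)
    then show "u (x + y) \<le> u x + u y" by simp
  next
    fix c :: real and x :: 'a assume c: "0 < c"
    have "u (c *\<^sub>R x) / c \<le> u x"
    proof (rule greatest)
      fix q assume q: "q \<in> C"
      then have "q (c *\<^sub>R x) = c * q x" using C sublinearD(2) c by blast
      with c lower[OF q, of "c *\<^sub>R x"] show "u (c *\<^sub>R x) / c \<le> q x" by (simp add: field_simps)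
    qed
    with c show "u (c *\<^sub>R x) \<le> c * u x" by (simp add: field_simps)
  qed
  then show ?thesis by (rule that) (simp add: le_fun_def lower)
qed

text \<open>Prescribed values do not appear here; they are built into \<open>p\<close> beforehand by
  \<open>sublinear_below_cone\<close>.\<close>

theorem Hahn_Banach_sublinear:
  fixes p :: "'a::real_vector \<Rightarrow> real"
  assumes p: "sublinear p"
  obtains g where "linear g" "g \<le> p"
proof -
  let ?A = "{q. sublinear q \<and> q \<le> p}"
  have "\<exists>m\<in>?A. \<forall>a\<in>?A. a \<le> m \<longrightarrow> a = m"
  proof -
    \<comment> \<open>\<open>predicate_Zorn\<close> yields maximal elements, so the order is
      reversed to obtain a minimal one.\<close>
    have "\<exists>m\<in>?A. \<forall>a\<in>?A. (\<lambda>q q'. q' \<le> q) m a \<longrightarrow> a = m"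
    proof (rule predicate_Zorn)
      show "partial_order_on ?A (relation_of (\<lambda>q q'. q' \<le> q) ?A)"
        by (rule partial_order_on_relation_ofI) auto
      fix C assume "C \<in> Chains (relation_of (\<lambda>q q'. q' \<le> q) ?A)"
      then have C: "\<And>q. q \<in> C \<Longrightarrow> sublinear q \<and> q \<le> p" "\<And>q q'. q \<in> C \<Longrightarrow> q' \<in> C \<Longrightarrow> q \<le> q' \<or> q' \<le> q"
        unfolding Chains_def relation_of_def by blast+
      show "\<exists>u\<in>?A. \<forall>a\<in>C. u \<le> a"
      proof (cases "C = {}")
        case True
        with p show ?thesis by auto
      next
        case False
        obtain u where u: "sublinear u" "\<And>q. q \<in> C \<Longrightarrow> u \<le> q"
          using chain_sublinear_lower_bound[OF False C] by blast
        from False obtain q where "q \<in> C" by blast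
        with u(2) C(1) have "u \<le> p" by (meson order_trans)
        with u show ?thesis by blast
      qed
    qed
    then show ?thesis .
  qed
  then obtain m where m: "sublinear m" "m \<le> p" "\<And>a. sublinear a \<Longrightarrow> a \<le> p \<Longrightarrow> a \<le> m \<Longrightarrow> a = m"
    by blast
  have "linear m" by (rule minimal_sublinear_linear[OF m(1)]) (use m(2,3) order_trans in blast)
  then show ?thesis using m(2) by (rule that)
qed

lemma sublinear_positive_abs:
  assumes \<phi>: "positive_functional \<phi>"
  shows "sublinear (\<lambda>y. \<phi> \<bar>y\<bar>)"
proof (rule sublinearI)
  have lin: "linear \<phi>" using \<phi> unfolding positive_functional_def by blast
  fix x y
  show "\<phi> \<bar>x + y\<bar> \<le> \<phi> \<bar>x\<bar> + \<phi> \<bar>y\<bar>"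
    unfolding linear_add[OF lin, symmetric] by (rule positive_functional_mono[OF \<phi> abs_triangle_ineq])
  fix c :: real assume "0 < c"
  have "\<phi> \<bar>c *\<^sub>R x\<bar> \<le> \<phi> (\<bar>c\<bar> *\<^sub>R \<bar>x\<bar>)" by (rule positive_functional_mono[OF \<phi> abs_scaleR_le])
  with \<open>0 < c\<close> show "\<phi> \<bar>c *\<^sub>R x\<bar> \<le> c * \<phi> \<bar>x\<bar>" by (simp add: linear_scale[OF lin])
qed

text \<open>The cone prescribes the lower bound \<open>t * d\<close> for \<open>g\<close> at
  \<open>t *\<^sub>R x - f\<close>, which the distance hypothesis makes compatible with the
  seminorm. Taking \<open>t = 0\<close> forces \<open>g\<close> to vanish on the subspace, and
  \<open>t = 1\<close>, \<open>f = 0\<close> gives the value at \<open>x\<close>.\<close>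

lemma separating_functional:
  fixes x :: "'a::archimedean_vector_lattice"
  assumes \<phi>: "positive_functional \<phi>" and F: "subspace F" and d: "\<And>f. f \<in> F \<Longrightarrow> d \<le> \<phi> \<bar>x - f\<bar>"
  obtains g where "linear g" "\<And>y. \<bar>g y\<bar> \<le> \<phi> \<bar>y\<bar>" "\<And>f. f \<in> F \<Longrightarrow> g f = 0" "d \<le> g x"
proof -
  let ?p = "\<lambda>y. \<phi> \<bar>y\<bar>"
  let ?S = "{(t *\<^sub>R x - f, t * d) |t f. 0 \<le> t \<and> f \<in> F}"
  have p: "sublinear ?p" by (rule sublinear_positive_abs[OF \<phi>])
  obtain q where q: "sublinear q" "q \<le> ?p" "\<And>k r. (k, r) \<in> ?S \<Longrightarrow> q (- k) \<le> - r"
  proof (rule sublinear_below_cone[OF p])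
    show "(0, 0) \<in> ?S" using subspace_0[OF F] by (auto intro!: exI[of _ 0])
    show "z + z' \<in> ?S" if zz: "z \<in> ?S" "z' \<in> ?S" for z z'
    proof -
      from zz obtain t f t' f' where "z = (t *\<^sub>R x - f, t * d)" "0 \<le> t" "f \<in> F"
        "z' = (t' *\<^sub>R x - f', t' * d)" "0 \<le> t'" "f' \<in> F"
        by blast
      then show ?thesis using subspace_add[OF F, of f f']
        by (auto simp: algebra_simps intro!: exI[of _ "t + t'"] exI[of _ "f + f'"])
    qed
    show "c *\<^sub>R z \<in> ?S" if c: "0 < c" and z: "z \<in> ?S" for c z
    proof -
      from z obtain t f where "z = (t *\<^sub>R x - f, t * d)" "0 \<le> t" "f \<in> F" by blast
      then show ?thesis using subspace_scale[OF F, of f c] c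
        by (auto simp: scaleR_diff_right intro!: exI[of _ "c * t"] exI[of _ "c *\<^sub>R f"])
    qed
    show "snd z \<le> ?p (fst z)" if "z \<in> ?S" for z
    proof -
      from that obtain t f where t: "z = (t *\<^sub>R x - f, t * d)" "0 \<le> t" "f \<in> F" by blast
      show ?thesis
      proof (cases "t = 0")
        case True
        with t \<phi> show ?thesis unfolding positive_functional_def by simp
      next
        case False
        have "d \<le> \<phi> \<bar>x - (1 / t) *\<^sub>R f\<bar>" by (rule d[OF subspace_scale[OF F t(3)]])
        then have "t * d \<le> ?p (t *\<^sub>R (x - (1 / t) *\<^sub>R f))"
          using sublinearD(2)[OF p, of t "x - (1 / t) *\<^sub>R f"] False t(2) by simp
        also have "t *\<^sub>R (x - (1 / t) *\<^sub>R f) = t *\<^sub>R x - f" using False by (simp add: scaleR_diff_right)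
        finally show ?thesis using t(1) by simp
      qed
    qed
  qed blast
  obtain g where g: "linear g" "g \<le> q" using Hahn_Banach_sublinear[OF q(1)] .
  have gp: "g y \<le> \<phi> \<bar>y\<bar>" for y using le_funD[OF g(2), of y] le_funD[OF q(2), of y] by simp
  have gF: "g f \<le> 0" if "f \<in> F" for f
  proof -
    have "(0 *\<^sub>R x - f, 0 * d) \<in> ?S" using that by blast
    from q(3)[OF this] le_funD[OF g(2), of f] show ?thesis by simp
  qed
  show ?thesis
  proof (rule that[OF g(1)])
    show "\<bar>g y\<bar> \<le> \<phi> \<bar>y\<bar>" for y
      using gp[of y] gp[of "- y"] by (simp add: linear_neg[OF g(1)])
    show "g f = 0" if "f \<in> F" for f
      using gF[OF that] gF[OF subspace_neg[OF F that]] by (simp add: linear_neg[OF g(1)])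
    have "(1 *\<^sub>R x - 0, 1 * d) \<in> ?S" using subspace_0[OF F] by (intro CollectI exI conjI) auto
    from q(3)[OF this] le_funD[OF g(2), of "- x"] show "d \<le> g x" by (simp add: linear_neg[OF g(1)])
  qed
qed

section \<open>The topology of an ideal of functionals\<close>

lemma positive_functional_inf_add:
  assumes "positive_functional \<phi>" "0 \<le> u"
  shows "\<phi> (inf \<bar>x + y\<bar> u) \<le> \<phi> (inf \<bar>x\<bar> u) + \<phi> (inf \<bar>y\<bar> u)"
proof -
  have "inf \<bar>x + y\<bar> u \<le> inf (\<bar>x\<bar> + \<bar>y\<bar>) u" by (rule inf_mono[OF abs_triangle_ineq order_refl])
  also have "\<dots> \<le> inf \<bar>x\<bar> u + inf \<bar>y\<bar> u" using assms(2) by (intro inf_add_le) auto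
  finally have "\<phi> (inf \<bar>x + y\<bar> u) \<le> \<phi> (inf \<bar>x\<bar> u + inf \<bar>y\<bar> u)" by (rule positive_functional_mono[OF assms(1)])
  then show ?thesis using assms(1) unfolding positive_functional_def by (simp add: linear_add)
qed

text \<open>The truncated seminorms are subadditive but not homogeneous, since \<open>u\<close> does
  not scale with \<open>x\<close>; hence the factor \<open>K\<close> is at least 1.\<close>

lemma positive_functional_inf_scaleR:
  assumes "positive_functional \<phi>" "0 \<le> u" "\<bar>c\<bar> \<le> K" "1 \<le> K"
  shows "\<phi> (inf \<bar>c *\<^sub>R x\<bar> u) \<le> K * \<phi> (inf \<bar>x\<bar> u)"
proof -
  have "inf \<bar>c *\<^sub>R x\<bar> u \<le> inf (\<bar>c\<bar> *\<^sub>R \<bar>x\<bar>) u" by (rule inf_mono[OF abs_scaleR_le order_refl])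
  also have "\<dots> \<le> K *\<^sub>R inf \<bar>x\<bar> u" using assms by (intro inf_scaleR_le) auto
  finally have "\<phi> (inf \<bar>c *\<^sub>R x\<bar> u) \<le> \<phi> (K *\<^sub>R inf \<bar>x\<bar> u)" by (rule positive_functional_mono[OF assms(1)])
  then show ?thesis using assms(1) unfolding positive_functional_def by (simp add: linear_scale)
qed

lemma positive_functional_inf_mono:
  assumes "positive_functional \<phi>" "\<bar>x\<bar> \<le> \<bar>y\<bar>" "u \<le> v"
  shows "\<phi> (inf \<bar>x\<bar> u) \<le> \<phi> (inf \<bar>y\<bar> v)"
  by (rule positive_functional_mono[OF assms(1) inf_mono[OF assms(2,3)]])

lemma oc_dual_eventually_small:
  assumes \<phi>: "\<phi> \<in> oc_dual" and D: "directed_set D r" and "order_limit D r x l" and "0 < e"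
  shows "eventually (\<lambda>i. \<phi> \<bar>x i - l\<bar> < e) (tail_filter D r)"
proof -
  have "order_limit D r (\<lambda>i. \<bar>x i - l\<bar>) 0"
    by (rule order_limit_dominated[OF assms(3)]) (simp add: abs_minus_commute)
  from tendstoD[OF oc_dualD[OF \<phi> D this] \<open>0 < e\<close>]
  show ?thesis by (rule eventually_mono) simp
qed

lemma oc_dualI_dominated:
  assumes "linear g" "\<phi> \<in> oc_dual" and g: "\<And>y. \<bar>g y\<bar> \<le> \<phi> \<bar>y\<bar>"
  shows "g \<in> oc_dual"
proof -
  have "((\<lambda>i. g (x i)) \<longlongrightarrow> 0) (tail_filter D r)"
    if D: "directed_set D r" "order_limit D r x 0" for D :: "'a net_index set" and r x
  proof (rule tendstoI)
    fix e :: real assume "0 < e"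
    have "eventually (\<lambda>i. \<phi> \<bar>x i - 0\<bar> < e) (tail_filter D r)"
      by (rule oc_dual_eventually_small[OF assms(2) D \<open>0 < e\<close>])
    then show "eventually (\<lambda>i. dist (g (x i)) 0 < e) (tail_filter D r)"
    proof (rule eventually_mono)
      fix i assume "\<phi> \<bar>x i - 0\<bar> < e"
      with g[of "x i"] show "dist (g (x i)) 0 < e" by simp
    qed
  qed
  with assms(1) show ?thesis unfolding oc_dual_def by blast
qed

lemma limitin_topology_generated_by:
  assumes "l \<in> \<Union>S" and ev: "\<And>U. U \<in> S \<Longrightarrow> l \<in> U \<Longrightarrow> eventually (\<lambda>i. x i \<in> U) F"
  shows "limitin (topology_generated_by S) x l F"
proof -
  have "eventually (\<lambda>i. x i \<in> U) F" if "generate_topology_on S U" "l \<in> U" for U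
    using that
  proof (induction rule: generate_topology_on.induct)
    case Empty
    then show ?case by simp
  next
    case (Int a b)
    then have "eventually (\<lambda>i. x i \<in> a) F" "eventually (\<lambda>i. x i \<in> b) F" by auto
    then show ?case by eventually_elim simp
  next
    case (UN K)
    then obtain k where "k \<in> K" "l \<in> k" "eventually (\<lambda>i. x i \<in> k) F" by blast
    from this(3) show ?case by (rule eventually_mono) (use \<open>k \<in> K\<close> in blast)
  next
    case (Basis s)
    then show ?case by (rule ev)
  qed
  with assms(1) show ?thesis unfolding limitin_def openin_topology_generated_by_iff by simp
qed

lemma closure_of_meets:
  assumes "x \<in> T closure_of A" "openin T U" "x \<in> U"
  obtains a where "a \<in> A" "a \<in> U"
  using assms unfolding in_closure_of by blast

lemma closure_of_adh_o:
  fixes T :: "'a::archimedean_vector_lattice topology"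
  assumes T: "\<And>(D :: 'a net_index set) r x l. directed_set D r \<Longrightarrow> order_limit D r x l \<Longrightarrow>
      limitin T x l (tail_filter D r)" and F: "F \<subseteq> topspace T"
  shows "adh_o (adh_o F) \<subseteq> T closure_of F"
proof -
  have *: "adh_o B \<subseteq> T closure_of B" for B
  proof
    fix l assume "l \<in> adh_o B"
    then obtain D :: "'a net_index set" and r x where
      D: "directed_set D r" "x ` D \<subseteq> B" "order_limit D r x l"
      unfolding adh_o_def by blast
    show "l \<in> T closure_of B" by (rule limitin_closure_of[OF D(1,2) T[OF D(1,3)]])
  qed
  have "adh_o (adh_o F) \<subseteq> T closure_of (T closure_of F)"
    using *[of "adh_o F"] closure_of_mono[OF *[of F], of T] by blast
  then show ?thesis by simp
qed

locale separating_ideal =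
  fixes I :: "('a::archimedean_vector_lattice \<Rightarrow> real) set"
  assumes ideal: "oc_ideal I" and separates: "separates_points I"
begin

section \<open>The positive functionals in the ideal\<close>

definition pos :: "('a \<Rightarrow> real) set" where
  "pos = {\<phi>\<in>I. positive_functional \<phi>}"

lemma I_subset: "I \<subseteq> oc_dual"
  using ideal unfolding oc_ideal_def by blast

lemma pos_positive: "\<phi> \<in> pos \<Longrightarrow> positive_functional \<phi>"
  and pos_oc_dual: "\<phi> \<in> pos \<Longrightarrow> \<phi> \<in> oc_dual"
  and pos_I: "\<phi> \<in> pos \<Longrightarrow> \<phi> \<in> I"
  and pos_linear: "\<phi> \<in> pos \<Longrightarrow> linear \<phi>"
  using I_subset unfolding pos_def positive_functional_def by auto

lemma zero_pos: "(\<lambda>x. 0) \<in> pos"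
  using ideal unfolding pos_def oc_ideal_def positive_functional_def by (simp add: linear_zero)

lemma add_pos: "\<phi> \<in> pos \<Longrightarrow> \<psi> \<in> pos \<Longrightarrow> (\<lambda>x. \<phi> x + \<psi> x) \<in> pos"
  using ideal unfolding pos_def oc_ideal_def positive_functional_def by (simp add: linear_compose_add)

text \<open>Places the functionals found by Hahn-Banach in the ideal: domination makes
  \<open>g\<close> order continuous and its modulus at most \<open>\<phi>\<close>.\<close>

lemma dominated_in_I:
  assumes \<phi>: "\<phi> \<in> pos" and "linear g" and g: "\<And>y. \<bar>g y\<bar> \<le> \<phi> \<bar>y\<bar>"
  shows "g \<in> I"
proof -
  have goc: "g \<in> oc_dual" by (rule oc_dualI_dominated[OF assms(2) pos_oc_dual[OF \<phi>] g])
  have "functional_le (oc_abs g) (oc_abs \<phi>)"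
    unfolding functional_le_def oc_abs_positive[OF pos_oc_dual[OF \<phi>] pos_positive[OF \<phi>]] oc_abs_eq_modulus[OF goc]
  proof (intro allI impI)
    fix x :: 'a assume "0 \<le> x"
    have "sup_below g x \<le> \<phi> x"
    proof (rule sup_below_least[OF \<open>0 \<le> x\<close>])
      fix y assume "\<bar>y\<bar> \<le> x"
      have "g y \<le> \<phi> \<bar>y\<bar>" using g[of y] by simp
      also have "\<dots> \<le> \<phi> x" by (rule positive_functional_mono[OF pos_positive[OF \<phi>] \<open>\<bar>y\<bar> \<le> x\<close>])
      finally show "g y \<le> \<phi> x" .
    qed
    then show "modulus g x \<le> \<phi> x" by (simp add: modulus_nonneg_eq[OF goc \<open>0 \<le> x\<close>])
  qed
  with ideal goc pos_I[OF \<phi>] show ?thesis unfolding oc_ideal_def by blast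
qed

lemma oc_abs_pos:
  assumes "\<phi> \<in> I"
  shows "oc_abs \<phi> \<in> pos"
proof -
  have \<phi>: "\<phi> \<in> oc_dual" using I_subset assms by blast
  have "oc_abs (oc_abs \<phi>) = oc_abs \<phi>"
    by (rule oc_abs_positive[OF oc_abs_in_oc_dual[OF \<phi>] positive_oc_abs[OF \<phi>]])
  then have "functional_le (oc_abs (oc_abs \<phi>)) (oc_abs \<phi>)" by (simp add: functional_le_def)
  with ideal assms oc_abs_in_oc_dual[OF \<phi>] have "oc_abs \<phi> \<in> I" unfolding oc_ideal_def by blast
  with positive_oc_abs[OF \<phi>] show ?thesis unfolding pos_def by blast
qed

lemma ex_pos_separates:
  assumes "x \<noteq> 0"
  obtains \<phi> where "\<phi> \<in> pos" "0 < \<phi> \<bar>x\<bar>"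
proof -
  obtain \<phi> where \<phi>: "\<phi> \<in> I" "\<phi> x \<noteq> \<phi> 0" using assms separates unfolding separates_points_def by blast
  then have "\<phi> \<in> oc_dual" using I_subset by blast
  then have "\<phi> 0 = 0" by (intro linear_0 oc_dual_linear)
  with \<phi>(2) abs_le_oc_abs[OF \<open>\<phi> \<in> oc_dual\<close>, of x] have "0 < oc_abs \<phi> \<bar>x\<bar>" by linarith
  with oc_abs_pos[OF \<phi>(1)] show ?thesis by (rule that)
qed

section \<open>The unbounded topology of the ideal\<close>

definition uo_ball :: "('a \<Rightarrow> real) \<Rightarrow> 'a \<Rightarrow> real \<Rightarrow> 'a \<Rightarrow> 'a set" where
  "uo_ball \<phi> u e x = {y. \<phi> (inf \<bar>y - x\<bar> u) < e}"

text \<open>The unbounded version of the absolute weak topology. Balls for a single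
  \<open>\<phi>\<close> and \<open>u\<close> form a base, because two pairs are dominated by the
  pair of their sums.\<close>

definition uo_topology :: "'a topology" where
  "uo_topology = topology (\<lambda>U. \<forall>x\<in>U. \<exists>\<phi>\<in>pos. \<exists>u\<ge>0. \<exists>e>0. uo_ball \<phi> u e x \<subseteq> U)"

lemma center_uo_ball:
  assumes "\<phi> \<in> pos" "0 \<le> u" "0 < e"
  shows "x \<in> uo_ball \<phi> u e x"
  using assms linear_0[OF pos_linear[OF assms(1)]] unfolding uo_ball_def by (simp add: inf_absorb1)

lemma uo_ball_add:
  assumes \<phi>: "\<phi> \<in> pos" and u: "0 \<le> u"
    and "y \<in> uo_ball \<phi> u d x" "z \<in> uo_ball \<phi> u e y"
  shows "z \<in> uo_ball \<phi> u (d + e) x"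
  using positive_functional_inf_add[OF pos_positive[OF \<phi>] u, of "z - y" "y - x"] assms(3,4)
  unfolding uo_ball_def by simp

lemma openin_uo_topology:
  "openin uo_topology U \<longleftrightarrow> (\<forall>x\<in>U. \<exists>\<phi>\<in>pos. \<exists>u\<ge>0. \<exists>e>0. uo_ball \<phi> u e x \<subseteq> U)"
proof -
  have "istopology (\<lambda>U. \<forall>x\<in>U. \<exists>\<phi>\<in>pos. \<exists>u\<ge>0. \<exists>e>0. uo_ball \<phi> u e x \<subseteq> U)"
    unfolding istopology_def
  proof (intro conjI allI impI)
    fix S S' assume S: "\<forall>x\<in>S. \<exists>\<phi>\<in>pos. \<exists>u\<ge>0. \<exists>e>0. uo_ball \<phi> u e x \<subseteq> S"
      and S': "\<forall>x\<in>S'. \<exists>\<phi>\<in>pos. \<exists>u\<ge>0. \<exists>e>0. uo_ball \<phi> u e x \<subseteq> S'"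
    show "\<forall>x\<in>S \<inter> S'. \<exists>\<phi>\<in>pos. \<exists>u\<ge>0. \<exists>e>0. uo_ball \<phi> u e x \<subseteq> S \<inter> S'"
    proof
      fix x assume x: "x \<in> S \<inter> S'"
      from S x obtain \<phi> u e where 1: "\<phi> \<in> pos" "0 \<le> u" "0 < e" "uo_ball \<phi> u e x \<subseteq> S" by blast
      from S' x obtain \<psi> v d where 2: "\<psi> \<in> pos" "0 \<le> v" "0 < d" "uo_ball \<psi> v d x \<subseteq> S'" by blast
      let ?\<theta> = "\<lambda>x. \<phi> x + \<psi> x"
      have "uo_ball ?\<theta> (u + v) (min e d) x \<subseteq> uo_ball \<phi> u e x \<inter> uo_ball \<psi> v d x"
      proof
        fix y assume y: "y \<in> uo_ball ?\<theta> (u + v) (min e d) x"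
        have uv: "u \<le> u + v" "v \<le> u + v" using 1(2) 2(2) by auto
        have nn: "0 \<le> inf \<bar>y - x\<bar> (u + v)" using 1(2) 2(2) by simp
        have "0 \<le> \<phi> (inf \<bar>y - x\<bar> (u + v))" "0 \<le> \<psi> (inf \<bar>y - x\<bar> (u + v))"
          using pos_positive[OF 1(1)] pos_positive[OF 2(1)] nn unfolding positive_functional_def by blast+
        moreover have "\<phi> (inf \<bar>y - x\<bar> u) \<le> \<phi> (inf \<bar>y - x\<bar> (u + v))"
          by (rule positive_functional_inf_mono[OF pos_positive[OF 1(1)] order_refl uv(1)])
        moreover have "\<psi> (inf \<bar>y - x\<bar> v) \<le> \<psi> (inf \<bar>y - x\<bar> (u + v))"
          by (rule positive_functional_inf_mono[OF pos_positive[OF 2(1)] order_refl uv(2)])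
        ultimately show "y \<in> uo_ball \<phi> u e x \<inter> uo_ball \<psi> v d x"
          using y unfolding uo_ball_def by auto
      qed
      with 1(4) 2(4) have sub: "uo_ball ?\<theta> (u + v) (min e d) x \<subseteq> S \<inter> S'" by blast
      have "0 \<le> u + v" "0 < min e d" using 1 2 by auto
      with add_pos[OF 1(1) 2(1)] sub
      show "\<exists>\<phi>\<in>pos. \<exists>u\<ge>0. \<exists>e>0. uo_ball \<phi> u e x \<subseteq> S \<inter> S'" by blast
    qed
  next
    fix K assume K: "\<forall>S\<in>K. \<forall>x\<in>S. \<exists>\<phi>\<in>pos. \<exists>u\<ge>0. \<exists>e>0. uo_ball \<phi> u e x \<subseteq> S"
    show "\<forall>x\<in>\<Union>K. \<exists>\<phi>\<in>pos. \<exists>u\<ge>0. \<exists>e>0. uo_ball \<phi> u e x \<subseteq> \<Union>K"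
    proof
      fix x assume "x \<in> \<Union>K"
      then obtain S where S: "S \<in> K" "x \<in> S" by blast
      with K obtain \<phi> u e where "\<phi> \<in> pos" "0 \<le> u" "0 < e" "uo_ball \<phi> u e x \<subseteq> S" by blast
      moreover have "S \<subseteq> \<Union>K" using S(1) by blast
      ultimately show "\<exists>\<phi>\<in>pos. \<exists>u\<ge>0. \<exists>e>0. uo_ball \<phi> u e x \<subseteq> \<Union>K" by (meson order_trans)
    qed
  qed
  then show ?thesis by (simp add: uo_topology_def)
qed

lemma topspace_uo_topology [simp]: "topspace uo_topology = UNIV"
proof -
  have "openin uo_topology UNIV"
    unfolding openin_uo_topology using zero_pos by (metis order_refl subset_UNIV zero_less_one)
  then show ?thesis by (metis openin_subset top.extremum_uniqueI)
qed

lemma openin_uo_ball: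
  assumes "\<phi> \<in> pos" "0 \<le> u"
  shows "openin uo_topology (uo_ball \<phi> u e x)"
  unfolding openin_uo_topology
proof
  fix y assume y: "y \<in> uo_ball \<phi> u e x"
  let ?n = "\<phi> (inf \<bar>y - x\<bar> u)"
  have "z \<in> uo_ball \<phi> u e x" if "z \<in> uo_ball \<phi> u (e - ?n) y" for z
    using positive_functional_inf_add[OF pos_positive[OF assms(1)] assms(2), of "z - y" "y - x"] that
    unfolding uo_ball_def by simp
  then have "uo_ball \<phi> u (e - ?n) y \<subseteq> uo_ball \<phi> u e x" by blast
  moreover have "0 < e - ?n" using y unfolding uo_ball_def by simp
  ultimately show "\<exists>\<phi>'\<in>pos. \<exists>u'\<ge>0. \<exists>e'>0. uo_ball \<phi>' u' e' y \<subseteq> uo_ball \<phi> u e x"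
    using assms by blast
qed

lemma in_closure_of_uo_topology:
  "x \<in> uo_topology closure_of A \<longleftrightarrow>
    (\<forall>\<phi>\<in>pos. \<forall>u\<ge>0. \<forall>e>0. \<exists>a\<in>A. \<phi> (inf \<bar>a - x\<bar> u) < e)"
proof
  assume x: "x \<in> uo_topology closure_of A"
  show "\<forall>\<phi>\<in>pos. \<forall>u\<ge>0. \<forall>e>0. \<exists>a\<in>A. \<phi> (inf \<bar>a - x\<bar> u) < e"
  proof (intro ballI allI impI)
    fix \<phi> :: "'a \<Rightarrow> real" and u :: 'a and e :: real
    assume *: "\<phi> \<in> pos" "0 \<le> u" "0 < e"
    obtain a where "a \<in> A" "a \<in> uo_ball \<phi> u e x"
      by (rule closure_of_meets[OF x openin_uo_ball[OF *(1,2)] center_uo_ball[OF *]])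
    then show "\<exists>a\<in>A. \<phi> (inf \<bar>a - x\<bar> u) < e" unfolding uo_ball_def by blast
  qed
next
  assume x: "\<forall>\<phi>\<in>pos. \<forall>u\<ge>0. \<forall>e>0. \<exists>a\<in>A. \<phi> (inf \<bar>a - x\<bar> u) < e"
  show "x \<in> uo_topology closure_of A"
    unfolding in_closure_of
  proof (intro conjI allI impI)
    fix U assume "x \<in> U \<and> openin uo_topology U"
    then obtain \<phi> u e where U: "\<phi> \<in> pos" "0 \<le> u" "0 < e" "uo_ball \<phi> u e x \<subseteq> U"
      unfolding openin_uo_topology by blast
    with x obtain a where "a \<in> A" "\<phi> (inf \<bar>a - x\<bar> u) < e" by blast
    with U(4) show "\<exists>y. y \<in> A \<and> y \<in> U" unfolding uo_ball_def by blast
  qed simp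
qed

section \<open>Hausdorff property, linearity and local solidity\<close>

lemma Hausdorff_uo_topology: "Hausdorff_space uo_topology"
  unfolding Hausdorff_space_def
proof (intro allI impI)
  fix x y assume "x \<in> topspace uo_topology \<and> y \<in> topspace uo_topology \<and> x \<noteq> y"
  then have "y - x \<noteq> 0" by simp
  then obtain \<phi> where \<phi>: "\<phi> \<in> pos" "0 < \<phi> \<bar>y - x\<bar>" by (rule ex_pos_separates)
  \<comment> \<open>With this \<open>u\<close> the truncation leaves
    \<open>\<bar>y - x\<bar>\<close> unchanged, so a common point of the two balls would contradict
    the triangle inequality.\<close>
  let ?u = "\<bar>y - x\<bar>" and ?e = "\<phi> \<bar>y - x\<bar> / 2"
  have e: "0 < ?e" using \<phi>(2) by simp
  have "disjnt (uo_ball \<phi> ?u ?e x) (uo_ball \<phi> ?u ?e y)"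
    unfolding disjnt_iff
  proof (intro allI notI, elim conjE)
    fix z assume z: "z \<in> uo_ball \<phi> ?u ?e x" "z \<in> uo_ball \<phi> ?u ?e y"
    then have "y \<in> uo_ball \<phi> ?u ?e z" unfolding uo_ball_def by (simp add: abs_minus_commute)
    from uo_ball_add[OF \<phi>(1) _ z(1) this] show False unfolding uo_ball_def by simp
  qed
  moreover have "openin uo_topology (uo_ball \<phi> ?u ?e x)" "openin uo_topology (uo_ball \<phi> ?u ?e y)"
    by (simp_all add: openin_uo_ball[OF \<phi>(1)])
  moreover have "x \<in> uo_ball \<phi> ?u ?e x" "y \<in> uo_ball \<phi> ?u ?e y"
    by (rule center_uo_ball[OF \<phi>(1) abs_ge_zero e])+
  ultimately show "\<exists>U V. openin uo_topology U \<and> openin uo_topology V \<and> x \<in> U \<and> y \<in> V \<and> disjnt U V"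
    by blast
qed

lemma continuous_add_uo_topology:
  "continuous_map (prod_topology uo_topology uo_topology) uo_topology (\<lambda>(x, y). x + y)"
  unfolding continuous_map_def
proof (intro conjI allI impI)
  fix U assume U: "openin uo_topology U"
  show "openin (prod_topology uo_topology uo_topology)
      {p \<in> topspace (prod_topology uo_topology uo_topology). (case p of (x, y) \<Rightarrow> x + y) \<in> U}"
    unfolding openin_prod_topology_alt
  proof (intro allI impI)
    fix x y assume "(x, y) \<in> {p \<in> topspace (prod_topology uo_topology uo_topology). (case p of (x, y) \<Rightarrow> x + y) \<in> U}"
    then have "x + y \<in> U" by simp
    with U obtain \<phi> u e where *: "\<phi> \<in> pos" "0 \<le> u" "0 < e" "uo_ball \<phi> u e (x + y) \<subseteq> U"
      unfolding openin_uo_topology by blast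
    have e: "0 < e / 2" using *(3) by simp
    let ?A = "uo_ball \<phi> u (e / 2) x" and ?B = "uo_ball \<phi> u (e / 2) y"
    have "a + b \<in> U" if "a \<in> ?A" "b \<in> ?B" for a b
    proof -
      have "\<phi> (inf \<bar>(a - x) + (b - y)\<bar> u) \<le> \<phi> (inf \<bar>a - x\<bar> u) + \<phi> (inf \<bar>b - y\<bar> u)"
        by (rule positive_functional_inf_add[OF pos_positive[OF *(1)] *(2)])
      also have "\<dots> < e" using that unfolding uo_ball_def by simp
      also have "(a - x) + (b - y) = (a + b) - (x + y)" by simp
      finally have "a + b \<in> uo_ball \<phi> u e (x + y)" unfolding uo_ball_def by simp
      with *(4) show ?thesis by blast
    qed
    then have sub: "?A \<times> ?B \<subseteq> {p \<in> topspace (prod_topology uo_topology uo_topology). (case p of (x, y) \<Rightarrow> x + y) \<in> U}"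
      by auto
    show "\<exists>A B. openin uo_topology A \<and> openin uo_topology B \<and> x \<in> A \<and> y \<in> B \<and>
        A \<times> B \<subseteq> {p \<in> topspace (prod_topology uo_topology uo_topology). (case p of (x, y) \<Rightarrow> x + y) \<in> U}"
      by (intro exI[of _ ?A] exI[of _ ?B] conjI openin_uo_ball[OF *(1,2)] center_uo_ball[OF *(1,2) e] sub)
  qed
qed simp

lemma continuous_scaleR_uo_topology:
  "continuous_map (prod_topology euclideanreal uo_topology) uo_topology (\<lambda>(c, x). c *\<^sub>R x)"
  unfolding continuous_map_def
proof (intro conjI allI impI)
  fix U assume U: "openin uo_topology U"
  show "openin (prod_topology euclideanreal uo_topology)
      {p \<in> topspace (prod_topology euclideanreal uo_topology). (case p of (c, x) \<Rightarrow> c *\<^sub>R x) \<in> U}"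
    unfolding openin_prod_topology_alt
  proof (intro allI impI)
    fix c x assume "(c, x) \<in> {p \<in> topspace (prod_topology euclideanreal uo_topology). (case p of (c, x) \<Rightarrow> c *\<^sub>R x) \<in> U}"
    then have "c *\<^sub>R x \<in> U" by simp
    with U obtain \<phi> u e where *: "\<phi> \<in> pos" "0 \<le> u" "0 < e" "uo_ball \<phi> u e (c *\<^sub>R x) \<subseteq> U"
      unfolding openin_uo_topology by blast
    note pos = pos_positive[OF *(1)]
    \<comment> \<open>\<open>K\<close> bounds \<open>\<bar>a\<bar>\<close> as soon as
      \<open>a\<close> is within 1 of \<open>c\<close>. The summand 1 in \<open>M\<close> keeps the
      divisor positive when \<open>\<phi> \<bar>x\<bar>\<close> is 0.\<close>
    define K where "K = \<bar>c\<bar> + 1"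
    define M where "M = \<phi> \<bar>x\<bar> + 1"
    have K: "1 \<le> K" "0 < e / (2 * K)" using *(3) by (simp_all add: K_def)
    have M: "1 \<le> M" using pos unfolding M_def positive_functional_def by simp
    define A where "A = ball c (min 1 (e / (2 * M)))"
    let ?B = "uo_ball \<phi> u (e / (2 * K)) x"
    have "a *\<^sub>R b \<in> U" if a: "a \<in> A" and b: "b \<in> ?B" for a b
    proof -
      have a': "\<bar>a - c\<bar> < 1" "\<bar>a - c\<bar> < e / (2 * M)" using a unfolding A_def by (auto simp: dist_real_def)
      have "\<phi> (inf \<bar>a *\<^sub>R (b - x) + (a - c) *\<^sub>R x\<bar> u) \<le> \<phi> (inf \<bar>a *\<^sub>R (b - x)\<bar> u) + \<phi> (inf \<bar>(a - c) *\<^sub>R x\<bar> u)"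
        by (rule positive_functional_inf_add[OF pos *(2)])
      moreover have "\<phi> (inf \<bar>a *\<^sub>R (b - x)\<bar> u) \<le> K * \<phi> (inf \<bar>b - x\<bar> u)"
        using a'(1) K(1) by (intro positive_functional_inf_scaleR[OF pos *(2)]) (auto simp: K_def)
      moreover have "K * \<phi> (inf \<bar>b - x\<bar> u) < e / 2"
        using b K(1) unfolding uo_ball_def by (simp add: field_simps)
      moreover have "\<phi> (inf \<bar>(a - c) *\<^sub>R x\<bar> u) \<le> e / 2"
      proof -
        have "inf \<bar>(a - c) *\<^sub>R x\<bar> u \<le> \<bar>a - c\<bar> *\<^sub>R \<bar>x\<bar>" by (rule le_infI1[OF abs_scaleR_le])
        then have "\<phi> (inf \<bar>(a - c) *\<^sub>R x\<bar> u) \<le> \<phi> (\<bar>a - c\<bar> *\<^sub>R \<bar>x\<bar>)" by (rule positive_functional_mono[OF pos])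
        also have "\<dots> = \<bar>a - c\<bar> * \<phi> \<bar>x\<bar>" by (simp add: linear_scale[OF pos_linear[OF *(1)]])
        also have "\<dots> \<le> \<bar>a - c\<bar> * M" unfolding M_def by (intro mult_left_mono) auto
        also have "\<dots> \<le> e / (2 * M) * M" using a'(2) M by (intro mult_right_mono) auto
        also have "\<dots> = e / 2" using M by simp
        finally show ?thesis .
      qed
      moreover have "a *\<^sub>R (b - x) + (a - c) *\<^sub>R x = a *\<^sub>R b - c *\<^sub>R x" by (simp add: algebra_simps)
      ultimately have "\<phi> (inf \<bar>a *\<^sub>R b - c *\<^sub>R x\<bar> u) < e" by simp
      with *(4) show ?thesis unfolding uo_ball_def by blast
    qed
    then have sub: "A \<times> ?B \<subseteq> {p \<in> topspace (prod_topology euclideanreal uo_topology). (case p of (c, x) \<Rightarrow> c *\<^sub>R x) \<in> U}"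
      by auto
    have "openin euclideanreal A" "c \<in> A" using M *(3) unfolding A_def by auto
    then show "\<exists>A B. openin euclideanreal A \<and> openin uo_topology B \<and> c \<in> A \<and> x \<in> B \<and>
        A \<times> B \<subseteq> {p \<in> topspace (prod_topology euclideanreal uo_topology). (case p of (c, x) \<Rightarrow> c *\<^sub>R x) \<in> U}"
      by (intro exI[of _ A] exI[of _ ?B] conjI openin_uo_ball[OF *(1,2)] center_uo_ball[OF *(1,2) K(2)] sub)
  qed
qed simp

lemma locally_solid_uo_topology: "locally_solid uo_topology"
  unfolding locally_solid_def
proof (intro conjI allI impI)
  show "linear_topology uo_topology"
    unfolding linear_topology_def
    using continuous_add_uo_topology continuous_scaleR_uo_topology by simp
  fix U assume "openin uo_topology U \<and> 0 \<in> U"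
  then obtain \<phi> u e where *: "\<phi> \<in> pos" "0 \<le> u" "0 < e" "uo_ball \<phi> u e 0 \<subseteq> U"
    unfolding openin_uo_topology by blast
  have "solid (uo_ball \<phi> u e 0)"
    unfolding solid_def uo_ball_def
  proof (intro allI impI)
    fix x y assume xy: "y \<in> {y. \<phi> (inf \<bar>y - 0\<bar> u) < e} \<and> \<bar>x\<bar> \<le> \<bar>y\<bar>"
    then have "\<phi> (inf \<bar>x\<bar> u) \<le> \<phi> (inf \<bar>y\<bar> u)"
      by (intro positive_functional_inf_mono[OF pos_positive[OF *(1)]]) auto
    with xy show "x \<in> {y. \<phi> (inf \<bar>y - 0\<bar> u) < e}" by simp
  qed
  with * openin_uo_ball[OF *(1,2), of e 0] center_uo_ball[OF *(1-3), of 0]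
  show "\<exists>V W. solid V \<and> V \<subseteq> U \<and> openin uo_topology W \<and> 0 \<in> W \<and> W \<subseteq> V" by blast
qed

sublocale Hausdorff_uo_Lebesgue uo_topology
proof
  show "uo_Lebesgue uo_topology"
    unfolding uo_Lebesgue_def
  proof (intro conjI allI impI)
    fix D :: "'a net_index set" and r and x :: "'a net_index \<Rightarrow> 'a" and l
    assume "directed_set D r \<and> uo_limit D r x l"
    then have D: "directed_set D r" and lim: "uo_limit D r x l" by blast+
    show "limitin uo_topology x l (tail_filter D r)"
      unfolding limitin_def
    proof (intro conjI allI impI)
      fix U assume "openin uo_topology U \<and> l \<in> U"
      then obtain \<phi> u e where *: "\<phi> \<in> pos" "0 \<le> u" "0 < e" "uo_ball \<phi> u e l \<subseteq> U"
        unfolding openin_uo_topology by blast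
      have "order_limit D r (\<lambda>i. inf \<bar>x i - l\<bar> u) 0" using lim *(2) unfolding uo_limit_def by blast
      from oc_dual_eventually_small[OF pos_oc_dual[OF *(1)] D this *(3)]
      show "eventually (\<lambda>i. x i \<in> U) (tail_filter D r)"
      proof (rule eventually_mono)
        fix i assume "\<phi> \<bar>inf \<bar>x i - l\<bar> u - 0\<bar> < e"
        moreover have "0 \<le> inf \<bar>x i - l\<bar> u" using *(2) by simp
        ultimately have "x i \<in> uo_ball \<phi> u e l" unfolding uo_ball_def by simp
        with *(4) show "x i \<in> U" by blast
      qed
    qed simp
  qed (rule locally_solid_uo_topology)
qed (rule Hausdorff_uo_topology)

text \<open>Treats addition, supremum and infimum alike through their common Lipschitz
  estimate.\<close>

lemma closure_of_binop:
  assumes f: "\<And>a b x y. \<bar>f a b - f x y\<bar> \<le> \<bar>a - x\<bar> + \<bar>b - y\<bar>"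
    and F: "\<And>a b. a \<in> F \<Longrightarrow> b \<in> F \<Longrightarrow> f a b \<in> F"
    and x: "x \<in> uo_topology closure_of F" and y: "y \<in> uo_topology closure_of F"
  shows "f x y \<in> uo_topology closure_of F"
  unfolding in_closure_of_uo_topology
proof (intro ballI allI impI)
  fix \<phi> :: "'a \<Rightarrow> real" and u :: 'a and e :: real
    assume *: "\<phi> \<in> pos" "0 \<le> u" "0 < e"
  then have "0 < e / 2" by simp
  with x y * obtain a b where ab: "a \<in> F" "\<phi> (inf \<bar>a - x\<bar> u) < e / 2" "b \<in> F" "\<phi> (inf \<bar>b - y\<bar> u) < e / 2"
    unfolding in_closure_of_uo_topology by meson
  have "\<bar>f a b - f x y\<bar> \<le> \<bar>\<bar>a - x\<bar> + \<bar>b - y\<bar>\<bar>" using f[of a b x y] by simp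
  then have "\<phi> (inf \<bar>f a b - f x y\<bar> u) \<le> \<phi> (inf \<bar>\<bar>a - x\<bar> + \<bar>b - y\<bar>\<bar> u)"
    by (rule positive_functional_inf_mono[OF pos_positive[OF *(1)] _ order_refl])
  also have "\<dots> \<le> \<phi> (inf \<bar>\<bar>a - x\<bar>\<bar> u) + \<phi> (inf \<bar>\<bar>b - y\<bar>\<bar> u)"
    by (rule positive_functional_inf_add[OF pos_positive[OF *(1)] *(2)])
  also have "\<dots> < e" using ab by simp
  finally show "\<exists>c\<in>F. \<phi> (inf \<bar>c - f x y\<bar> u) < e" using F ab by blast
qed

lemma vector_sublattice_closure:
  assumes F: "vector_sublattice F"
  shows "vector_sublattice (uo_topology closure_of F)"
proof -
  have sub: "subspace F" and F': "\<And>a b. a \<in> F \<Longrightarrow> b \<in> F \<Longrightarrow> sup a b \<in> F" "\<And>a b. a \<in> F \<Longrightarrow> b \<in> F \<Longrightarrow> inf a b \<in> F"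
    using F unfolding vector_sublattice_def by blast+
  let ?G = "uo_topology closure_of F"
  have add_diff: "\<bar>a + b - (x + y)\<bar> \<le> \<bar>a - x\<bar> + \<bar>b - y\<bar>" for a b x y :: 'a
    using abs_triangle_ineq[of "a - x" "b - y"] by (simp add: algebra_simps)
  have "c *\<^sub>R x \<in> ?G" if x: "x \<in> ?G" for c x
    unfolding in_closure_of_uo_topology
  proof (intro ballI allI impI)
    fix \<phi> :: "'a \<Rightarrow> real" and u :: 'a and e :: real
    assume *: "\<phi> \<in> pos" "0 \<le> u" "0 < e"
    let ?K = "max 1 \<bar>c\<bar>"
    have "0 < e / ?K" using *(3) by simp
    with x * obtain a where a: "a \<in> F" "\<phi> (inf \<bar>a - x\<bar> u) < e / ?K"
      unfolding in_closure_of_uo_topology by meson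
    have "\<phi> (inf \<bar>c *\<^sub>R a - c *\<^sub>R x\<bar> u) = \<phi> (inf \<bar>c *\<^sub>R (a - x)\<bar> u)" by (simp add: scaleR_diff_right)
    also have "\<dots> \<le> ?K * \<phi> (inf \<bar>a - x\<bar> u)"
      by (rule positive_functional_inf_scaleR[OF pos_positive[OF *(1)] *(2)]) auto
    also have "\<dots> < e"
    proof -
      have "0 < ?K" by simp
      with a(2) show ?thesis by (simp only: pos_less_divide_eq mult.commute)
    qed
    finally show "\<exists>b\<in>F. \<phi> (inf \<bar>b - c *\<^sub>R x\<bar> u) < e" using subspace_scale[OF sub a(1)] by blast
  qed
  moreover have "0 \<in> ?G" using subspace_0[OF sub] closure_of_subset[of F uo_topology] by auto
  moreover have "x + y \<in> ?G" if "x \<in> ?G" "y \<in> ?G" for x y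
    by (rule closure_of_binop[of "(+)", OF add_diff subspace_add[OF sub] that])
  ultimately have "subspace ?G" unfolding subspace_def by blast
  moreover have "sup x y \<in> ?G" if "x \<in> ?G" "y \<in> ?G" for x y
    by (rule closure_of_binop[of sup, OF abs_sup_diff_le F'(1) that])
  moreover have "inf x y \<in> ?G" if "x \<in> ?G" "y \<in> ?G" for x y
    by (rule closure_of_binop[of inf, OF abs_inf_diff_le F'(2) that])
  ultimately show ?thesis unfolding vector_sublattice_def by blast
qed

text \<open>A point outside the closure has a positive truncated distance from the subspace. The
  untruncated seminorm is larger, so its distance is positive too, and a functional in
  \<open>I\<close> separates the point from the subspace.\<close>

lemma weak_closure_subset:
  assumes F: "subspace F"
  shows "weak_topology_of I closure_of F \<subseteq> uo_topology closure_of F"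
proof (rule subsetI, rule ccontr)
  fix x assume x: "x \<in> weak_topology_of I closure_of F" and "x \<notin> uo_topology closure_of F"
  then obtain \<phi> u e where *: "\<phi> \<in> pos" "0 \<le> u" "0 < e" "\<And>a. a \<in> F \<Longrightarrow> e \<le> \<phi> (inf \<bar>a - x\<bar> u)"
    unfolding in_closure_of_uo_topology by (meson not_le)
  have "e \<le> \<phi> \<bar>x - f\<bar>" if "f \<in> F" for f
  proof -
    have "e \<le> \<phi> (inf \<bar>f - x\<bar> u)" by (rule *(4)[OF that])
    also have "\<dots> \<le> \<phi> \<bar>f - x\<bar>" by (rule positive_functional_mono[OF pos_positive[OF *(1)] inf_le1])
    finally show ?thesis by (simp add: abs_minus_commute)
  qed
  then obtain g where g: "linear g" "\<And>y. \<bar>g y\<bar> \<le> \<phi> \<bar>y\<bar>" "\<And>f. f \<in> F \<Longrightarrow> g f = 0" "e \<le> g x"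
    using separating_functional[OF pos_positive[OF *(1)] F] by metis
  have "g \<in> I" by (rule dominated_in_I[OF *(1) g(1,2)])
  then have "g -` {0<..} \<in> {\<phi> -` U |\<phi> U. \<phi> \<in> I \<and> open U}"
    by (intro CollectI exI[of _ g] exI[of _ "{0<..}"]) simp
  then have "openin (weak_topology_of I) (g -` {0<..})"
    unfolding weak_topology_of_def by (rule topology_generated_by_Basis)
  moreover have "x \<in> g -` {0<..}" using g(4) *(3) by simp
  ultimately obtain f where "f \<in> F" "f \<in> g -` {0<..}" by (rule closure_of_meets[OF x])
  with g(3) show False by simp
qed

lemma abs_weak_closure_subset: "abs_weak_topology_of I closure_of F \<subseteq> uo_topology closure_of F"
proof
  fix x assume x: "x \<in> abs_weak_topology_of I closure_of F"
  show "x \<in> uo_topology closure_of F"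
    unfolding in_closure_of_uo_topology
  proof (intro ballI allI impI)
    fix \<phi> :: "'a \<Rightarrow> real" and u :: 'a and e :: real
    assume *: "\<phi> \<in> pos" "0 \<le> u" "0 < e"
    have abs: "oc_abs \<phi> = \<phi>" by (rule oc_abs_positive[OF pos_oc_dual[OF *(1)] pos_positive[OF *(1)]])
    have "{y. oc_abs \<phi> \<bar>y - x\<bar> < e} \<in> {{x. oc_abs \<phi> \<bar>x - a\<bar> < e} |\<phi> a e. \<phi> \<in> I \<and> 0 < e}"
      using pos_I[OF *(1)] *(3) by blast
    then have "openin (abs_weak_topology_of I) {y. oc_abs \<phi> \<bar>y - x\<bar> < e}"
      unfolding abs_weak_topology_of_def by (rule topology_generated_by_Basis)
    moreover have "x \<in> {y. oc_abs \<phi> \<bar>y - x\<bar> < e}"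
      using *(3) linear_0[OF pos_linear[OF *(1)]] by (simp add: abs)
    ultimately obtain a where "a \<in> F" "a \<in> {y. oc_abs \<phi> \<bar>y - x\<bar> < e}"
      by (rule closure_of_meets[OF x])
    then have a: "a \<in> F" "\<phi> \<bar>a - x\<bar> < e" by (simp_all add: abs)
    have "\<phi> (inf \<bar>a - x\<bar> u) \<le> \<phi> \<bar>a - x\<bar>" by (rule positive_functional_mono[OF pos_positive[OF *(1)] inf_le1])
    with a show "\<exists>a\<in>F. \<phi> (inf \<bar>a - x\<bar> u) < e" by (meson le_less_trans)
  qed
qed

section \<open>Order convergence in the weak and absolute weak topologies\<close>

lemma topspace_weak: "topspace (weak_topology_of I) = UNIV"
proof -
  have "(\<lambda>x. 0) -` UNIV \<in> {\<phi> -` U |\<phi> U. \<phi> \<in> I \<and> open U}" using pos_I[OF zero_pos] by blast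
  then show ?thesis unfolding weak_topology_of_def topology_generated_by_topspace by blast
qed

lemma topspace_abs_weak: "topspace (abs_weak_topology_of I) = UNIV"
proof -
  have "x \<in> \<Union>{{x. oc_abs \<phi> \<bar>x - a\<bar> < e} |\<phi> a e. \<phi> \<in> I \<and> 0 < e}" for x
  proof -
    have "oc_abs (\<lambda>x::'a. 0) = (\<lambda>x. 0)"
      by (rule oc_abs_positive[OF pos_oc_dual[OF zero_pos] pos_positive[OF zero_pos]])
    then have "x \<in> {y. oc_abs (\<lambda>x::'a. 0) \<bar>y - x\<bar> < 1}" by simp
    then show ?thesis using pos_I[OF zero_pos] zero_less_one by blast
  qed
  then show ?thesis unfolding abs_weak_topology_of_def topology_generated_by_topspace by blast
qed

lemma order_limit_weak:
  assumes D: "directed_set D r" and lim: "order_limit D r x l"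
  shows "limitin (weak_topology_of I) x l (tail_filter D r)"
  unfolding weak_topology_of_def
proof (rule limitin_topology_generated_by)
  show "l \<in> \<Union>{\<phi> -` U |\<phi> U. \<phi> \<in> I \<and> open U}"
    by (simp only: topspace_weak[unfolded weak_topology_of_def topology_generated_by_topspace] UNIV_I)
  fix V assume "V \<in> {\<phi> -` U |\<phi> U. \<phi> \<in> I \<and> open U}" "l \<in> V"
  then obtain \<phi> U where V: "V = \<phi> -` U" "\<phi> \<in> I" "open U" "\<phi> l \<in> U" by blast
  then obtain e where e: "0 < e" "ball (\<phi> l) e \<subseteq> U" using open_contains_ball by blast
  have \<phi>: "\<phi> \<in> oc_dual" using I_subset V(2) by blast
  from oc_dual_eventually_small[OF oc_abs_in_oc_dual[OF \<phi>] D lim e(1)]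
  show "eventually (\<lambda>i. x i \<in> V) (tail_filter D r)"
  proof (rule eventually_mono)
    fix i assume "oc_abs \<phi> \<bar>x i - l\<bar> < e"
    with abs_le_oc_abs[OF \<phi>, of "x i - l"] have "\<bar>\<phi> (x i) - \<phi> l\<bar> < e"
      by (simp add: linear_diff[OF oc_dual_linear[OF \<phi>]])
    then have "\<phi> (x i) \<in> ball (\<phi> l) e" by (simp add: dist_real_def abs_minus_commute)
    with e(2) V(1) show "x i \<in> V" by blast
  qed
qed

lemma order_limit_abs_weak:
  assumes D: "directed_set D r" and lim: "order_limit D r x l"
  shows "limitin (abs_weak_topology_of I) x l (tail_filter D r)"
  unfolding abs_weak_topology_of_def
proof (rule limitin_topology_generated_by)
  show "l \<in> \<Union>{{x. oc_abs \<phi> \<bar>x - a\<bar> < e} |\<phi> a e. \<phi> \<in> I \<and> 0 < e}"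
    by (simp only: topspace_abs_weak[unfolded abs_weak_topology_of_def topology_generated_by_topspace] UNIV_I)
  fix V assume "V \<in> {{x. oc_abs \<phi> \<bar>x - a\<bar> < e} |\<phi> a e. \<phi> \<in> I \<and> 0 < e}" "l \<in> V"
  then obtain \<phi> a e where V: "V = {x. oc_abs \<phi> \<bar>x - a\<bar> < e}" "\<phi> \<in> I" "oc_abs \<phi> \<bar>l - a\<bar> < e" by blast
  have \<phi>: "\<phi> \<in> oc_dual" using I_subset V(2) by blast
  \<comment> \<open>The subbasic set is centred at \<open>a\<close>, not at \<open>l\<close>; this
    is the radius that remains around \<open>l\<close>.\<close>
  have "0 < e - oc_abs \<phi> \<bar>l - a\<bar>" using V(3) by simp
  from oc_dual_eventually_small[OF oc_abs_in_oc_dual[OF \<phi>] D lim this]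
  show "eventually (\<lambda>i. x i \<in> V) (tail_filter D r)"
  proof (rule eventually_mono)
    fix i assume "oc_abs \<phi> \<bar>x i - l\<bar> < e - oc_abs \<phi> \<bar>l - a\<bar>"
    moreover have "oc_abs \<phi> \<bar>x i - a\<bar> \<le> oc_abs \<phi> (\<bar>x i - l\<bar> + \<bar>l - a\<bar>)"
      by (rule positive_functional_mono[OF positive_oc_abs[OF \<phi>] abs_diff_triangle])
    ultimately show "x i \<in> V"
      unfolding V(1) by (simp add: linear_add[OF oc_dual_linear[OF oc_abs_in_oc_dual[OF \<phi>]]])
  qed
qed

end

section \<open>Order adherences\<close>

lemma order_limit_imp_uo_limit:
  fixes x :: "'i \<Rightarrow> 'a::archimedean_vector_lattice"
  assumes "order_limit D r x l"
  shows "uo_limit D r x l"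
  unfolding uo_limit_def
proof (intro allI impI)
  fix u :: 'a assume u: "0 \<le> u"
  show "order_limit D r (\<lambda>i. inf \<bar>x i - l\<bar> u) 0"
  proof (rule order_limit_dominated[OF assms])
    fix i
    have "0 \<le> inf \<bar>x i - l\<bar> u" using u by simp
    then have "\<bar>0 - inf \<bar>x i - l\<bar> u\<bar> = inf \<bar>x i - l\<bar> u" by simp
    also have "\<dots> \<le> \<bar>l - x i\<bar>" by (simp add: abs_minus_commute le_infI1)
    finally show "\<bar>0 - inf \<bar>x i - l\<bar> u\<bar> \<le> \<bar>l - x i\<bar>" .
  qed
qed

lemma subset_adh_o: "A \<subseteq> adh_o A"
proof
  fix a assume "a \<in> A"
  then have "(\<lambda>_. a) ` {()} \<subseteq> A" by simp
  then show "a \<in> adh_o A"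
    by (rule adh_oI[OF directed_set_singleton]) (simp add: order_limit_const[OF directed_set_singleton])
qed

lemma adh_o_subset_adh_uo: "adh_o A \<subseteq> adh_uo A"
  unfolding adh_o_def adh_uo_def using order_limit_imp_uo_limit by blast

text \<open>Truncating the uo-convergent sequence \<open>x n\<close> at a fixed \<open>\<bar>x m\<bar>\<close> makes it order bounded, hence
  order convergent; the limits, truncations of \<open>l\<close>, then order converge to \<open>l\<close>.\<close>

lemma adh_suo_subset_adh_o_adh_o:
  assumes F: "vector_sublattice F"
  shows "adh_suo F \<subseteq> adh_o (adh_o F)"
proof
  fix l assume "l \<in> adh_suo F"
  then obtain x :: "nat \<Rightarrow> 'a" where x: "range x \<subseteq> F" "uo_limit UNIV (\<le>) x l"
    unfolding adh_suo_def by blast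
  \<comment> \<open>An error dominated both by \<open>\<bar>x n - l\<bar>\<close> and by a fixed
    \<open>u\<close> is dominated by their infimum, which is order null by uo-convergence.\<close>
  have lim: "order_limit UNIV (\<le>) z k"
    if "0 \<le> u" "\<And>n. \<bar>k - z n\<bar> \<le> \<bar>x n - l\<bar>" "\<And>n. \<bar>k - z n\<bar> \<le> u" for z :: "nat \<Rightarrow> 'a" and k u
  proof (rule order_limit_dominated)
    show "order_limit UNIV (\<le>) (\<lambda>n. inf \<bar>x n - l\<bar> u) 0" using x(2) that(1) unfolding uo_limit_def by blast
    fix n
    have "\<bar>k - z n\<bar> \<le> inf \<bar>x n - l\<bar> u" using that(2,3) by simp
    also have "\<dots> \<le> \<bar>0 - inf \<bar>x n - l\<bar> u\<bar>" using that(1) by simp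
    finally show "\<bar>k - z n\<bar> \<le> \<bar>0 - inf \<bar>x n - l\<bar> u\<bar>" .
  qed
  have F': "sup a b \<in> F" "inf a b \<in> F" if "a \<in> F" "b \<in> F" for a b
    using that F unfolding vector_sublattice_def by blast+
  have neg: "- a \<in> F" if "a \<in> F" for a
    using that F subspace_neg[of F a] unfolding vector_sublattice_def by blast
  have xF: "x n \<in> F" for n using x(1) by blast
  have bound: "\<bar>truncation u a - truncation v b\<bar> \<le> u + v" if "0 \<le> u" "0 \<le> v" for u v a b :: 'a
    using order_trans[OF abs_triangle_ineq4 add_mono[OF abs_truncation_le[OF that(1)] abs_truncation_le[OF that(2)]]] .
  have "truncation \<bar>x m\<bar> l \<in> adh_o F" for m
  proof (rule adh_oI[OF directed_set_nat])
    have "\<bar>x m\<bar> \<in> F" unfolding abs_lattice by (intro F' neg xF)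
    then have "truncation \<bar>x m\<bar> (x n) \<in> F" for n
      unfolding truncation_def by (intro F' neg xF)
    then show "range (\<lambda>n. truncation \<bar>x m\<bar> (x n)) \<subseteq> F" by blast
    show "order_limit UNIV (\<le>) (\<lambda>n. truncation \<bar>x m\<bar> (x n)) (truncation \<bar>x m\<bar> l)"
    proof (rule lim[of "\<bar>x m\<bar> + \<bar>x m\<bar>"])
      show "\<bar>truncation \<bar>x m\<bar> l - truncation \<bar>x m\<bar> (x n)\<bar> \<le> \<bar>x n - l\<bar>" for n
        using abs_truncation_diff_le[of "\<bar>x m\<bar>" l "x n"] by (simp add: abs_minus_commute)
    qed (auto intro: bound)
  qed
  moreover have "order_limit UNIV (\<le>) (\<lambda>m. truncation \<bar>x m\<bar> l) l"
  proof (rule lim[of "\<bar>l\<bar>"])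
    fix m
    \<comment> \<open>Truncation is Lipschitz in its bound, and truncating \<open>l\<close> at
      \<open>\<bar>l\<bar>\<close> gives \<open>l\<close> back.\<close>
    have "\<bar>truncation \<bar>l\<bar> l - truncation \<bar>x m\<bar> l\<bar> \<le> \<bar>\<bar>l\<bar> - \<bar>x m\<bar>\<bar>" by (rule abs_truncation_diff_bound_le)
    also have "\<dots> \<le> \<bar>l - x m\<bar>" by (rule abs_triangle_ineq3)
    finally show "\<bar>l - truncation \<bar>x m\<bar> l\<bar> \<le> \<bar>x m - l\<bar>" by (simp add: truncation_eq abs_minus_commute)
    show "\<bar>l - truncation \<bar>x m\<bar> l\<bar> \<le> \<bar>l\<bar>" by (rule abs_diff_truncation_le) auto
  qed simp
  ultimately show "l \<in> adh_o (adh_o F)" by (intro adh_oI[OF directed_set_nat]) auto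
qed

text \<open>Closed sets are stable under \<open>c\<close>, so the closure of \<open>F\<close>
  contains everything reached by repeating \<open>c\<close>. Two rounds are allowed because order
  convergence reaches \<open>G\<close> in two.\<close>

lemma closure_of_adh_topology:
  assumes closedin: "\<And>B. closedin (adh_topology c) B \<longleftrightarrow> c B = B"
    and mono: "\<And>A B. A \<subseteq> B \<Longrightarrow> c A \<subseteq> c B" and G: "c G = G" "F \<subseteq> G" "G \<subseteq> c (c F)"
  shows "adh_topology c closure_of F = G"
proof
  have cl: "closedin (adh_topology c) G" using closedin G(1) by blast
  then show "adh_topology c closure_of F \<subseteq> G" by (rule closure_of_minimal[OF G(2)])
  let ?B = "adh_topology c closure_of F"
  have "F \<subseteq> topspace (adh_topology c)" using G(2) closedin_subset[OF cl] by blast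
  then have "F \<subseteq> ?B" by (rule closure_of_subset)
  then have "c (c F) \<subseteq> c (c ?B)" by (intro mono)
  moreover have "c ?B = ?B" using closedin closedin_closure_of by blast
  ultimately show "G \<subseteq> ?B" using G(3) by simp
qed

theorem theorem8p8:
  assumes "countable_sup_property TYPE('a::archimedean_vector_lattice)"
    and "separates_points (oc_dual :: ('a \<Rightarrow> real) set)"
  shows "(\<exists>!T :: 'a topology. Hausdorff_space T \<and> uo_Lebesgue T) \<and>
    (\<forall>(T :: 'a topology) (I :: ('a \<Rightarrow> real) set) (F :: 'a set).
       Hausdorff_space T \<and> uo_Lebesgue T \<and> oc_ideal I \<and> separates_points I \<and> vector_sublattice F \<longrightarrow>
       (\<exists>G. vector_sublattice G \<and>
          adh_seq T F = G \<and> adh_topology (adh_seq T) closure_of F = G \<and>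
          adh_suo F = G \<and> adh_topology adh_suo closure_of F = G \<and>
          adh_uo F = G \<and> adh_topology adh_uo closure_of F = G \<and>
          T closure_of F = G \<and> abs_weak_topology_of I closure_of F = G \<and>
          weak_topology_of I closure_of F = G \<and>
          adh_o (adh_o F) = G \<and> adh_topology adh_o closure_of F = G))"
proof (intro conjI allI impI)
  interpret dual: separating_ideal "oc_dual :: ('a \<Rightarrow> real) set"
    using oc_ideal_oc_dual assms(2) by unfold_locales
  show "\<exists>!T :: 'a topology. Hausdorff_space T \<and> uo_Lebesgue T"
  proof (rule ex1I)
    show "Hausdorff_space dual.uo_topology \<and> uo_Lebesgue dual.uo_topology"
      using dual.Hausdorff dual.uo_Lebesgue by blast
    fix T :: "'a topology" assume "Hausdorff_space T \<and> uo_Lebesgue T"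
    then have "Hausdorff_uo_Lebesgue T" by unfold_locales blast+
    then show "T = dual.uo_topology"
      by (rule Hausdorff_uo_Lebesgue_unique[OF assms(1) _ dual.Hausdorff_uo_Lebesgue_axioms])
  qed
next
  fix T :: "'a topology" and I :: "('a \<Rightarrow> real) set" and F :: "'a set"
  assume *: "Hausdorff_space T \<and> uo_Lebesgue T \<and> oc_ideal I \<and> separates_points I \<and> vector_sublattice F"
  then have F: "vector_sublattice F" by blast
  interpret separating_ideal I using * by unfold_locales blast+
  have "Hausdorff_uo_Lebesgue T" using * by unfold_locales blast+
  \<comment> \<open>Uniqueness identifies the given \<open>T\<close> with the topology of the given
    \<open>I\<close>, although the two were chosen independently; the description by functionals
    from \<open>I\<close> is then available for \<open>T\<close>.\<close>
  then have T: "T = uo_topology"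
    by (rule Hausdorff_uo_Lebesgue_unique[OF assms(1) _ Hausdorff_uo_Lebesgue_axioms])
  note adh = closure_eq_adh[OF assms(1), folded T]
  have top: "topspace T = UNIV" unfolding T by simp
  define G where "G = T closure_of F"
  have FG: "F \<subseteq> G" unfolding G_def T by (rule closure_of_subset) simp
  have cG: "T closure_of G = G" unfolding G_def by simp
  \<comment> \<open>Order limits are uo-limits, and the uo-adherence of the closed set
    \<open>G\<close> is \<open>G\<close>.\<close>
  have "adh_o G \<subseteq> G" using adh_o_subset_adh_uo[of G] by (simp add: adh cG)
  moreover have mono_o: "adh_o A \<subseteq> adh_o B" if "A \<subseteq> B" for A B :: "'a set"
    using that unfolding adh_o_def by blast
  moreover have "G \<subseteq> adh_o G" by (rule subset_adh_o)
  ultimately have oG: "adh_o G = G" by blast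
  have Goo: "G \<subseteq> adh_o (adh_o F)" using adh_suo_subset_adh_o_adh_o[OF F] by (simp add: adh G_def)
  have ooG: "adh_o (adh_o F) = G"
    using Goo mono_o[OF mono_o[OF FG]] by (simp add: oG)
  have weak: "weak_topology_of I closure_of F = G"
  proof
    show "weak_topology_of I closure_of F \<subseteq> G"
      using weak_closure_subset F unfolding vector_sublattice_def G_def T by blast
    show "G \<subseteq> weak_topology_of I closure_of F"
      using closure_of_adh_o[OF order_limit_weak, of F] Goo topspace_weak by blast
  qed
  have abs_weak: "abs_weak_topology_of I closure_of F = G"
  proof
    show "abs_weak_topology_of I closure_of F \<subseteq> G"
      unfolding G_def T by (rule abs_weak_closure_subset)
    show "G \<subseteq> abs_weak_topology_of I closure_of F"
      using closure_of_adh_o[OF order_limit_abs_weak, of F] Goo topspace_abs_weak by blast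
  qed
  have mono: "T closure_of A \<subseteq> T closure_of B" if "A \<subseteq> B" for A B using that by (rule closure_of_mono)
  have "adh_topology (adh_seq T) closure_of F = G"
    by (rule closure_of_adh_topology[OF closedin_seq_topology[OF top]])
      (simp_all add: adh mono cG FG G_def[symmetric])
  moreover have "adh_topology adh_suo closure_of F = G"
    by (rule closure_of_adh_topology[OF closedin_suo_topology]) (simp_all add: adh mono cG FG G_def[symmetric])
  moreover have "adh_topology adh_uo closure_of F = G"
    by (rule closure_of_adh_topology[OF closedin_uo_topology]) (simp_all add: adh mono cG FG G_def[symmetric])
  moreover have "adh_topology adh_o closure_of F = G"
    by (rule closure_of_adh_topology[OF closedin_o_topology mono_o oG FG Goo])
  moreover have "vector_sublattice G" unfolding G_def T by (rule vector_sublattice_closure[OF F])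
  ultimately show "\<exists>G. vector_sublattice G \<and>
          adh_seq T F = G \<and> adh_topology (adh_seq T) closure_of F = G \<and>
          adh_suo F = G \<and> adh_topology adh_suo closure_of F = G \<and>
          adh_uo F = G \<and> adh_topology adh_uo closure_of F = G \<and>
          T closure_of F = G \<and> abs_weak_topology_of I closure_of F = G \<and>
          weak_topology_of I closure_of F = G \<and>
          adh_o (adh_o F) = G \<and> adh_topology adh_o closure_of F = G"
    using weak abs_weak ooG by (intro exI[of _ G]) (simp add: adh G_def[symmetric])
qed

end
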